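(* Let $\mathcal{G}=(V,E)$ be a finite connected directed graph with arc graph $\mathcal{H}=(E,K)$, and let $\alpha=(\alpha_e)_{e\in E}$ and $Z=(Z_{e,e'})_{(e,e')\in K}$ be strictly positive parameters. Let $\omega\sim\mathbb{P}^{(\alpha,Z)}$ and let $P$ be the law on $\Omega_{\check K}$ of the time-reversed environment $\check\omega$. If $\mathrm{div}(\alpha)=0$, then $$P=\mathbb{P}^{(\check\alpha,\check Z)} .$$
   Context: Graphs: $E\subset V\times V$; "connected" means that for any two vertices $x,y$ there is a directed path from $x$ to $y$ or from $y$ to $x$. For $e\in E$, $\underline e$ and $\overline e$ are its tail and head, and $\check e=(\overline e,\underline e)$. The arc graph is $\mathcal{H}=(E,K)$ with $K=\{(e,e')\in E^2:\overline e=\underline e'\}$. The reversed graph is $\check{\mathcal{G}}=(V,\check E)$, $\check E=\{\check e:e\in E\}$, with arc graph $\check{\mathcal{H}}=(\check E,\check K)$, where $(\check e',\check e)\in\check K$ iff $(e,e')\in K$. For $\theta\in\mathbb{R}^E$ and $x\in V$, $\mathrm{div}(\theta)(x)=\sum_{\underline e=x}\theta(e)-\sum_{\overline e=x}\theta(e)$. Environments: $\Omega_K=\{\omega\in(0,1]^K:\sum_{e':(e,e')\in K}\omega(e,e')=1\ \forall e\in E\}$, and $\Omega_{\check K}$ is defined in the same way for $\check{\mathcal{H}}$. The law $\mathbb{P}^{(\alpha,Z)}$: for $x\in V$ let $\Delta^{(x)}=\{(u_e)_{\underline e=x}:u_e>0,\ \sum_{\underline e=x}u_e=1\}$ with its Lebesgue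 measure (product of $du_e$ over all edges exiting $x$ but one). Let the vectors $(u_e)_{\underline e=x}\in\Delta^{(x)}$, $x\in V$, be independent with density proportional to $$\prod_{e:\underline e=x}u_e^{\alpha_e-1}\ \prod_{e:\overline e=x}\Big(\sum_{e':\underline e'=x}Z_{e,e'}u_{e'}\Big)^{-\alpha_e},$$ and set, for $(e,e')\in K$, $\omega(e,e')=\dfrac{Z_{e,e'}u_{e'}}{\sum_{e'':\underline e''=\overline e}Z_{e,e''}u_{e''}}$. The law of $\omega\in\Omega_K$ is $\mathbb{P}^{(\alpha,Z)}$. The law $\mathbb{P}^{(\check\alpha,\check Z)}$ on $\Omega_{\check K}$ is defined in the same way on $\check{\mathcal{G}}$ with parameters $\check\alpha_{\check e}=\alpha_e$ and $\check Z_{\check e',\check e}=Z_{e,e'}$. Time reversal: let $\pi^\omega$ be the (unique) invariant probability measure of the Markov chain on $E$ with transition probabilities $\omega\in\Omega_K$. The time-reversed environment $\check\omega\in\Omega_{\check K}$ is $\check\omega(\check e',\check e)=\pi^\omega(e)\,\omega(e,e')\,\pi^\omega(e')^{-1}$ for $(e,e')\in K$. *)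

theory Defs
  imports "HOL-Probability.Probability"
begin

text \<open>
  A directed graph is given by \<open>V\<close> and \<open>E \<subseteq> V \<times> V\<close> (loops allowed); the tail of an edge is
  \<^const>\<open>fst\<close>, its head is \<^const>\<open>snd\<close>, its reversal is \<^const>\<open>prod.swap\<close>, and the edge set of
  the reversed graph is the converse \<open>E\<inverse>\<close>.
\<close>

definition graph_connected :: "'v set \<Rightarrow> ('v \<times> 'v) set \<Rightarrow> bool" where
  "graph_connected V E \<longleftrightarrow> (\<forall>x\<in>V. \<forall>y\<in>V. (x, y) \<in> E\<^sup>* \<or> (y, x) \<in> E\<^sup>*)"

definition out_edges :: "('v \<times> 'v) set \<Rightarrow> 'v \<Rightarrow> ('v \<times> 'v) set" where
  "out_edges E x = {e \<in> E. fst e = x}"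

definition in_edges :: "('v \<times> 'v) set \<Rightarrow> 'v \<Rightarrow> ('v \<times> 'v) set" where
  "in_edges E x = {e \<in> E. snd e = x}"

definition arcs :: "('v \<times> 'v) set \<Rightarrow> (('v \<times> 'v) \<times> ('v \<times> 'v)) set" where
  "arcs E = {(e, e'). e \<in> E \<and> e' \<in> E \<and> snd e = fst e'}"

definition divergence :: "('v \<times> 'v) set \<Rightarrow> ('v \<times> 'v \<Rightarrow> real) \<Rightarrow> 'v \<Rightarrow> real" where
  "divergence E \<theta> x = (\<Sum>e\<in>out_edges E x. \<theta> e) - (\<Sum>e\<in>in_edges E x. \<theta> e)"


subsection \<open>Environments and their time reversal\<close>

definition environments :: "('v \<times> 'v) set \<Rightarrow> (('v \<times> 'v) \<times> ('v \<times> 'v) \<Rightarrow> real) set" where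
  "environments E = {\<omega> \<in> arcs E \<rightarrow>\<^sub>E {0<..1}. \<forall>e\<in>E. (\<Sum>e' | (e, e') \<in> arcs E. \<omega> (e, e')) = 1}"

definition env_space :: "('v \<times> 'v) set \<Rightarrow> (('v \<times> 'v) \<times> ('v \<times> 'v) \<Rightarrow> real) measure" where
  "env_space E = restrict_space (\<Pi>\<^sub>M k\<in>arcs E. borel) (environments E)"

definition invariant_prob ::
    "('v \<times> 'v) set \<Rightarrow> (('v \<times> 'v) \<times> ('v \<times> 'v) \<Rightarrow> real) \<Rightarrow> ('v \<times> 'v \<Rightarrow> real) \<Rightarrow> bool" where
  "invariant_prob E \<omega> \<pi> \<longleftrightarrow>
     \<pi> \<in> E \<rightarrow>\<^sub>E {0..} \<and> (\<Sum>e\<in>E. \<pi> e) = 1 \<and>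
     (\<forall>e'\<in>E. (\<Sum>e | (e, e') \<in> arcs E. \<pi> e * \<omega> (e, e')) = \<pi> e')"

text \<open>Uniqueness holds as soon as the graph is strongly connected and has an edge; this is the
  case for a connected graph with an edge that carries a positive \<open>\<alpha>\<close> of divergence zero.\<close>

definition the_invariant_prob ::
    "('v \<times> 'v) set \<Rightarrow> (('v \<times> 'v) \<times> ('v \<times> 'v) \<Rightarrow> real) \<Rightarrow> ('v \<times> 'v \<Rightarrow> real)" where
  "the_invariant_prob E \<omega> = (THE \<pi>. invariant_prob E \<omega> \<pi>)"

text \<open>An arc \<open>(f, g)\<close> of the reversed graph is \<open>(swap e', swap e)\<close> for the arc
  \<open>(e, e') = (swap g, swap f)\<close> of \<open>E\<close>.\<close>

definition time_reversal ::
    "('v \<times> 'v) set \<Rightarrow> (('v \<times> 'v) \<times> ('v \<times> 'v) \<Rightarrow> real) \<Rightarrow> (('v \<times> 'v) \<times> ('v \<times> 'v) \<Rightarrow> real)" where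
  "time_reversal E \<omega> =
     (\<lambda>(f, g)\<in>arcs (E\<inverse>).
        the_invariant_prob E \<omega> (prod.swap g) * \<omega> (prod.swap g, prod.swap f)
          / the_invariant_prob E \<omega> (prod.swap f))"

definition rev_edge_fun :: "('v \<times> 'v \<Rightarrow> real) \<Rightarrow> ('v \<times> 'v \<Rightarrow> real)" where
  "rev_edge_fun \<alpha> f = \<alpha> (prod.swap f)"

definition rev_arc_fun ::
    "(('v \<times> 'v) \<times> ('v \<times> 'v) \<Rightarrow> real) \<Rightarrow> (('v \<times> 'v) \<times> ('v \<times> 'v) \<Rightarrow> real)" where
  "rev_arc_fun Z = (\<lambda>(f, g). Z (prod.swap g, prod.swap f))"


subsection \<open>The law of the random environment\<close>

definition open_simplex :: "'i set \<Rightarrow> ('i \<Rightarrow> real) set" where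
  "open_simplex S = {u \<in> S \<rightarrow>\<^sub>E {0<..}. (\<Sum>i\<in>S. u i) = 1}"

text \<open>Lebesgue measure on the open simplex: Lebesgue measure in all coordinates but one, the
  remaining coordinate \<open>r\<close> being determined by the others. The result does not depend on the
  choice of \<open>r \<in> S\<close>; for a singleton \<open>S\<close> it is the unit mass at the only point, and for
  empty \<open>S\<close> it is the zero measure on the empty space.\<close>

definition simplex_lebesgue :: "'i set \<Rightarrow> ('i \<Rightarrow> real) measure" where
  "simplex_lebesgue S =
     (let r = (SOME r. r \<in> S) in
      distr
        (restrict_space (\<Pi>\<^sub>M i\<in>S - {r}. lborel)
           {v. (\<forall>i\<in>S - {r}. 0 < v i) \<and> (\<Sum>i\<in>S - {r}. v i) < 1})
        (restrict_space (\<Pi>\<^sub>M i\<in>S. borel) (open_simplex S))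
        (\<lambda>v. v(r := 1 - (\<Sum>i\<in>S - {r}. v i))))"

definition vertex_weight ::
    "('v \<times> 'v) set \<Rightarrow> ('v \<times> 'v \<Rightarrow> real) \<Rightarrow> (('v \<times> 'v) \<times> ('v \<times> 'v) \<Rightarrow> real)
      \<Rightarrow> 'v \<Rightarrow> ('v \<times> 'v \<Rightarrow> real) \<Rightarrow> real" where
  "vertex_weight E \<alpha> Z x u =
     (\<Prod>e\<in>out_edges E x. u e powr (\<alpha> e - 1)) *
     (\<Prod>e\<in>in_edges E x. (\<Sum>e'\<in>out_edges E x. Z (e, e') * u e') powr (- \<alpha> e))"

definition vertex_law ::
    "('v \<times> 'v) set \<Rightarrow> ('v \<times> 'v \<Rightarrow> real) \<Rightarrow> (('v \<times> 'v) \<times> ('v \<times> 'v) \<Rightarrow> real)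
      \<Rightarrow> 'v \<Rightarrow> ('v \<times> 'v \<Rightarrow> real) measure" where
  "vertex_law E \<alpha> Z x =
     (let L = simplex_lebesgue (out_edges E x) in
      density L (\<lambda>u. ennreal (vertex_weight E \<alpha> Z x u)
                       / (\<integral>\<^sup>+ u'. ennreal (vertex_weight E \<alpha> Z x u') \<partial>L)))"

definition env_of ::
    "('v \<times> 'v) set \<Rightarrow> (('v \<times> 'v) \<times> ('v \<times> 'v) \<Rightarrow> real) \<Rightarrow> ('v \<Rightarrow> 'v \<times> 'v \<Rightarrow> real)
      \<Rightarrow> (('v \<times> 'v) \<times> ('v \<times> 'v) \<Rightarrow> real)" where
  "env_of E Z u =
     (\<lambda>(e, e')\<in>arcs E.
        Z (e, e') * u (snd e) e' / (\<Sum>e''\<in>out_edges E (snd e). Z (e, e'') * u (snd e) e''))"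

definition env_law ::
    "'v set \<Rightarrow> ('v \<times> 'v) set \<Rightarrow> ('v \<times> 'v \<Rightarrow> real) \<Rightarrow> (('v \<times> 'v) \<times> ('v \<times> 'v) \<Rightarrow> real)
      \<Rightarrow> (('v \<times> 'v) \<times> ('v \<times> 'v) \<Rightarrow> real) measure" where
  "env_law V E \<alpha> Z = distr (\<Pi>\<^sub>M x\<in>V. vertex_law E \<alpha> Z x) (env_space E) (env_of E Z)"

end

theory Submission imports Defs begin

text \<open>
  The law of the reversed environment is identified through functionals of the environment that
  do not feel the reversal and whose expectations are explicit.

  Write \<open>s(e) = (\<Sum>e'. Z(e,e') u(e'))\<close>, so that \<open>\<omega>(e,e') = Z(e,e') u(e') / s(e)\<close>. Take exponents
  \<open>\<kappa>\<close> on the arcs that are balanced: every edge is entered as often as it is left, as along a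
  family of closed walks. In the monomial \<open>\<omega>\<^sup>\<kappa>\<close> the invariant measure cancels, so \<open>\<omega>\<close> and its
  time reversal give it the same value (\<open>monomial_time_reversal\<close>). Moreover
  \<open>\<omega>\<^sup>\<kappa> = Z\<^sup>\<kappa> (\<Prod>e. (u(e) / s(e))\<^sup>n\<^sup>(\<^sup>e\<^sup>))\<close> with \<open>n(e)\<close> the number of visits to \<open>e\<close>. Multiplying the
  density of \<open>u\<close> by such a factor merely shifts \<open>\<alpha>\<close> to \<open>\<alpha> + n\<close>, so the expectation of \<open>\<omega>\<^sup>\<kappa>\<close> is
  \<open>Z\<^sup>\<kappa>\<close> times the quotient of the products over the vertices of the normalizing constants for
  \<open>\<alpha> + n\<close> and for \<open>\<alpha>\<close> (\<open>expectation_monomial\<close>).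

  Both \<open>\<alpha>\<close> and \<open>\<alpha> + n\<close> have divergence zero. It is therefore enough that, for parameters of
  divergence zero, the product of the normalizing constants is the same for the graph and for its
  reversal. At one vertex, Feynman's formula replaces the powers \<open>s(e)\<^sup>-\<^sup>\<alpha>\<^sup>(\<^sup>e\<^sup>)\<close> of the incoming
  edges by an integral over a second simplex. The normalizing constant, times the Gamma factors of
  the incoming edges, becomes a double integral over the simplices of the incoming and of the
  outgoing edges, with kernel \<open>(\<Sum>e e'. \<tau>(e) Z(e,e') u(e'))\<close> to the power minus the total incoming
  weight. Equality of the total weights in and out makes it symmetric in the two simplices
  (\<open>simplex_weight_integral_duality\<close>). In the product over the vertices the Gamma factors cancel,
  since every edge has one head and one tail (\<open>prod_vertex_const_converse\<close>).

  So balanced monomials have the same expectations under the law of the reversed environment and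
  under the law on the reversed graph. Powers of balanced monomials are again balanced monomials,
  and monomials take values in the unit interval; hence moments determine the joint law of finitely
  many of them, which is the same on both sides (\<open>distr_PiM_eqI_moments\<close>).

  Finally, finitely many balanced monomials determine an environment, by a measurable formula
  (\<open>reconstruct_eq\<close>). Fix a root edge \<open>r\<close> and let \<open>h(e)\<close> be the weight of a path from \<open>r\<close> to \<open>e\<close>.
  The matrix \<open>h(e) \<omega>(e,e') / h(e')\<close> is a quotient of weights of closed walks. Its positive left
  eigenvector for the eigenvalue 1 is a limit of sums over walks from \<open>r\<close> that do not return to
  \<open>r\<close>, and conjugation by this eigenvector yields the time reversal of \<open>\<omega>\<close>. The same formula
  recovers an environment of the reversed graph from its own monomials. Irreducibility, used for
  the invariant measure and for the eigenvector, comes from the positive divergence-free \<open>\<alpha>\<close>: no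
  set of vertices can be entered without being left (\<open>reachable_back_if_divergence_free\<close>).
\<close>

section \<open>Lebesgue measure on the simplex\<close>

lemma nn_integral_PiM_lborel_scale:
  fixes c :: real
  assumes "finite J" "c > 0"
    and "F \<in> borel_measurable (\<Pi>\<^sub>M j\<in>J. (lborel :: real measure))"
  shows "(\<integral>\<^sup>+v. F v \<partial>(\<Pi>\<^sub>M j\<in>J. (lborel :: real measure)))
    = ennreal (c ^ card J) * (\<integral>\<^sup>+v. F (\<lambda>j\<in>J. c * v j) \<partial>(\<Pi>\<^sub>M j\<in>J. (lborel :: real measure)))"
  using assms(1,3)
proof (induction J arbitrary: F rule: finite_induct)
  case empty
  then show ?case
    by (simp add: PiM_empty nn_integral_count_space_finite restrict_def)
next
  case (insert i J)
  interpret product_sigma_finite "\<lambda>_. lborel :: real measure" by standard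
  note [measurable] = insert.prems
  have cpow: "ennreal (c ^ card (insert i J)) = ennreal c * ennreal (c ^ card J)"
    using insert.hyps \<open>c > 0\<close> by (simp add: ennreal_mult)
  let ?P = "\<Pi>\<^sub>M j\<in>J. (lborel :: real measure)"
  have upd[measurable]: "(\<lambda>(x, y). x(i := y)) \<in> ?P \<Otimes>\<^sub>M lborel \<rightarrow>\<^sub>M (\<Pi>\<^sub>M j\<in>insert i J. (lborel :: real measure))"
    by (rule measurable_add_dim)
  have scale[measurable]: "(\<lambda>v. \<lambda>j\<in>A. c * v j) \<in> (\<Pi>\<^sub>M j\<in>A. lborel) \<rightarrow>\<^sub>M (\<Pi>\<^sub>M j\<in>A. (lborel :: real measure))" for A :: "'a set"
    by measurable
  have mF: "(\<lambda>x. \<integral>\<^sup>+y. F (x(i := c * y)) \<partial>lborel) \<in> borel_measurable ?P"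
  proof -
    have "(\<lambda>(x, y). F (x(i := c * y))) \<in> borel_measurable (?P \<Otimes>\<^sub>M lborel)"
      using measurable_compose[OF _ insert.prems, of "\<lambda>(x, y). x(i := c * y)" "?P \<Otimes>\<^sub>M lborel"]
        measurable_compose[OF _ upd, of "\<lambda>(x, y). (x, c * y)" "?P \<Otimes>\<^sub>M lborel"]
      by (simp add: split_beta')
    then show ?thesis
      using lborel.borel_measurable_nn_integral[of "\<lambda>x y. F (x(i := c * y))" ?P] by (simp add: split_beta')
  qed
  have "(\<integral>\<^sup>+v. F v \<partial>(\<Pi>\<^sub>M j\<in>insert i J. (lborel :: real measure)))
    = (\<integral>\<^sup>+x. (\<integral>\<^sup>+y. F (x(i := y)) \<partial>lborel) \<partial>?P)"
    by (rule product_nn_integral_insert) (use insert in auto)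
  also have "\<dots> = (\<integral>\<^sup>+x. ennreal c * (\<integral>\<^sup>+y. F (x(i := c * y)) \<partial>lborel) \<partial>?P)"
  proof (rule nn_integral_cong)
    fix x assume x: "x \<in> space ?P"
    have "(\<lambda>y. F (x(i := y))) \<in> borel_measurable lborel"
      using measurable_comp[OF measurable_component_update[OF x insert.hyps(2)] insert.prems]
      by (simp add: comp_def)
    then show "(\<integral>\<^sup>+y. F (x(i := y)) \<partial>lborel) = ennreal c * (\<integral>\<^sup>+y. F (x(i := c * y)) \<partial>lborel)"
      using nn_integral_real_affine[of "\<lambda>y. F (x(i := y))" c 0] \<open>c > 0\<close> by simp
  qed
  also have "\<dots> = ennreal c * (\<integral>\<^sup>+x. (\<integral>\<^sup>+y. F (x(i := c * y)) \<partial>lborel) \<partial>?P)"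
    by (rule nn_integral_cmult[OF mF])
  also have "(\<integral>\<^sup>+x. (\<integral>\<^sup>+y. F (x(i := c * y)) \<partial>lborel) \<partial>?P)
      = ennreal (c ^ card J) * (\<integral>\<^sup>+x. (\<integral>\<^sup>+y. F ((\<lambda>j\<in>J. c * x j)(i := c * y)) \<partial>lborel) \<partial>?P)"
    by (rule insert.IH[OF mF])
  also have "(\<integral>\<^sup>+x. (\<integral>\<^sup>+y. F ((\<lambda>j\<in>J. c * x j)(i := c * y)) \<partial>lborel) \<partial>?P)
      = (\<integral>\<^sup>+x. (\<integral>\<^sup>+y. F (\<lambda>j\<in>insert i J. c * (x(i := y)) j) \<partial>lborel) \<partial>?P)"
  proof -
    have "(\<lambda>j\<in>J. c * x j)(i := c * y) = (\<lambda>j\<in>insert i J. c * (x(i := y)) j)" for x y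
      using insert.hyps(2) by (auto simp: fun_eq_iff restrict_def)
    then show ?thesis by simp
  qed
  also have "\<dots> = (\<integral>\<^sup>+v. F (\<lambda>j\<in>insert i J. c * v j) \<partial>(\<Pi>\<^sub>M j\<in>insert i J. (lborel :: real measure)))"
    by (rule product_nn_integral_insert[symmetric]) (use insert in \<open>auto intro!: measurable_compose[OF scale]\<close>)
  finally show ?case
    by (simp only: cpow mult.assoc)
qed

definition simplex_chart :: "'i set \<Rightarrow> 'i \<Rightarrow> ('i \<Rightarrow> real) set" where
  "simplex_chart S r = {v. (\<forall>i\<in>S - {r}. 0 < v i) \<and> (\<Sum>i\<in>S - {r}. v i) < 1}"

definition simplex_point :: "'i set \<Rightarrow> 'i \<Rightarrow> ('i \<Rightarrow> real) \<Rightarrow> 'i \<Rightarrow> real" where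
  "simplex_point S r v = v(r := 1 - (\<Sum>i\<in>S - {r}. v i))"

lemma simplex_lebesgue_eq:
  "simplex_lebesgue S = (let r = (SOME r. r \<in> S) in
      distr (restrict_space (\<Pi>\<^sub>M i\<in>S - {r}. lborel) (simplex_chart S r))
        (restrict_space (\<Pi>\<^sub>M i\<in>S. borel) (open_simplex S)) (simplex_point S r))"
  unfolding simplex_lebesgue_def simplex_chart_def simplex_point_def[abs_def] ..

lemma sets_simplex_lebesgue:
  "sets (simplex_lebesgue S) = sets (restrict_space (\<Pi>\<^sub>M i\<in>S. borel) (open_simplex S))"
  by (simp add: simplex_lebesgue_eq Let_def)

lemma space_simplex_lebesgue: "space (simplex_lebesgue S) = open_simplex S"
  by (auto simp: simplex_lebesgue_eq Let_def space_restrict_space space_PiM open_simplex_def PiE_def)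

lemma measurable_simplex_lebesgueI:
  assumes "f \<in> (\<Pi>\<^sub>M i\<in>S. (borel :: real measure)) \<rightarrow>\<^sub>M N"
  shows "f \<in> simplex_lebesgue S \<rightarrow>\<^sub>M N"
  using measurable_restrict_space1[OF assms, of "open_simplex S"]
  by (simp add: measurable_cong_sets[OF sets_simplex_lebesgue refl])

lemma measurable_simplex_point:
  assumes "r \<in> S" and fin: "finite S"
  shows "simplex_point S r \<in> (\<Pi>\<^sub>M i\<in>S - {r}. (lborel :: real measure)) \<rightarrow>\<^sub>M (\<Pi>\<^sub>M i\<in>S. (borel :: real measure))"
proof (rule measurable_PiM_single')
  show "simplex_point S r \<in> space (\<Pi>\<^sub>M i\<in>S - {r}. (lborel :: real measure)) \<rightarrow> (\<Pi>\<^sub>E i\<in>S. space borel)"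
    using assms by (auto simp: simplex_point_def space_PiM PiE_def extensional_def)
  fix i assume "i \<in> S"
  then show "(\<lambda>v. simplex_point S r v i) \<in> (\<Pi>\<^sub>M i\<in>S - {r}. (lborel :: real measure)) \<rightarrow>\<^sub>M (borel :: real measure)"
    by (cases "i = r") (auto simp: simplex_point_def)
qed

lemma measurable_simplex_chart[measurable]:
  assumes fin: "finite S"
  shows "Measurable.pred (\<Pi>\<^sub>M i\<in>S - {r}. (lborel :: real measure)) (\<lambda>v. v \<in> simplex_chart S r)"
  using assms unfolding simplex_chart_def mem_Collect_eq
  by (intro pred_intros_logic pred_intros_finite borel_measurable_pred_less) auto

text \<open>
  The defining chart, as a formula for integrals; everything else about the simplex goes through it.
\<close>

lemma nn_integral_simplex_lebesgue:
  assumes fin: "finite S" and "S \<noteq> {}" and r: "r = (SOME r. r \<in> S)"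
    and f: "f \<in> borel_measurable (\<Pi>\<^sub>M i\<in>S. (borel :: real measure))"
  shows "(\<integral>\<^sup>+u. f u \<partial>simplex_lebesgue S)
    = (\<integral>\<^sup>+v. f (simplex_point S r v) * indicator (simplex_chart S r) v \<partial>(\<Pi>\<^sub>M i\<in>S - {r}. (lborel :: real measure)))"
proof -
  let ?P = "\<Pi>\<^sub>M i\<in>S - {r}. (lborel :: real measure)"
  have rS: "r \<in> S" using assms(2) r by (simp add: some_in_eq)
  have chart: "simplex_chart S r \<inter> space ?P \<in> sets ?P"
    using measurable_simplex_chart[OF fin, of r] by (simp add: pred_def Int_def conj_commute)
  have sp: "simplex_point S r \<in> restrict_space ?P (simplex_chart S r) \<rightarrow>\<^sub>M restrict_space (\<Pi>\<^sub>M i\<in>S. borel) (open_simplex S)"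
  proof (rule measurable_restrict_space2)
    show "simplex_point S r \<in> space (restrict_space ?P (simplex_chart S r)) \<rightarrow> open_simplex S"
    proof
      fix v assume "v \<in> space (restrict_space ?P (simplex_chart S r))"
      then have v: "v \<in> simplex_chart S r" "v \<in> extensional (S - {r})"
        by (auto simp: space_restrict_space space_PiM PiE_def)
      then have "(\<Sum>i\<in>S. simplex_point S r v i) = 1"
        using rS fin by (simp add: simplex_point_def sum.remove[of S r])
      with v rS show "simplex_point S r v \<in> open_simplex S"
        by (auto simp: simplex_point_def simplex_chart_def open_simplex_def PiE_def extensional_def)
    qed
    show "simplex_point S r \<in> restrict_space ?P (simplex_chart S r) \<rightarrow>\<^sub>M (\<Pi>\<^sub>M i\<in>S. borel)"
      by (rule measurable_restrict_space1) (rule measurable_simplex_point[OF rS fin])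
  qed
  show ?thesis
    unfolding simplex_lebesgue_eq Let_def r[symmetric]
    using nn_integral_distr[OF sp, of f] f chart
    by (simp add: measurable_restrict_space1 nn_integral_restrict_space)
qed

text \<open>
  The coordinates of a chart lie in the unit cube, which bounds the total mass by 1.
\<close>

lemma finite_measure_simplex_lebesgue:
  assumes fin: "finite S" and "S \<noteq> {}"
  shows "finite_measure (simplex_lebesgue S)"
proof
  define r where "r = (SOME r. r \<in> S)"
  interpret product_sigma_finite "\<lambda>_. lborel :: real measure" by standard
  let ?P = "\<Pi>\<^sub>M i\<in>S - {r}. (lborel :: real measure)"
  have "emeasure (simplex_lebesgue S) (space (simplex_lebesgue S)) = (\<integral>\<^sup>+u. 1 \<partial>simplex_lebesgue S)"
    by simp
  also have "\<dots> = (\<integral>\<^sup>+v. indicator (simplex_chart S r) v \<partial>?P)"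
    using nn_integral_simplex_lebesgue[OF assms r_def, of "\<lambda>_. 1"] by simp
  also have "\<dots> \<le> (\<integral>\<^sup>+v. (\<Prod>i\<in>S - {r}. indicator {0..1} (v i)) \<partial>?P)"
  proof (rule nn_integral_mono)
    fix v :: "'a \<Rightarrow> real"
    have "v i \<in> {0..1}" if "v \<in> simplex_chart S r" "i \<in> S - {r}" for i
    proof -
      have "v i \<le> (\<Sum>i\<in>S - {r}. v i)"
        by (rule member_le_sum) (use that fin in \<open>auto simp: simplex_chart_def less_imp_le\<close>)
      with that show ?thesis by (auto simp: simplex_chart_def less_imp_le)
    qed
    then show "indicator (simplex_chart S r) v \<le> (\<Prod>i\<in>S - {r}. indicator {0..1} (v i) :: ennreal)"
      by (auto simp: indicator_def)
  qed
  also have "\<dots> = (\<Prod>i\<in>S - {r}. (\<integral>\<^sup>+x. indicator {0..1} x \<partial>(lborel :: real measure)))"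
    by (rule product_nn_integral_prod) (use fin in auto)
  also have "\<dots> = 1" by simp
  finally show "emeasure (simplex_lebesgue S) (space (simplex_lebesgue S)) \<noteq> \<infinity>"
    by (auto simp: top_unique)
qed

text \<open>
  Integration over the orthant along rays through the simplex. With \<open>r\<close> the coordinate that
  \<^const>\<open>simplex_lebesgue\<close> singles out, the shift of \<open>t r\<close> to \<open>R = (\<Sum>i\<in>S. t i)\<close> and the scaling of
  the other coordinates by \<open>R\<close> carry Lebesgue measure to \<open>R\<^sup>|\<^sup>S\<^sup>|\<^sup>-\<^sup>1 dR\<close> times the measure on the
  simplex.
\<close>

lemma nn_integral_orthant_polar:
  assumes fin: "finite S" and ne: "S \<noteq> {}"
    and g: "g \<in> borel_measurable (\<Pi>\<^sub>M i\<in>S. (borel :: real measure))"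
  shows "(\<integral>\<^sup>+t. g t * indicator {t. \<forall>i\<in>S. 0 < t i} t \<partial>(\<Pi>\<^sub>M i\<in>S. (lborel :: real measure)))
    = (\<integral>\<^sup>+\<tau>. (\<integral>\<^sup>+R. g (\<lambda>i\<in>S. R * \<tau> i) * ennreal (R ^ (card S - 1)) * indicator {0<..} R \<partial>lborel)
         \<partial>simplex_lebesgue S)"
proof -
  define r where "r = (SOME r. r \<in> S)"
  define J where "J = S - {r}"
  have rS: "r \<in> S" using ne by (simp add: some_in_eq r_def)
  have S: "S = insert r J" and rJ: "r \<notin> J" and finJ: "finite J" and cJ: "card J = card S - 1"
    using rS fin by (auto simp: J_def)
  interpret product_sigma_finite "\<lambda>_. lborel :: real measure" by standard
  interpret PJ: sigma_finite_measure "\<Pi>\<^sub>M i\<in>J. (lborel :: real measure)"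
    by (rule sigma_finite[OF finJ])
  interpret PL: pair_sigma_finite "\<Pi>\<^sub>M i\<in>J. (lborel :: real measure)" "lborel :: real measure" ..
  let ?P = "\<Pi>\<^sub>M i\<in>J. (lborel :: real measure)"
  let ?B = "\<Pi>\<^sub>M i\<in>S. (borel :: real measure)"
  have sets_eq: "sets (\<Pi>\<^sub>M i\<in>S. (lborel :: real measure)) = sets ?B"
    by (rule sets_PiM_cong) auto
  define H where "H x R = g (x(r := R - sum x J)) * indicator {x. (\<forall>j\<in>J. 0 < x j) \<and> sum x J < R} x"
    for x :: "'a \<Rightarrow> real" and R
  have gS: "(\<lambda>t. g t * indicator {t. \<forall>i\<in>S. 0 < t i} t) \<in> borel_measurable (\<Pi>\<^sub>M i\<in>S. (lborel :: real measure))"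
  proof -
    have "(\<lambda>t. g t * (if \<forall>i\<in>S. 0 < t i then 1 else 0)) \<in> borel_measurable ?B"
      using fin g by measurable
    then show ?thesis
      unfolding measurable_cong_sets[OF sets_eq refl] indicator_def of_bool_def mem_Collect_eq .
  qed
  have mpt: "(\<lambda>(x, R). x(r := R - sum x J)) \<in> ?P \<Otimes>\<^sub>M (lborel :: real measure) \<rightarrow>\<^sub>M ?B"
  proof (rule measurable_PiM_single')
    show "(\<lambda>(x, R). x(r := R - sum x J)) \<in> space (?P \<Otimes>\<^sub>M (lborel :: real measure)) \<rightarrow> (\<Pi>\<^sub>E i\<in>S. space borel)"
      by (auto simp: space_pair_measure space_PiM PiE_def extensional_def S)
    fix i assume "i \<in> S"
    then show "(\<lambda>p. (case p of (x, R) \<Rightarrow> x(r := R - sum x J)) i)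
      \<in> ?P \<Otimes>\<^sub>M (lborel :: real measure) \<rightarrow>\<^sub>M (borel :: real measure)"
      by (cases "i = r") (auto simp: split_beta' S)
  qed
  have mH: "(\<lambda>(x, R). H x R) \<in> borel_measurable (?P \<Otimes>\<^sub>M (lborel :: real measure))"
  proof -
    have "(\<lambda>p. g (case p of (x, R) \<Rightarrow> x(r := R - sum x J)) *
       (if (\<forall>j\<in>J. 0 < fst p j) \<and> sum (fst p) J < snd p then 1 else 0)) \<in> borel_measurable (?P \<Otimes>\<^sub>M (lborel :: real measure))"
      using measurable_compose[OF mpt g] finJ by measurable
    then show ?thesis
      unfolding H_def by (simp add: split_beta' indicator_def of_bool_def)
  qed
  have mHR: "(\<lambda>x. H x R) \<in> borel_measurable ?P" for R
    using measurable_compose[OF measurable_Pair2'[of R lborel ?P] mH] by simp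
  have chart: "(\<lambda>j\<in>J. R * v j) \<in> {x. (\<forall>j\<in>J. 0 < x j) \<and> sum x J < R} \<longleftrightarrow> v \<in> simplex_chart S r" if "R > 0" for R v
    using that by (auto simp: simplex_chart_def J_def[symmetric] zero_less_mult_iff simp flip: sum_distrib_left)
  have pt: "(\<lambda>j\<in>J. R * v j)(r := R - sum (\<lambda>j\<in>J. R * v j) J) = (\<lambda>i\<in>S. R * simplex_point S r v i)" for R v
    by (auto simp: fun_eq_iff simplex_point_def J_def[symmetric] S rJ restrict_def algebra_simps simp flip: sum_distrib_left)
  have mray: "(\<lambda>(v, R). \<lambda>i\<in>S. R * simplex_point S r v i) \<in> ?P \<Otimes>\<^sub>M (lborel :: real measure) \<rightarrow>\<^sub>M ?B"
  proof -
    have [measurable]: "(\<lambda>v. simplex_point S r v i) \<in> borel_measurable ?P" if "i \<in> S" for i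
      using measurable_compose[OF measurable_simplex_point[OF rS fin] measurable_component_singleton[OF that]]
      by (simp add: J_def)
    show ?thesis by (simp add: split_beta') measurable
  qed
  have [measurable]: "Measurable.pred ?P (\<lambda>v. v \<in> simplex_chart S r)"
    using measurable_simplex_chart[OF fin, of r] by (simp add: J_def)
  have mray': "(\<lambda>(v, R). g (\<lambda>i\<in>S. R * simplex_point S r v i)
          * ennreal (R ^ (card S - 1)) * indicator {0<..} R * indicator (simplex_chart S r) v)
      \<in> borel_measurable (?P \<Otimes>\<^sub>M (lborel :: real measure))"
    using measurable_compose[OF mray g] by (simp add: split_beta') measurable
  have "(\<integral>\<^sup>+t. g t * indicator {t. \<forall>i\<in>S. 0 < t i} t \<partial>(\<Pi>\<^sub>M i\<in>S. (lborel :: real measure)))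
    = (\<integral>\<^sup>+x. (\<integral>\<^sup>+y. g (x(r := y)) * indicator {t. \<forall>i\<in>S. 0 < t i} (x(r := y)) \<partial>lborel) \<partial>?P)"
    using gS unfolding S by (intro product_nn_integral_insert finJ rJ)
  also have "\<dots> = (\<integral>\<^sup>+x. (\<integral>\<^sup>+R. H x R \<partial>lborel) \<partial>?P)"
  proof (rule nn_integral_cong)
    fix x assume x: "x \<in> space ?P"
    let ?h = "\<lambda>y. g (x(r := y)) * indicator {t. \<forall>i\<in>S. 0 < t i} (x(r := y))"
    have "?h \<in> borel_measurable borel"
      using measurable_comp[OF measurable_component_update[OF x rJ] gS[unfolded S]]
      by (simp add: comp_def S)
    from nn_integral_real_affine[OF this, of 1 "- sum x J"]
    have "(\<integral>\<^sup>+y. ?h y \<partial>lborel) = (\<integral>\<^sup>+R. ?h (R - sum x J) \<partial>lborel)" by simp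
    also have "\<dots> = (\<integral>\<^sup>+R. H x R \<partial>lborel)"
      using rJ by (intro nn_integral_cong) (auto simp: H_def S indicator_def)
    finally show "(\<integral>\<^sup>+y. ?h y \<partial>lborel) = (\<integral>\<^sup>+R. H x R \<partial>lborel)" by simp
  qed
  also have "\<dots> = (\<integral>\<^sup>+R. (\<integral>\<^sup>+x. H x R \<partial>?P) \<partial>lborel)"
    by (rule PL.Fubini'[symmetric, OF mH])
  also have "\<dots> = (\<integral>\<^sup>+R. (\<integral>\<^sup>+v. g (\<lambda>i\<in>S. R * simplex_point S r v i)
          * ennreal (R ^ (card S - 1)) * indicator {0<..} R * indicator (simplex_chart S r) v \<partial>?P) \<partial>lborel)"
  proof (rule nn_integral_cong)
    fix R :: real
    show "(\<integral>\<^sup>+x. H x R \<partial>?P) = (\<integral>\<^sup>+v. g (\<lambda>i\<in>S. R * simplex_point S r v i)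
          * ennreal (R ^ (card S - 1)) * indicator {0<..} R * indicator (simplex_chart S r) v \<partial>?P)"
    proof (cases "R > 0")
      case True
      have "(\<integral>\<^sup>+x. H x R \<partial>?P) = ennreal (R ^ card J) * (\<integral>\<^sup>+v. H (\<lambda>j\<in>J. R * v j) R \<partial>?P)"
        by (rule nn_integral_PiM_lborel_scale[OF finJ True mHR])
      also have "\<dots> = (\<integral>\<^sup>+v. ennreal (R ^ card J) * H (\<lambda>j\<in>J. R * v j) R \<partial>?P)"
      proof (rule nn_integral_cmult[symmetric])
        have "(\<lambda>v. \<lambda>j\<in>J. R * v j) \<in> ?P \<rightarrow>\<^sub>M ?P" by measurable
        from measurable_compose[OF this mHR] show "(\<lambda>v. H (\<lambda>j\<in>J. R * v j) R) \<in> borel_measurable ?P" .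
      qed
      also have "\<dots> = (\<integral>\<^sup>+v. g (\<lambda>i\<in>S. R * simplex_point S r v i)
          * ennreal (R ^ (card S - 1)) * indicator {0<..} R * indicator (simplex_chart S r) v \<partial>?P)"
        using True chart[OF True]
        by (intro nn_integral_cong) (simp only: H_def pt cJ, auto simp: indicator_def mult_ac)
      finally show ?thesis .
    next
      case False
      then have "H x R = 0" for x
        using sum_nonneg[of J x] by (auto simp: H_def indicator_def not_less) (meson less_imp_le less_le_trans not_less order.trans)
      with False show ?thesis by simp
    qed
  qed
  also have "\<dots> = (\<integral>\<^sup>+v. (\<integral>\<^sup>+R. g (\<lambda>i\<in>S. R * simplex_point S r v i)
          * ennreal (R ^ (card S - 1)) * indicator {0<..} R * indicator (simplex_chart S r) v \<partial>lborel) \<partial>?P)"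
    by (rule PL.Fubini'[OF mray'])
  also have "\<dots> = (\<integral>\<^sup>+v. (\<integral>\<^sup>+R. g (\<lambda>i\<in>S. R * simplex_point S r v i)
          * ennreal (R ^ (card S - 1)) * indicator {0<..} R \<partial>lborel) * indicator (simplex_chart S r) v \<partial>?P)"
    by (intro nn_integral_cong) (auto simp: indicator_def)
  also have "\<dots> = (\<integral>\<^sup>+\<tau>. (\<integral>\<^sup>+R. g (\<lambda>i\<in>S. R * \<tau> i) * ennreal (R ^ (card S - 1)) * indicator {0<..} R \<partial>lborel)
         \<partial>simplex_lebesgue S)"
  proof (subst nn_integral_simplex_lebesgue[OF fin ne r_def])
    have "(\<lambda>(\<tau>, R). \<lambda>i\<in>S. R * \<tau> i) \<in> ?B \<Otimes>\<^sub>M (lborel :: real measure) \<rightarrow>\<^sub>M ?B"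
      by (simp add: split_beta') measurable
    from measurable_compose[OF this g]
    show "(\<lambda>\<tau>. \<integral>\<^sup>+R. g (\<lambda>i\<in>S. R * \<tau> i) * ennreal (R ^ (card S - 1)) * indicator {0<..} R \<partial>lborel) \<in> borel_measurable ?B"
      by (intro lborel.borel_measurable_nn_integral) (simp add: split_beta')
  qed (simp add: J_def)
  finally show ?thesis .
qed

section \<open>Duality of hypergeometric simplex integrals\<close>

lemma nn_integral_Gamma_scaled:
  fixes a s :: real
  assumes "a > 0" "s > 0"
  shows "(\<integral>\<^sup>+t. ennreal (t powr (a - 1) * exp (- (t * s))) * indicator {0<..} t \<partial>lborel)
    = ennreal (Gamma a * s powr (- a))"
proof -
  have "ennreal (Gamma a) = (\<integral>\<^sup>+t. ennreal (indicator {0..} t * t powr (a - 1) / exp t) \<partial>lborel)"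
    by (rule Gamma_conv_nn_integral_real) fact
  also have "\<dots> = ennreal s * (\<integral>\<^sup>+t. ennreal (indicator {0..} (s * t) * (s * t) powr (a - 1) / exp (s * t)) \<partial>lborel)"
    using nn_integral_real_affine[of "\<lambda>t. ennreal (indicator {0..} t * t powr (a - 1) / exp t)" s 0] \<open>s > 0\<close>
    by simp
  also have "(\<integral>\<^sup>+t. ennreal (indicator {0..} (s * t) * (s * t) powr (a - 1) / exp (s * t)) \<partial>lborel)
      = (\<integral>\<^sup>+t. ennreal (s powr (a - 1)) * (ennreal (t powr (a - 1) * exp (- (t * s))) * indicator {0<..} t) \<partial>lborel)"
    using \<open>s > 0\<close>
    by (intro nn_integral_cong)
      (auto simp: indicator_def zero_le_mult_iff zero_less_mult_iff powr_mult exp_minus divide_simps ennreal_mult'[symmetric] mult_ac)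
  also have "\<dots> = ennreal (s powr (a - 1)) * (\<integral>\<^sup>+t. ennreal (t powr (a - 1) * exp (- (t * s))) * indicator {0<..} t \<partial>lborel)"
    by (rule nn_integral_cmult) auto
  finally have eq: "ennreal (Gamma a) = ennreal s * (ennreal (s powr (a - 1))
      * (\<integral>\<^sup>+t. ennreal (t powr (a - 1) * exp (- (t * s))) * indicator {0<..} t \<partial>lborel))" .
  have "ennreal (s powr (- a)) * (ennreal s * ennreal (s powr (a - 1))) = 1"
    using \<open>s > 0\<close> by (simp add: ennreal_mult'[symmetric] powr_mult_base powr_add[symmetric])
  then have "ennreal (s powr (- a)) * ennreal (Gamma a)
      = (\<integral>\<^sup>+t. ennreal (t powr (a - 1) * exp (- (t * s))) * indicator {0<..} t \<partial>lborel)"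
    by (subst eq) (simp add: mult.assoc[symmetric])
  then show ?thesis
    using assms by (simp add: ennreal_mult'[symmetric] mult.commute Gamma_real_pos less_imp_le)
qed

lemma open_simplexD:
  assumes "u \<in> open_simplex S"
  shows "\<And>i. i \<in> S \<Longrightarrow> 0 < u i" "(\<Sum>i\<in>S. u i) = 1"
  using assms by (auto simp: open_simplex_def PiE_def)

text \<open>
  Write each \<open>s i powr - a i\<close> as a Gamma integral over \<open>t i > 0\<close> and pass to polar coordinates
  \<open>t = R \<tau>\<close>. The radial integral is again a Gamma integral, with exponent \<open>sum a S\<close> and rate
  \<open>\<Sum>i\<in>S. \<tau> i * s i\<close>.
\<close>

lemma Feynman_parametrization:
  fixes a s :: "'i \<Rightarrow> real"
  assumes fin: "finite S" and ne: "S \<noteq> {}"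
    and a: "\<And>i. i \<in> S \<Longrightarrow> a i > 0" and s: "\<And>i. i \<in> S \<Longrightarrow> s i > 0"
  shows "ennreal (\<Prod>i\<in>S. Gamma (a i) * s i powr (- a i))
    = ennreal (Gamma (sum a S)) *
      (\<integral>\<^sup>+\<tau>. ennreal ((\<Prod>i\<in>S. \<tau> i powr (a i - 1)) * (\<Sum>i\<in>S. \<tau> i * s i) powr (- sum a S)) \<partial>simplex_lebesgue S)"
proof -
  interpret product_sigma_finite "\<lambda>_. lborel :: real measure" by standard
  define g where "g t = ennreal (\<Prod>i\<in>S. t i powr (a i - 1) * exp (- (t i * s i)))" for t :: "'i \<Rightarrow> real"
  have g: "g \<in> borel_measurable (\<Pi>\<^sub>M i\<in>S. (borel :: real measure))"
    unfolding g_def by measurable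
  have A: "sum a S > 0" using a by (intro sum_pos fin ne) auto
  have "ennreal (\<Prod>i\<in>S. Gamma (a i) * s i powr (- a i)) = (\<Prod>i\<in>S. ennreal (Gamma (a i) * s i powr (- a i)))"
    using a s by (intro prod_ennreal[symmetric]) (auto intro!: mult_nonneg_nonneg less_imp_le[OF Gamma_real_pos])
  also have "\<dots> = (\<Prod>i\<in>S. (\<integral>\<^sup>+t. ennreal (t powr (a i - 1) * exp (- (t * s i))) * indicator {0<..} t \<partial>lborel))"
    using a s by (intro prod.cong) (auto simp: nn_integral_Gamma_scaled)
  also have "\<dots> = (\<integral>\<^sup>+t. (\<Prod>i\<in>S. ennreal (t i powr (a i - 1) * exp (- (t i * s i))) * indicator {0<..} (t i))
      \<partial>(\<Pi>\<^sub>M i\<in>S. (lborel :: real measure)))"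
    by (rule product_nn_integral_prod[symmetric]) (use fin in auto)
  also have "\<dots> = (\<integral>\<^sup>+t. g t * indicator {t. \<forall>i\<in>S. 0 < t i} t \<partial>(\<Pi>\<^sub>M i\<in>S. (lborel :: real measure)))"
  proof (intro nn_integral_cong)
    fix t :: "'i \<Rightarrow> real"
    have "(\<Prod>i\<in>S. indicator {0<..} (t i)) = (indicator {t. \<forall>i\<in>S. 0 < t i} t :: ennreal)"
      using fin by (auto simp: indicator_def)
    then show "(\<Prod>i\<in>S. ennreal (t i powr (a i - 1) * exp (- (t i * s i))) * indicator {0<..} (t i))
      = g t * indicator {t. \<forall>i\<in>S. 0 < t i} t"
      unfolding g_def prod.distrib[of "\<lambda>i. ennreal (f i)" for f] by (simp add: prod_ennreal)
  qed
  also have "\<dots> = (\<integral>\<^sup>+\<tau>. (\<integral>\<^sup>+R. g (\<lambda>i\<in>S. R * \<tau> i) * ennreal (R ^ (card S - 1)) * indicator {0<..} R \<partial>lborel)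
         \<partial>simplex_lebesgue S)"
    by (rule nn_integral_orthant_polar[OF fin ne g])
  also have "\<dots> = (\<integral>\<^sup>+\<tau>. ennreal (Gamma (sum a S)) *
     ennreal ((\<Prod>i\<in>S. \<tau> i powr (a i - 1)) * (\<Sum>i\<in>S. \<tau> i * s i) powr (- sum a S)) \<partial>simplex_lebesgue S)"
  proof (intro nn_integral_cong)
    fix \<tau> assume "\<tau> \<in> space (simplex_lebesgue S)"
    then have \<tau>: "\<And>i. i \<in> S \<Longrightarrow> 0 < \<tau> i"
      by (auto simp: space_simplex_lebesgue dest: open_simplexD)
    let ?p = "\<Prod>i\<in>S. \<tau> i powr (a i - 1)" and ?s = "\<Sum>i\<in>S. \<tau> i * s i"
    have p: "?p \<ge> 0" by (intro prod_nonneg) auto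
    have s_pos: "?s > 0" using \<tau> s by (intro sum_pos fin ne) auto
    have "g (\<lambda>i\<in>S. R * \<tau> i) * ennreal (R ^ (card S - 1)) * indicator {0<..} R
      = ennreal ?p * (ennreal (R powr (sum a S - 1) * exp (- (R * ?s))) * indicator {0<..} R)" for R
    proof (cases "R > 0")
      case True
      have "(\<Prod>i\<in>S. (R * \<tau> i) powr (a i - 1) * exp (- (R * \<tau> i * s i)))
        = (\<Prod>i\<in>S. R powr (a i - 1)) * ?p * exp (- (R * ?s))"
        using True \<tau> fin
        by (simp add: powr_mult prod.distrib exp_sum[symmetric] sum_negf[symmetric] sum_distrib_left mult.assoc less_imp_le
            cong: prod.cong)
      also have "(\<Prod>i\<in>S. R powr (a i - 1)) = R powr (sum a S - card S)"
        using True fin by (simp add: powr_sum[symmetric] sum_subtractf)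
      finally have "g (\<lambda>i\<in>S. R * \<tau> i) = ennreal (R powr (sum a S - card S) * ?p * exp (- (R * ?s)))"
        by (simp add: g_def)
      moreover have "R powr (sum a S - card S) * R ^ (card S - 1) = R powr (sum a S - 1)"
        using True fin ne by (simp add: powr_realpow[symmetric] powr_add[symmetric] of_nat_diff card_gt_0_iff Suc_leI)
      then have "R powr (sum a S - card S) * ?p * exp (- (R * ?s)) * R ^ (card S - 1)
          = ?p * (R powr (sum a S - 1) * exp (- (R * ?s)))"
        by (simp add: algebra_simps) 
      ultimately show ?thesis
        using True p by (simp add: ennreal_mult'[symmetric] ennreal_mult''[symmetric])
    qed simp
    then have "(\<integral>\<^sup>+R. g (\<lambda>i\<in>S. R * \<tau> i) * ennreal (R ^ (card S - 1)) * indicator {0<..} R \<partial>lborel)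
      = (\<integral>\<^sup>+R. ennreal ?p * (ennreal (R powr (sum a S - 1) * exp (- (R * ?s))) * indicator {0<..} R) \<partial>lborel)"
      by (intro nn_integral_cong) auto
    also have "\<dots> = ennreal ?p * ennreal (Gamma (sum a S) * ?s powr (- sum a S))"
      by (subst nn_integral_cmult) (auto simp: nn_integral_Gamma_scaled[OF A s_pos])
    also have "\<dots> = ennreal (Gamma (sum a S)) * ennreal (?p * ?s powr (- sum a S))"
      using p Gamma_real_pos[OF A] by (simp add: ennreal_mult'[symmetric] mult_ac)
    finally show "(\<integral>\<^sup>+R. g (\<lambda>i\<in>S. R * \<tau> i) * ennreal (R ^ (card S - 1)) * indicator {0<..} R \<partial>lborel)
      = ennreal (Gamma (sum a S)) * ennreal (?p * ?s powr (- sum a S))" .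
  qed
  also have "\<dots> = ennreal (Gamma (sum a S)) *
      (\<integral>\<^sup>+\<tau>. ennreal ((\<Prod>i\<in>S. \<tau> i powr (a i - 1)) * (\<Sum>i\<in>S. \<tau> i * s i) powr (- sum a S)) \<partial>simplex_lebesgue S)"
    by (intro nn_integral_cmult measurable_simplex_lebesgueI) measurable
  finally show ?thesis .
qed

text \<open>
  The unnormalized density at a vertex with incoming edges \<open>I\<close> and outgoing edges \<open>J\<close>. The two index
  types differ, so that the edges of a graph can be paired with those of its reversal.
\<close>

definition simplex_weight ::
  "'i set \<Rightarrow> 'j set \<Rightarrow> ('i \<Rightarrow> real) \<Rightarrow> ('j \<Rightarrow> real) \<Rightarrow> ('i \<Rightarrow> 'j \<Rightarrow> real) \<Rightarrow> ('j \<Rightarrow> real) \<Rightarrow> real" where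
  "simplex_weight I J a b Z u =
     (\<Prod>j\<in>J. u j powr (b j - 1)) * (\<Prod>i\<in>I. (\<Sum>j\<in>J. Z i j * u j) powr (- a i))"

lemma borel_measurable_simplex_weight:
  "simplex_weight I J a b Z \<in> borel_measurable (simplex_lebesgue J)"
  unfolding simplex_weight_def[abs_def] by (intro measurable_simplex_lebesgueI) measurable

text \<open>
  Feynman's formula for the factors \<open>(\<Sum>j\<in>J. Z i j * u j) powr - a i\<close>, pointwise in \<open>u\<close>. The kernel
  that results is bilinear in \<open>\<tau>\<close> and \<open>u\<close>, so the right-hand side is symmetric up to the total
  weights; this is the source of the duality.
\<close>

lemma simplex_weight_integral_as_double_integral:
  assumes I: "finite I" "I \<noteq> {}" and J: "finite J" "J \<noteq> {}"
    and a: "\<And>i. i \<in> I \<Longrightarrow> a i > 0"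
    and Z: "\<And>i j. i \<in> I \<Longrightarrow> j \<in> J \<Longrightarrow> Z i j > 0"
  shows "ennreal (\<Prod>i\<in>I. Gamma (a i)) * (\<integral>\<^sup>+u. ennreal (simplex_weight I J a b Z u) \<partial>simplex_lebesgue J)
    = ennreal (Gamma (sum a I)) * (\<integral>\<^sup>+u. (\<integral>\<^sup>+\<tau>. ennreal ((\<Prod>j\<in>J. u j powr (b j - 1)) * (\<Prod>i\<in>I. \<tau> i powr (a i - 1))
        * (\<Sum>i\<in>I. \<Sum>j\<in>J. \<tau> i * Z i j * u j) powr (- sum a I)) \<partial>simplex_lebesgue I) \<partial>simplex_lebesgue J)"
    (is "_ = _ * (\<integral>\<^sup>+u. (\<integral>\<^sup>+\<tau>. ennreal (?W u \<tau>) \<partial>_) \<partial>_)")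
proof -
  interpret I: finite_measure "simplex_lebesgue I" by (rule finite_measure_simplex_lebesgue[OF I])
  have G: "(\<Prod>i\<in>I. Gamma (a i)) \<ge> 0"
    using a by (intro prod_nonneg ballI less_imp_le[OF Gamma_real_pos]) auto
  have mW: "(\<lambda>u. \<integral>\<^sup>+\<tau>. ennreal (?W u \<tau>) \<partial>simplex_lebesgue I) \<in> borel_measurable (simplex_lebesgue J)"
  proof (rule I.borel_measurable_nn_integral)
    have [measurable]: "(\<lambda>p. fst p j) \<in> borel_measurable (simplex_lebesgue J \<Otimes>\<^sub>M simplex_lebesgue I)" if "j \<in> J" for j
      using that by (intro measurable_compose[OF measurable_fst] measurable_simplex_lebesgueI) auto
    have [measurable]: "(\<lambda>p. snd p j) \<in> borel_measurable (simplex_lebesgue J \<Otimes>\<^sub>M simplex_lebesgue I)" if "j \<in> I" for j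
      using that by (intro measurable_compose[OF measurable_snd] measurable_simplex_lebesgueI) auto
    show "(\<lambda>(u, \<tau>). ennreal (?W u \<tau>)) \<in> borel_measurable (simplex_lebesgue J \<Otimes>\<^sub>M simplex_lebesgue I)"
      unfolding split_beta' by measurable
  qed
  have "ennreal (\<Prod>i\<in>I. Gamma (a i)) * (\<integral>\<^sup>+u. ennreal (simplex_weight I J a b Z u) \<partial>simplex_lebesgue J)
    = (\<integral>\<^sup>+u. ennreal (\<Prod>i\<in>I. Gamma (a i)) * ennreal (simplex_weight I J a b Z u) \<partial>simplex_lebesgue J)"
    by (intro nn_integral_cmult[symmetric] measurable_compose[OF borel_measurable_simplex_weight]) auto
  also have "\<dots> = (\<integral>\<^sup>+u. ennreal (Gamma (sum a I)) * (\<integral>\<^sup>+\<tau>. ennreal (?W u \<tau>) \<partial>simplex_lebesgue I) \<partial>simplex_lebesgue J)"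
  proof (intro nn_integral_cong)
    fix u assume "u \<in> space (simplex_lebesgue J)"
    then have u: "\<And>i. i \<in> J \<Longrightarrow> 0 < u i"
      by (auto simp: space_simplex_lebesgue dest: open_simplexD)
    define s where "s i = (\<Sum>j\<in>J. Z i j * u j)" for i
    let ?p = "\<Prod>j\<in>J. u j powr (b j - 1)"
    have s: "s i > 0" if "i \<in> I" for i
      unfolding s_def using u Z that by (intro sum_pos J) auto
    have p: "?p \<ge> 0" by (intro prod_nonneg) auto
    have "ennreal (\<Prod>i\<in>I. Gamma (a i)) * ennreal (simplex_weight I J a b Z u)
       = ennreal ?p * ennreal (\<Prod>i\<in>I. Gamma (a i) * s i powr (- a i))"
      using G p by (simp add: simplex_weight_def s_def ennreal_mult'[symmetric] prod.distrib mult_ac)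
    also have "\<dots> = ennreal ?p * (ennreal (Gamma (sum a I)) *
      (\<integral>\<^sup>+\<tau>. ennreal ((\<Prod>i\<in>I. \<tau> i powr (a i - 1)) * (\<Sum>i\<in>I. \<tau> i * s i) powr (- sum a I)) \<partial>simplex_lebesgue I))"
      by (subst Feynman_parametrization[OF I a s]) auto
    also have "\<dots> = ennreal (Gamma (sum a I)) * (\<integral>\<^sup>+\<tau>. ennreal ?p * ennreal ((\<Prod>i\<in>I. \<tau> i powr (a i - 1)) * (\<Sum>i\<in>I. \<tau> i * s i) powr (- sum a I)) \<partial>simplex_lebesgue I)"
      by (subst nn_integral_cmult, intro measurable_simplex_lebesgueI, measurable) (simp add: mult_ac)
    also have "\<dots> = ennreal (Gamma (sum a I)) * (\<integral>\<^sup>+\<tau>. ennreal (?W u \<tau>) \<partial>simplex_lebesgue I)"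
      using p by (simp add: ennreal_mult'[symmetric] s_def sum_distrib_left mult_ac)
    finally show "ennreal (\<Prod>i\<in>I. Gamma (a i)) * ennreal (simplex_weight I J a b Z u)
      = ennreal (Gamma (sum a I)) * (\<integral>\<^sup>+\<tau>. ennreal (?W u \<tau>) \<partial>simplex_lebesgue I)" .
  qed
  also have "\<dots> = ennreal (Gamma (sum a I)) * (\<integral>\<^sup>+u. (\<integral>\<^sup>+\<tau>. ennreal (?W u \<tau>) \<partial>simplex_lebesgue I) \<partial>simplex_lebesgue J)"
    by (rule nn_integral_cmult[OF mW])
  finally show ?thesis .
qed

lemma simplex_weight_integral_duality:
  assumes I: "finite I" "I \<noteq> {}" and J: "finite J" "J \<noteq> {}"
    and a: "\<And>i. i \<in> I \<Longrightarrow> a i > 0" and b: "\<And>j. j \<in> J \<Longrightarrow> b j > 0"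
    and Z: "\<And>i j. i \<in> I \<Longrightarrow> j \<in> J \<Longrightarrow> Z i j > 0"
    and ab: "sum a I = sum b J"
  shows "ennreal (\<Prod>i\<in>I. Gamma (a i)) * (\<integral>\<^sup>+u. ennreal (simplex_weight I J a b Z u) \<partial>simplex_lebesgue J)
    = ennreal (\<Prod>j\<in>J. Gamma (b j)) * (\<integral>\<^sup>+\<tau>. ennreal (simplex_weight J I b a (\<lambda>j i. Z i j) \<tau>) \<partial>simplex_lebesgue I)"
proof -
  interpret I: finite_measure "simplex_lebesgue I" by (rule finite_measure_simplex_lebesgue[OF I])
  interpret J: finite_measure "simplex_lebesgue J" by (rule finite_measure_simplex_lebesgue[OF J])
  interpret IJ: pair_sigma_finite "simplex_lebesgue I" "simplex_lebesgue J" ..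
  let ?W = "\<lambda>\<tau> u. ennreal ((\<Prod>j\<in>J. u j powr (b j - 1)) * (\<Prod>i\<in>I. \<tau> i powr (a i - 1))
        * (\<Sum>i\<in>I. \<Sum>j\<in>J. \<tau> i * Z i j * u j) powr (- sum a I))"
  let ?W' = "\<lambda>\<tau> u. ennreal ((\<Prod>i\<in>I. \<tau> i powr (a i - 1)) * (\<Prod>j\<in>J. u j powr (b j - 1))
        * (\<Sum>j\<in>J. \<Sum>i\<in>I. u j * Z i j * \<tau> i) powr (- sum b J))"
  have W: "?W \<tau> u = ?W' \<tau> u" for \<tau> u
    using ab by (subst sum.swap) (simp add: mult_ac)
  have "(\<integral>\<^sup>+u. (\<integral>\<^sup>+\<tau>. ?W \<tau> u \<partial>simplex_lebesgue I) \<partial>simplex_lebesgue J)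
      = (\<integral>\<^sup>+\<tau>. (\<integral>\<^sup>+u. ?W \<tau> u \<partial>simplex_lebesgue J) \<partial>simplex_lebesgue I)"
  proof (rule IJ.Fubini')
    have [measurable]: "(\<lambda>p. snd p j) \<in> borel_measurable (simplex_lebesgue I \<Otimes>\<^sub>M simplex_lebesgue J)" if "j \<in> J" for j
      using that by (intro measurable_compose[OF measurable_snd] measurable_simplex_lebesgueI) auto
    have [measurable]: "(\<lambda>p. fst p j) \<in> borel_measurable (simplex_lebesgue I \<Otimes>\<^sub>M simplex_lebesgue J)" if "j \<in> I" for j
      using that by (intro measurable_compose[OF measurable_fst] measurable_simplex_lebesgueI) auto
    show "(\<lambda>(\<tau>, u). ?W \<tau> u) \<in> borel_measurable (simplex_lebesgue I \<Otimes>\<^sub>M simplex_lebesgue J)"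
      unfolding split_beta' by measurable
  qed
  also have "\<dots> = (\<integral>\<^sup>+\<tau>. (\<integral>\<^sup>+u. ?W' \<tau> u \<partial>simplex_lebesgue J) \<partial>simplex_lebesgue I)"
    by (simp only: W)
  finally show ?thesis
    unfolding ab
      simplex_weight_integral_as_double_integral[where a = a and b = b and Z = Z, OF I J a Z, simplified]
      simplex_weight_integral_as_double_integral[where a = b and b = a and Z = "\<lambda>j i. Z i j", OF J I b Z, simplified]
    by simp
qed

text \<open>
  Feynman's formula with all linear coefficients equal to 1.
\<close>

lemma nn_integral_Dirichlet:
  assumes "finite J" "J \<noteq> {}" and b: "\<And>j. j \<in> J \<Longrightarrow> b j > 0"
  shows "ennreal (\<Prod>j\<in>J. Gamma (b j))
    = ennreal (Gamma (sum b J)) * (\<integral>\<^sup>+u. ennreal (\<Prod>j\<in>J. u j powr (b j - 1)) \<partial>simplex_lebesgue J)"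
proof -
  have "(\<integral>\<^sup>+u. ennreal ((\<Prod>j\<in>J. u j powr (b j - 1)) * (\<Sum>j\<in>J. u j * 1) powr (- sum b J)) \<partial>simplex_lebesgue J)
    = (\<integral>\<^sup>+u. ennreal (\<Prod>j\<in>J. u j powr (b j - 1)) \<partial>simplex_lebesgue J)"
    by (intro nn_integral_cong) (auto simp: space_simplex_lebesgue dest: open_simplexD(2))
  then show ?thesis
    using Feynman_parametrization[where a = b and s = "\<lambda>_. 1", OF assms(1,2) b] by simp
qed

lemma simplex_weight_pos:
  assumes "finite J" "J \<noteq> {}" and u: "u \<in> open_simplex J"
    and Z: "\<And>i j. i \<in> I \<Longrightarrow> j \<in> J \<Longrightarrow> Z i j > 0"
  shows "simplex_weight I J a b Z u > 0"
proof -
  have "(\<Sum>j\<in>J. Z i j * u j) > 0" if "i \<in> I" for i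
    using Z that open_simplexD(1)[OF u] by (intro sum_pos assms) auto
  then show ?thesis
    unfolding simplex_weight_def using open_simplexD(1)[OF u]
    by (intro mult_pos_pos prod_pos) (auto simp: order_less_le)
qed

text \<open>
  On the simplex the linear forms are bounded below by the least entry of \<open>Z\<close>, so the weight is
  dominated by a Dirichlet density. It does not vanish, and neither does the simplex measure because
  the Dirichlet integral is positive.
\<close>

lemma simplex_weight_integral_bounds:
  assumes I: "finite I" and J: "finite J" "J \<noteq> {}"
    and a: "\<And>i. i \<in> I \<Longrightarrow> a i > 0" and b: "\<And>j. j \<in> J \<Longrightarrow> b j > 0"
    and Z: "\<And>i j. i \<in> I \<Longrightarrow> j \<in> J \<Longrightarrow> Z i j > 0"
  defines "c \<equiv> (\<integral>\<^sup>+u. ennreal (simplex_weight I J a b Z u) \<partial>simplex_lebesgue J)"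
  shows "c \<noteq> 0" "c \<noteq> \<infinity>"
proof -
  let ?D = "\<integral>\<^sup>+u. ennreal (\<Prod>j\<in>J. u j powr (b j - 1)) \<partial>simplex_lebesgue J"
  have G: "(\<Prod>j\<in>J. Gamma (b j)) > 0" using b by (intro prod_pos Gamma_real_pos) auto
  have GA: "Gamma (sum b J) > 0" by (intro Gamma_real_pos sum_pos J b)
  note D = nn_integral_Dirichlet[where b = b, OF J b]
  have D0: "?D \<noteq> 0" using D G by auto
  have Dfin: "?D < \<infinity>"
  proof (rule ccontr)
    assume "\<not> ?D < \<infinity>"
    then have "?D = top" by (simp add: less_top[symmetric])
    with D GA show False by (simp add: ennreal_mult_top)
  qed
  show "c \<noteq> 0"
  proof
    assume "c = 0"
    then have "AE u in simplex_lebesgue J. ennreal (simplex_weight I J a b Z u) = 0"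
      unfolding c_def
      by (subst (asm) nn_integral_0_iff_AE) (auto intro!: measurable_compose[OF borel_measurable_simplex_weight])
    moreover have "AE u in simplex_lebesgue J. simplex_weight I J a b Z u > 0"
      by (intro AE_I2 simplex_weight_pos J Z) (auto simp: space_simplex_lebesgue)
    ultimately have "AE u in simplex_lebesgue J. False"
      by eventually_elim (auto simp: ennreal_eq_0_iff)
    then have "?D = 0"
      by (subst nn_integral_0_iff_AE) (auto intro!: measurable_simplex_lebesgueI)
    with D0 show False ..
  qed
  have "\<exists>z>0. \<forall>i\<in>I. \<forall>j\<in>J. z \<le> Z i j"
  proof (cases "I = {}")
    case False
    let ?z = "Min ((\<lambda>(i, j). Z i j) ` (I \<times> J))"
    have "?z > 0" using False I J Z by (subst Min_gr_iff) auto
    moreover have "?z \<le> Z i j" if "i \<in> I" "j \<in> J" for i j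
      using that I J by (intro Min_le) force+
    ultimately show ?thesis by blast
  qed (auto intro: exI[of _ 1])
  then obtain z where z: "z > 0" "\<And>i j. i \<in> I \<Longrightarrow> j \<in> J \<Longrightarrow> z \<le> Z i j" by blast
  have "c \<le> (\<integral>\<^sup>+u. ennreal (\<Prod>i\<in>I. z powr (- a i)) * ennreal (\<Prod>j\<in>J. u j powr (b j - 1)) \<partial>simplex_lebesgue J)"
    unfolding c_def
  proof (intro nn_integral_mono)
    fix u assume "u \<in> space (simplex_lebesgue J)"
    then have u: "u \<in> open_simplex J" by (simp add: space_simplex_lebesgue)
    have "(\<Sum>j\<in>J. Z i j * u j) powr (- a i) \<le> z powr (- a i)" if "i \<in> I" for i
    proof (rule powr_mono2')
      have "z = (\<Sum>j\<in>J. z * u j)" using open_simplexD(2)[OF u] by (simp flip: sum_distrib_left)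
      also have "\<dots> \<le> (\<Sum>j\<in>J. Z i j * u j)"
        using z(2)[OF that] open_simplexD(1)[OF u] by (intro sum_mono mult_right_mono) (auto simp: less_imp_le)
      finally show "z \<le> (\<Sum>j\<in>J. Z i j * u j)" .
    qed (use a[OF that] z in auto)
    then have "(\<Prod>i\<in>I. (\<Sum>j\<in>J. Z i j * u j) powr (- a i)) \<le> (\<Prod>i\<in>I. z powr (- a i))"
      by (intro prod_mono) auto
    then have "simplex_weight I J a b Z u \<le> (\<Prod>i\<in>I. z powr (- a i)) * (\<Prod>j\<in>J. u j powr (b j - 1))"
      unfolding simplex_weight_def by (subst mult.commute) (intro mult_right_mono prod_nonneg, auto)
    moreover have "(\<Prod>i\<in>I. z powr (- a i)) \<ge> 0" by (intro prod_nonneg) auto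
    ultimately show "ennreal (simplex_weight I J a b Z u)
        \<le> ennreal (\<Prod>i\<in>I. z powr (- a i)) * ennreal (\<Prod>j\<in>J. u j powr (b j - 1))"
      by (simp add: ennreal_mult'[symmetric] ennreal_leI)
  qed
  also have "\<dots> = ennreal (\<Prod>i\<in>I. z powr (- a i)) * ?D"
    by (intro nn_integral_cmult measurable_simplex_lebesgueI) measurable
  also have "\<dots> < \<infinity>" using Dfin by (simp add: ennreal_mult_less_top)
  finally show "c \<noteq> \<infinity>" by simp
qed

section \<open>Moments determine a law on the cube\<close>

text \<open>
  Equal moments give equal integrals of polynomials, by Weierstrass of continuous functions on the
  unit interval, and by dominated convergence of indicators of half-lines.
\<close>

lemma finite_measure_eqI_moments:
  fixes M N :: "real measure"
  assumes fM: "finite_measure M" and fN: "finite_measure N"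
    and sM: "sets M = sets borel" and sN: "sets N = sets borel"
    and bM: "AE x in M. x \<in> {0..1}" and bN: "AE x in N. x \<in> {0..1}"
    and moments: "\<And>n. (\<integral>x. x ^ n \<partial>M) = (\<integral>x. x ^ n \<partial>N)"
  shows "M = N"
proof -
  have int: "integrable L f"
    if "finite_measure L" "sets L = sets borel" "AE x in L. x \<in> {0..1}" "continuous_on UNIV f"
    for L :: "real measure" and f :: "real \<Rightarrow> real"
  proof -
    interpret finite_measure L by fact
    have "compact (f ` {0..1})"
      using that by (intro compact_continuous_image) (auto intro: continuous_on_subset)
    then obtain B where "\<forall>x\<in>{0..1}. \<bar>f x\<bar> \<le> B"
      by (auto dest!: compact_imp_bounded simp: bounded_iff)
    then have B: "\<And>x. x \<in> {0..1} \<Longrightarrow> \<bar>f x\<bar> \<le> B" by blast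
    have "f \<in> borel_measurable L"
      using borel_measurable_continuous_onI[OF that(4)] by (simp add: measurable_cong_sets[OF that(2) refl])
    moreover have "AE x in L. norm (f x) \<le> B"
      using that(3) by eventually_elim (use B in auto)
    ultimately show ?thesis by (intro integrable_const_bound[of _ B])
  qed
  note intM = int[OF fM sM bM] and intN = int[OF fN sN bN]
  interpret M: finite_measure M by fact
  interpret N: finite_measure N by fact
  have cont: "(\<integral>x. f x \<partial>M) = (\<integral>x. f x \<partial>N)" if f: "continuous_on UNIV f" for f :: "real \<Rightarrow> real"
  proof (rule ccontr)
    \<comment> \<open>the summand 1 keeps \<open>c\<close> positive and makes the final estimate strict\<close>
    define c where "c = measure M (space M) + measure N (space N) + 1"
    define d where "d = \<bar>(\<integral>x. f x \<partial>M) - (\<integral>x. f x \<partial>N)\<bar>"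
    assume "(\<integral>x. f x \<partial>M) \<noteq> (\<integral>x. f x \<partial>N)"
    then have d: "d > 0" by (simp add: d_def)
    have c: "c > 0" by (simp add: c_def add_nonneg_pos)
    obtain g where g: "real_polynomial_function g" "\<And>x. x \<in> {0..1} \<Longrightarrow> \<bar>f x - g x\<bar> < d / c"
      using Stone_Weierstrass_real_polynomial_function[of "{0..1::real}" f "d / c"] f d c
      by (auto intro: continuous_on_subset)
    obtain a n where g_eq: "g = (\<lambda>x. \<Sum>i\<le>n. a i * x ^ i)"
      using g(1) unfolding real_polynomial_function_iff_sum by blast
    have gc: "continuous_on UNIV g" unfolding g_eq by (intro continuous_intros)
    have "(\<integral>x. g x \<partial>M) = (\<integral>x. g x \<partial>N)"
      unfolding g_eq
      by (subst (1 2) Bochner_Integration.integral_sum) (auto intro!: integrable_mult_right intM intN continuous_intros simp: moments)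
    moreover have "\<bar>(\<integral>x. f x \<partial>L) - (\<integral>x. g x \<partial>L)\<bar> \<le> d / c * measure L (space L)"
      if L: "finite_measure L" "sets L = sets borel" "AE x in L. x \<in> {0..1}" for L
    proof -
      interpret finite_measure L by fact
      have "\<bar>(\<integral>x. f x \<partial>L) - (\<integral>x. g x \<partial>L)\<bar> = \<bar>\<integral>x. f x - g x \<partial>L\<bar>"
        by (subst Bochner_Integration.integral_diff) (use int[OF L f] int[OF L gc] in auto)
      also have "\<dots> \<le> (\<integral>x. \<bar>f x - g x\<bar> \<partial>L)" by (rule integral_abs_bound)
      also have "\<dots> \<le> (\<integral>x. d / c \<partial>L)"
      proof (intro integral_mono_AE int[OF L] continuous_intros f gc integrable_const)
        show "AE x in L. \<bar>f x - g x\<bar> \<le> d / c"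
          using L(3) by eventually_elim (intro less_imp_le g(2))
      qed
      finally show ?thesis by (simp add: mult.commute)
    qed
    note this[OF fM sM bM] this[OF fN sN bN]
    ultimately have "d \<le> d / c * (measure M (space M) + measure N (space N))"
      unfolding d_def by (simp add: distrib_left)
    also have "\<dots> < d / c * c"
      using d c by (intro mult_strict_left_mono) (auto simp: c_def)
    finally show False using c by simp
  qed
  have atMost: "emeasure M {..a} = emeasure N {..a}" for a
  proof -
    \<comment> \<open>continuous cut-offs that decrease from 1 to 0 on an interval of length \<open>1 / k\<close> to the right of \<open>a\<close>\<close>
    define h where "h k x = max 0 (min 1 (1 - real k * (x - a)))" for k x
    have hc: "continuous_on UNIV (h k)" for k
      unfolding h_def by (intro continuous_intros)
    have lim: "(\<lambda>k. h k x) \<longlonglongrightarrow> indicator {..a} x" for x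
    proof (cases "x \<le> a")
      case True
      then have "h k x = 1" for k by (auto simp: h_def mult_nonneg_nonpos min_def)
      with True show ?thesis by simp
    next
      case False
      then obtain K where K: "1 < real K * (x - a)"
        using reals_Archimedean3[of "x - a"] by (auto)
      have "h k x = 0" if "k \<ge> K" for k
      proof -
        have "real K * (x - a) \<le> real k * (x - a)" using that False by (intro mult_right_mono) auto
        with K show ?thesis by (simp add: h_def)
      qed
      then have "\<forall>\<^sub>F k in sequentially. h k x = 0" by (auto simp: eventually_sequentially)
      with False show ?thesis by (simp add: tendsto_eventually)
    qed
    have "(\<lambda>k. \<integral>x. h k x \<partial>L) \<longlonglongrightarrow> measure L {..a}"
      if L: "finite_measure L" "sets L = sets borel" "AE x in L. x \<in> {0..1}" for L
    proof -
      interpret finite_measure L by fact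
      have "(\<lambda>k. \<integral>x. h k x \<partial>L) \<longlonglongrightarrow> (\<integral>x. indicator {..a} x \<partial>L)"
      proof (rule integral_dominated_convergence[where w = "\<lambda>_. 1"])
        show "h k \<in> borel_measurable L" for k
          using borel_measurable_continuous_onI[OF hc] by (simp add: measurable_cong_sets[OF L(2) refl])
        show "indicator {..a} \<in> borel_measurable L"
          using L(2) by (simp add: borel_measurable_indicator)
      qed (use lim in \<open>auto simp: h_def\<close>)
      then show ?thesis using L(2) sets_eq_imp_space_eq[OF L(2)] by simp
    qed
    from this[OF fM sM bM] this[OF fN sN bN] have "measure M {..a} = measure N {..a}"
      by (simp add: cont[OF hc] LIMSEQ_unique)
    then show ?thesis by (simp add: M.emeasure_eq_measure N.emeasure_eq_measure)
  qed
  show ?thesis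
  proof (rule measure_eqI_generator_eq[where E = "range atMost" and \<Omega> = UNIV and A = "\<lambda>i. {..real i}"])
    show "Int_stable (range atMost :: real set set)"
    proof -
      have "{..a} \<inter> {..b} = {..min a b}" for a b :: real by auto
      then show ?thesis by (auto simp: Int_stable_def)
    qed
    show "(\<Union>i. {..real i}) = UNIV" by (auto intro: real_arch_simple)
    show "sets M = sigma_sets UNIV (range atMost)" "sets N = sigma_sets UNIV (range atMost)"
      by (simp_all add: sM sN borel_eq_atMost)
  qed (auto simp: atMost)
qed

text \<open>
  The coordinates are treated one at a time: in the integral of a product, replace a power of one
  variable by the indicator of a Borel set. The remaining factors act as a density, and the
  one-dimensional statement applies to the image of the weighted measure. When every power has been
  replaced, the integrals are the probabilities of boxes.
\<close>

lemma distr_PiM_eqI_moments: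
  fixes P :: "'p measure" and Q :: "'q measure"
    and X :: "'i \<Rightarrow> 'p \<Rightarrow> real" and Y :: "'i \<Rightarrow> 'q \<Rightarrow> real"
  assumes P: "prob_space P" and Q: "prob_space Q" and fin: "finite B"
    and X[measurable]: "\<And>i. i \<in> B \<Longrightarrow> X i \<in> borel_measurable P" 
    and Y[measurable]: "\<And>i. i \<in> B \<Longrightarrow> Y i \<in> borel_measurable Q"
    and X01: "\<And>i w. i \<in> B \<Longrightarrow> w \<in> space P \<Longrightarrow> X i w \<in> {0..1}"
    and Y01: "\<And>i w. i \<in> B \<Longrightarrow> w \<in> space Q \<Longrightarrow> Y i w \<in> {0..1}"
    and moments: "\<And>m. (\<integral>w. (\<Prod>i\<in>B. X i w ^ m i) \<partial>P) = (\<integral>w. (\<Prod>i\<in>B. Y i w ^ m i) \<partial>Q)"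
  shows "distr P (\<Pi>\<^sub>M i\<in>B. borel) (\<lambda>w. \<lambda>i\<in>B. X i w) = distr Q (\<Pi>\<^sub>M i\<in>B. (borel :: real measure)) (\<lambda>w. \<lambda>i\<in>B. Y i w)"
proof -
  interpret P: prob_space P by fact
  interpret Q: prob_space Q by fact
  \<comment> \<open>the factor of variable \<open>i\<close>: an indicator if \<open>i\<close> has been treated already, a power otherwise\<close>
  define t :: "'i set \<Rightarrow> ('i \<Rightarrow> real set) \<Rightarrow> ('i \<Rightarrow> nat) \<Rightarrow> 'i \<Rightarrow> real \<Rightarrow> real"
    where "t F A m i x = (if i \<in> F then indicator (A i) x else x ^ m i)" for F A m i x
  have t01: "t F A m i x \<in> {0..1}" if "x \<in> {0..1}" for F A m i x
    using that by (auto simp: t_def indicator_def power_le_one)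
  have t_meas: "t F A m i \<in> borel_measurable borel" if "i \<in> F \<Longrightarrow> A i \<in> sets borel" for F A m i
    using that by (cases "i \<in> F") (auto simp: t_def[abs_def])
  have box: "(\<integral>w. (\<Prod>i\<in>B. t F A m i (X i w)) \<partial>P) = (\<integral>w. (\<Prod>i\<in>B. t F A m i (Y i w)) \<partial>Q)"
    if "finite F" "F \<subseteq> B" "\<And>i. i \<in> F \<Longrightarrow> A i \<in> sets borel" for F A m
    using that
  proof (induction F arbitrary: m rule: finite_induct)
    case empty
    then show ?case by (simp add: t_def moments)
  next
    case (insert k F)
    have k: "k \<in> B" and A: "\<And>i. i \<in> F \<Longrightarrow> A i \<in> sets borel" "A k \<in> sets borel"
      using insert.prems by auto
    let ?d = "\<lambda>X w. \<Prod>i\<in>B - {k}. t F A m i (X i w)"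
    let ?e = "\<lambda>z. \<Prod>i\<in>B - {k}. t F A m i (z i)"
    let ?M = "\<lambda>P X. distr (density P (\<lambda>w. ennreal (?d X w))) borel (X k)"
    have split: "(\<Prod>i\<in>B. t G A n i (z i)) = ?e z * t G A n k (z k)"
      if "\<And>i. i \<noteq> k \<Longrightarrow> t G A n i = t F A m i" for G n z
      using that k fin by (subst prod.remove[of B k]) (auto intro!: prod.cong simp: mult.commute)
    have gen: "finite_measure (?M R Z)" "AE x in ?M R Z. x \<in> {0..1}"
      "\<And>g. g \<in> borel_measurable borel \<Longrightarrow> (\<integral>x. g x \<partial>?M R Z) = (\<integral>w. ?d Z w * g (Z k w) \<partial>R)"
      if R: "prob_space R" and Z: "\<And>i. i \<in> B \<Longrightarrow> Z i \<in> borel_measurable R" 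
        and Z01: "\<And>i w. i \<in> B \<Longrightarrow> w \<in> space R \<Longrightarrow> Z i w \<in> {0..1}" for R :: "'w measure" and Z
    proof -
      interpret prob_space R by fact
      have [measurable]: "Z k \<in> borel_measurable R" using Z k by auto
      have d[measurable]: "?d Z \<in> borel_measurable R"
        using A by (intro borel_measurable_prod measurable_compose[OF Z t_meas]) auto
      have d0: "?d Z w \<ge> 0" "?d Z w \<le> 1" if "w \<in> space R" for w
        using t01[OF Z01] that by (auto intro!: prod_nonneg prod_le_1)
      show "finite_measure (?M R Z)"
      proof
        have "emeasure (?M R Z) (space (?M R Z)) = (\<integral>\<^sup>+w. ennreal (?d Z w) \<partial>R)"
          by (simp add: emeasure_distr emeasure_density)
        also have "\<dots> \<le> (\<integral>\<^sup>+w. 1 \<partial>R)"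
          using d0 by (intro nn_integral_mono) (auto simp: ennreal_le_1)
        finally show "emeasure (?M R Z) (space (?M R Z)) \<noteq> \<infinity>" by (auto simp: emeasure_space_1 top_unique)
      qed
      show "AE x in ?M R Z. x \<in> {0..1}"
        using Z01[OF k] by (auto simp: AE_distr_iff AE_density)
      fix g :: "real \<Rightarrow> real" assume [measurable]: "g \<in> borel_measurable borel"
      have "(\<integral>x. g x \<partial>?M R Z) = (\<integral>w. g (Z k w) \<partial>density R (\<lambda>w. ennreal (?d Z w)))"
        by (rule integral_distr) auto
      also have "\<dots> = (\<integral>w. ?d Z w * g (Z k w) \<partial>R)"
        using d0 by (subst integral_density) auto
      finally show "(\<integral>x. g x \<partial>?M R Z) = (\<integral>w. ?d Z w * g (Z k w) \<partial>R)" .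
    qed
    note gP = gen[of P X, OF P X X01]
    note gQ = gen[of Q Y, OF Q Y Y01]
    have "?M P X = ?M Q Y"
    proof (rule finite_measure_eqI_moments)
      fix n
      have *: "t F A (m(k := n)) i = t F A m i" if "i \<noteq> k" for i
        using that by (intro ext) (simp add: t_def)
      have tk: "t F A (m(k := n)) k x = x ^ n" for x
        using insert.hyps by (simp add: t_def)
      have spl: "(\<Prod>i\<in>B. t F A (m(k := n)) i (z i)) = ?e z * z k ^ n" for z
        using * by (subst split) (simp_all add: tk)
      show "(\<integral>x. x ^ n \<partial>?M P X) = (\<integral>x. x ^ n \<partial>?M Q Y)"
        using insert.IH[of "m(k := n)", unfolded spl] insert.prems
          gP(3)[of "\<lambda>x. x ^ n"] gQ(3)[of "\<lambda>x. x ^ n"]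
        by simp
    qed (use gP gQ in auto)
    then have "(\<integral>w. ?d X w * indicator (A k) (X k w) \<partial>P) = (\<integral>w. ?d Y w * indicator (A k) (Y k w) \<partial>Q)"
      using gP(3)[of "indicator (A k)"] gQ(3)[of "indicator (A k)"] A by simp
    moreover have "(\<Prod>i\<in>B. t (insert k F) A m i (z i)) = ?e z * indicator (A k) (z k)" for z
    proof -
      have "t (insert k F) A m i = t F A m i" if "i \<noteq> k" for i
        using that by (intro ext) (simp add: t_def)
      moreover have "t (insert k F) A m k x = indicator (A k) x" for x by (simp add: t_def)
      ultimately show ?thesis by (subst split) simp_all
    qed
    ultimately show ?case by simp
  qed
  have Xm: "(\<lambda>w. \<lambda>i\<in>B. X i w) \<in> P \<rightarrow>\<^sub>M (\<Pi>\<^sub>M i\<in>B. borel)" by measurable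
  have Ym: "(\<lambda>w. \<lambda>i\<in>B. Y i w) \<in> Q \<rightarrow>\<^sub>M (\<Pi>\<^sub>M i\<in>B. borel)" by measurable
  show ?thesis
  proof (rule measure_eqI_PiM_finite[OF fin])
    fix A :: "'i \<Rightarrow> real set" assume A: "\<And>i. i \<in> B \<Longrightarrow> A i \<in> sets borel"
    have emb: "emeasure (distr R (\<Pi>\<^sub>M i\<in>B. borel) (\<lambda>w. \<lambda>i\<in>B. Z i w)) (Pi\<^sub>E B A)
       = ennreal (\<integral>w. (\<Prod>i\<in>B. t B A m i (Z i w)) \<partial>R)"
      if R: "prob_space R" and Z: "\<And>i. i \<in> B \<Longrightarrow> Z i \<in> borel_measurable R" 
      for R :: "'w measure" and Z m
    proof -
      interpret prob_space R by fact
      note Z[measurable]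
      have Zm: "(\<lambda>w. \<lambda>i\<in>B. Z i w) \<in> R \<rightarrow>\<^sub>M (\<Pi>\<^sub>M i\<in>B. (borel :: real measure))" by measurable
      let ?S = "(\<lambda>w. \<lambda>i\<in>B. Z i w) -` Pi\<^sub>E B A \<inter> space R"
      have PiE: "Pi\<^sub>E B A \<in> sets (\<Pi>\<^sub>M i\<in>B. borel)" using A fin by (intro sets_PiM_I_finite) auto
      have "(\<integral>w. (\<Prod>i\<in>B. t B A m i (Z i w)) \<partial>R) = (\<integral>w. indicator ?S w \<partial>R)"
        using fin by (intro Bochner_Integration.integral_cong refl) (auto simp: t_def indicator_def PiE_def Pi_def)
      then show ?thesis
        using Zm PiE measurable_sets[OF Zm PiE] by (simp add: emeasure_distr emeasure_eq_measure)
    qed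
    from emb[of P X "\<lambda>_. 0", OF P X] emb[of Q Y "\<lambda>_. 0", OF Q Y]
      box[of B A "\<lambda>_. 0", OF fin order.refl A]
    show "emeasure (distr P (\<Pi>\<^sub>M i\<in>B. borel) (\<lambda>w. \<lambda>i\<in>B. X i w)) (Pi\<^sub>E B A)
      = emeasure (distr Q (\<Pi>\<^sub>M i\<in>B. borel) (\<lambda>w. \<lambda>i\<in>B. Y i w)) (Pi\<^sub>E B A)" by simp
  next
    show "range (\<lambda>_::nat. Pi\<^sub>E B (\<lambda>_. UNIV)) \<subseteq> prod_algebra B (\<lambda>_. borel :: real measure)"
      using fin by (auto simp: prod_algebra_eq_finite)
  qed (use finite_measure.emeasure_finite[OF P.finite_measure_distr[OF Xm]] in \<open>auto simp: space_PiM\<close>)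
qed

section \<open>Connectivity of divergence-free graphs\<close>

text \<open>
  For an edge from \<open>x\<close> to \<open>y\<close>, let \<open>R\<close> be the set of vertices that can be reached from \<open>y\<close>. No edge
  leaves \<open>R\<close>, so by conservation no weight enters it. If \<open>x\<close> were outside \<open>R\<close>, the edge from \<open>x\<close> to
  \<open>y\<close> would carry positive weight into \<open>R\<close>.
\<close>

lemma reachable_back_if_divergence_free:
  fixes \<alpha> :: "'v \<times> 'v \<Rightarrow> real"
  assumes V: "finite V" "E \<subseteq> V \<times> V"
    and \<alpha>: "\<And>e. e \<in> E \<Longrightarrow> \<alpha> e > 0"
    and div: "\<And>x. x \<in> V \<Longrightarrow> divergence E \<alpha> x = 0"
    and path: "(x, y) \<in> E\<^sup>*"
  shows "(y, x) \<in> E\<^sup>*"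
proof -
  have finE: "finite E" using V by (meson finite_SigmaI finite_subset)
  have edge: "(y, x) \<in> E\<^sup>*" if xy: "(x, y) \<in> E" for x y
  proof (rule ccontr)
    assume not: "(y, x) \<notin> E\<^sup>*"
    define R where "R = {z \<in> V. (y, z) \<in> E\<^sup>*}"
    have R: "finite R" "R \<subseteq> V" using V by (auto simp: R_def)
    have "(\<Sum>z\<in>R. \<Sum>e\<in>out_edges E z. \<alpha> e) = (\<Sum>e | e \<in> E \<and> fst e \<in> R. \<alpha> e)"
    proof -
      have "(\<Sum>z\<in>R. \<Sum>e\<in>out_edges E z. \<alpha> e)
          = (\<Sum>z\<in>R. \<Sum>e | e \<in> {e \<in> E. fst e \<in> R} \<and> fst e = z. \<alpha> e)"
        by (intro sum.cong refl) (auto simp: out_edges_def)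
      also have "\<dots> = (\<Sum>e | e \<in> E \<and> fst e \<in> R. \<alpha> e)"
        by (rule sum.group) (use finE R in auto)
      finally show ?thesis .
    qed
    moreover have "(\<Sum>z\<in>R. \<Sum>e\<in>in_edges E z. \<alpha> e) = (\<Sum>e | e \<in> E \<and> snd e \<in> R. \<alpha> e)"
    proof -
      have "(\<Sum>z\<in>R. \<Sum>e\<in>in_edges E z. \<alpha> e)
          = (\<Sum>z\<in>R. \<Sum>e | e \<in> {e \<in> E. snd e \<in> R} \<and> snd e = z. \<alpha> e)"
        by (intro sum.cong refl) (auto simp: in_edges_def)
      also have "\<dots> = (\<Sum>e | e \<in> E \<and> snd e \<in> R. \<alpha> e)"
        by (rule sum.group) (use finE R in auto)
      finally show ?thesis .
    qed
    moreover have "(\<Sum>z\<in>R. divergence E \<alpha> z) = 0"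
      using div R by (intro sum.neutral) auto
    ultimately have balance: "(\<Sum>e | e \<in> E \<and> fst e \<in> R. \<alpha> e) = (\<Sum>e | e \<in> E \<and> snd e \<in> R. \<alpha> e)"
      by (simp add: divergence_def sum_subtractf)
    have "{e. e \<in> E \<and> fst e \<in> R} \<subset> {e. e \<in> E \<and> snd e \<in> R}"
    proof
      show "{e. e \<in> E \<and> fst e \<in> R} \<subseteq> {e. e \<in> E \<and> snd e \<in> R}"
        using V by (auto simp: R_def intro: rtrancl.rtrancl_into_rtrancl)
      have "(x, y) \<in> {e. e \<in> E \<and> snd e \<in> R} - {e. e \<in> E \<and> fst e \<in> R}"
        using xy not V by (auto simp: R_def)
      then show "{e. e \<in> E \<and> fst e \<in> R} \<noteq> {e. e \<in> E \<and> snd e \<in> R}" by blast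
    qed
    then have "(\<Sum>e | e \<in> E \<and> fst e \<in> R. \<alpha> e) < (\<Sum>e | e \<in> E \<and> snd e \<in> R. \<alpha> e)"
      using finE \<alpha> by (intro sum_strict_mono2[of _ _ "(x, y)"]) (use xy not V in \<open>auto simp: R_def less_imp_le intro: rtrancl.rtrancl_into_rtrancl\<close>)
    with balance show False by simp
  qed
  from path show ?thesis
    by (induction rule: rtrancl_induct) (auto intro: rtrancl_trans edge)
qed

lemma arcs_path_if_path:
  assumes "(x, y) \<in> E\<^sup>*" "e \<in> E" "snd e = x" "f \<in> E" "fst f = y"
  shows "(e, f) \<in> (arcs E)\<^sup>*"
  using assms
proof (induction arbitrary: f rule: rtrancl_induct)
  case base
  then show ?case by (auto simp: arcs_def)
next
  case (step y z)
  then have "(e, (y, z)) \<in> (arcs E)\<^sup>*" by auto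
  moreover have "((y, z), f) \<in> arcs E" using step by (auto simp: arcs_def)
  ultimately show ?case by (rule rtrancl_into_rtrancl)
qed

lemma edges_at_vertex_nonempty:
  assumes "\<And>x y. x \<in> V \<Longrightarrow> y \<in> V \<Longrightarrow> (x, y) \<in> E\<^sup>*" "E \<subseteq> V \<times> V" "E \<noteq> {}" "x \<in> V"
  shows "out_edges E x \<noteq> {}" "in_edges E x \<noteq> {}"
proof -
  obtain a b where ab: "(a, b) \<in> E" using assms(3) by auto
  then have "(x, a) \<in> E\<^sup>*" "(b, x) \<in> E\<^sup>*" using assms by blast+
  from this(1) show "out_edges E x \<noteq> {}"
    using ab by (cases rule: converse_rtranclE) (auto simp: out_edges_def)
  from \<open>(b, x) \<in> E\<^sup>*\<close> show "in_edges E x \<noteq> {}"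
    using ab by (cases rule: rtranclE) (auto simp: in_edges_def)
qed

lemma finite_arcs: "finite E \<Longrightarrow> finite (arcs E)"
  by (rule finite_subset[of _ "E \<times> E"]) (auto simp: arcs_def)

lemma arcs_subset: "arcs E \<subseteq> E \<times> E"
  by (auto simp: arcs_def)

section \<open>Irreducible chains on a finite set\<close>

lemma averaging_eq_min:
  fixes p q :: "'e \<Rightarrow> real"
  assumes "finite S" "\<And>i. i \<in> S \<Longrightarrow> p i > 0" "(\<Sum>i\<in>S. p i) = 1"
    and "\<And>i. i \<in> S \<Longrightarrow> m \<le> q i" "(\<Sum>i\<in>S. p i * q i) = m" "i \<in> S"
  shows "q i = m"
proof -
  have "(\<Sum>i\<in>S. p i * (q i - m)) = (\<Sum>i\<in>S. p i * q i) - (\<Sum>i\<in>S. p i) * m"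
    by (simp add: right_diff_distrib sum_subtractf sum_distrib_right)
  also have "\<dots> = 0" using assms by simp
  finally have "p i * (q i - m) = 0"
    using assms by (subst (asm) sum_nonneg_eq_0_iff) (auto simp: less_imp_le)
  with assms(2)[OF \<open>i \<in> S\<close>] show ?thesis by simp
qed

locale irreducible_relation =
  fixes E :: "'e set" and K :: "('e \<times> 'e) set"
  assumes finite_states: "finite E" and K_subset: "K \<subseteq> E \<times> E"
    and irreducible: "\<And>e f. e \<in> E \<Longrightarrow> f \<in> E \<Longrightarrow> (e, f) \<in> K\<^sup>*"
begin

lemma finite_preds [simp]: "finite {e. (e, f) \<in> K}"
  by (rule finite_subset[OF _ finite_states]) (use K_subset in auto)

lemma finite_succs [simp]: "finite {f. (e, f) \<in> K}"
  by (rule finite_subset[OF _ finite_states]) (use K_subset in auto)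

lemma sum_succs_swap:
  "(\<Sum>f\<in>E. \<Sum>e | (e, f) \<in> K. F e f) = (\<Sum>e\<in>E. \<Sum>f | (e, f) \<in> K. F e f)"
proof -
  have *: "{e. (e, f) \<in> K} = {e \<in> E. (e, f) \<in> K}" "{f. (e, f) \<in> K} = {f \<in> E. (e, f) \<in> K}" for e f
    using K_subset by auto
  show ?thesis
    unfolding * by (rule sum.swap_restrict[OF finite_states finite_states])
qed

text \<open>
  A minimum principle for the chain run backwards from \<open>f\<close> with transition probabilities \<open>p e f\<close>: the
  value at a minimum point other than \<open>r\<close> is an average of values at predecessors, so the minimum
  propagates along a path back to \<open>r\<close>, where \<open>q\<close> takes its largest value. In probabilistic terms, the
  backward chain hits \<open>r\<close> almost surely.
\<close>

lemma harmonic_eq_1: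
  fixes p :: "'e \<Rightarrow> 'e \<Rightarrow> real"
  assumes p: "\<And>e f. (e, f) \<in> K \<Longrightarrow> p e f > 0" "\<And>f. f \<in> E \<Longrightarrow> (\<Sum>e | (e, f) \<in> K. p e f) = 1"
    and r: "r \<in> E" "q r = 1" and le1: "\<And>e. e \<in> E \<Longrightarrow> q e \<le> 1"
    and harm: "\<And>f. f \<in> E \<Longrightarrow> f \<noteq> r \<Longrightarrow> q f = (\<Sum>e | (e, f) \<in> K. p e f * q e)"
    and e: "e \<in> E"
  shows "q e = 1"
proof -
  define m where "m = Min (q ` E)"
  have m: "\<And>e. e \<in> E \<Longrightarrow> m \<le> q e"
    using finite_states by (auto simp: m_def)
  have "m \<in> q ` E" unfolding m_def using finite_states r by (intro Min_in) auto
  then obtain f where f: "f \<in> E" "q f = m" by auto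
  have "(r, f) \<in> K\<^sup>*" using irreducible r f by auto
  then have "q r = m"
    using f
  proof (induction rule: rtrancl_induct)
    case (step y z)
    show ?case
    proof (cases "z = r")
      case False
      then have "q y = m"
        using step K_subset m p harm[of z]
        by (intro averaging_eq_min[of "{e. (e, z) \<in> K}" "\<lambda>e. p e z" m q]) auto
      then show ?thesis using step K_subset by auto
    qed (use step in auto)
  qed
  with m[OF e] le1[OF e] r show ?thesis by simp
qed

end

text \<open>
  The total weight of the walks from \<open>r\<close> to \<open>f\<close> with at most \<open>n\<close> steps that do not return to \<open>r\<close>,
  including the empty walk. For a stochastic matrix its limit is the expected number of visits to
  \<open>f\<close> during an excursion from \<open>r\<close>.
\<close>

primrec taboo_sum :: "('e \<times> 'e) set \<Rightarrow> 'e \<Rightarrow> ('e \<times> 'e \<Rightarrow> real) \<Rightarrow> nat \<Rightarrow> 'e \<Rightarrow> real" where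
  "taboo_sum K r M 0 = (\<lambda>f. of_bool (f = r))"
| "taboo_sum K r M (Suc n) =
     (\<lambda>f. if f = r then 1 else \<Sum>e | (e, f) \<in> K. taboo_sum K r M n e * M (e, f))"

lemma taboo_sum_base [simp]: "taboo_sum K r M n r = 1"
  by (cases n) auto

lemma taboo_sum_nonneg:
  assumes "\<And>k. k \<in> K \<Longrightarrow> 0 \<le> M k"
  shows "0 \<le> taboo_sum K r M n f"
  by (induction n arbitrary: f) (auto intro!: sum_nonneg mult_nonneg_nonneg assms)

lemma taboo_sum_Suc_mono:
  assumes "\<And>k. k \<in> K \<Longrightarrow> 0 \<le> M k"
  shows "taboo_sum K r M n f \<le> taboo_sum K r M (Suc n) f"
proof (induction n arbitrary: f)
  case 0
  show ?case by (auto intro!: sum_nonneg mult_nonneg_nonneg assms)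
next
  case (Suc n)
  show ?case
    by (subst (1 2) taboo_sum.simps) (auto intro!: sum_mono mult_right_mono assms Suc simp del: taboo_sum.simps)
qed

lemma taboo_sum_convergent:
  assumes M: "\<And>k. k \<in> K \<Longrightarrow> 0 \<le> M k" and B: "\<And>n. taboo_sum K r M n f \<le> B"
  obtains l where "(\<lambda>n. taboo_sum K r M n f) \<longlonglongrightarrow> l"
proof -
  have "incseq (\<lambda>n. taboo_sum K r M n f)"
    by (rule incseq_SucI) (rule taboo_sum_Suc_mono[OF M])
  then obtain l where "(\<lambda>n. taboo_sum K r M n f) \<longlonglongrightarrow> l"
    using B by (rule incseq_convergent[OF _ allI])
  then show thesis by (rule that)
qed

context irreducible_relation begin

text \<open>
  The matrix \<open>M\<close> is conjugate by \<open>w\<close> to the transpose of the stochastic matrix \<open>p\<close>, so \<open>w\<close> is a left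
  eigenvector of \<open>M\<close> with eigenvalue 1. Dividing the path sums by \<open>w\<close> gives the probabilities that
  the backward chain hits \<open>r\<close> within \<open>n\<close> steps. These increase to a function that is harmonic away
  from \<open>r\<close>, hence equal to 1.
\<close>

lemma taboo_sum_tendsto:
  fixes p :: "'e \<Rightarrow> 'e \<Rightarrow> real"
  assumes p: "\<And>e f. (e, f) \<in> K \<Longrightarrow> p e f > 0" "\<And>f. f \<in> E \<Longrightarrow> (\<Sum>e | (e, f) \<in> K. p e f) = 1"
    and w: "\<And>e. e \<in> E \<Longrightarrow> w e > 0"
    and M: "\<And>e f. (e, f) \<in> K \<Longrightarrow> M (e, f) = p e f * w f / w e"
    and r: "r \<in> E" and f: "f \<in> E"
  shows "(\<lambda>n. taboo_sum K r M n f) \<longlonglongrightarrow> w f / w r"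
proof -
  have M0: "0 \<le> M k" if "k \<in> K" for k
    using that K_subset by (cases k) (auto simp: M intro!: divide_nonneg_pos mult_nonneg_nonneg less_imp_le[OF p(1)] less_imp_le[OF w] w)
  have scale: "(x * M (e, f)) * (w r / w f) = p e f * (x * (w r / w e))" if "(e, f) \<in> K" for e f x
    using that K_subset w[of e] w[of f] by (auto simp: M field_simps)
  have le: "taboo_sum K r M n f * (w r / w f) \<le> 1" if "f \<in> E" for n f
    using that
  proof (induction n arbitrary: f)
    case (Suc n)
    show ?case
    proof (cases "f = r")
      case False
      have "taboo_sum K r M (Suc n) f * (w r / w f)
        = (\<Sum>e | (e, f) \<in> K. p e f * (taboo_sum K r M n e * (w r / w e)))"
        using False by (simp add: sum_distrib_right scale del: times_divide_eq_right)
      also have "\<dots> \<le> (\<Sum>e | (e, f) \<in> K. p e f * 1)"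
        using K_subset p by (intro sum_mono mult_left_mono Suc) (auto simp: less_imp_le)
      also have "\<dots> = 1" using p Suc by simp
      finally show ?thesis .
    qed (use w[OF r] in simp)
  next
    case 0
    then show ?case using w[OF r] less_imp_le[OF w[of f]] by auto
  qed
  have "\<exists>l. (\<lambda>n. taboo_sum K r M n f) \<longlonglongrightarrow> l" if "f \<in> E" for f
  proof -
    have "taboo_sum K r M n f \<le> w f / w r" for n
      using le[OF that, of n] w[OF that] w[OF r] by (simp add: field_simps)
    then show ?thesis using taboo_sum_convergent[of K M r f "w f / w r"] M0 by blast
  qed
  then obtain l where l: "\<And>f. f \<in> E \<Longrightarrow> (\<lambda>n. taboo_sum K r M n f) \<longlonglongrightarrow> l f" by metis
  define q where "q f = l f * (w r / w f)" for f
  have "q f = 1"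
  proof (rule harmonic_eq_1[where p = p and r = r and q = q, OF p r _ _ _ f])
    have "l r = 1" using LIMSEQ_unique[OF l[OF r]] by simp
    then show "q r = 1" using w[OF r] by (simp add: q_def)
    show "q e \<le> 1" if "e \<in> E" for e
      unfolding q_def
      by (rule LIMSEQ_le_const2[OF tendsto_mult_right[OF l[OF that]]]) (use le[OF that] in blast)
    show "q f = (\<Sum>e | (e, f) \<in> K. p e f * q e)" if "f \<in> E" "f \<noteq> r" for f
    proof -
      have "(\<lambda>n. \<Sum>e | (e, f) \<in> K. taboo_sum K r M n e * M (e, f)) \<longlonglongrightarrow> (\<Sum>e | (e, f) \<in> K. l e * M (e, f))"
        using K_subset by (intro tendsto_sum tendsto_mult_right l) auto
      then have "(\<lambda>n. taboo_sum K r M (Suc n) f) \<longlonglongrightarrow> (\<Sum>e | (e, f) \<in> K. l e * M (e, f))"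
        using that by simp
      with LIMSEQ_Suc[OF l[OF that(1)]] have "l f = (\<Sum>e | (e, f) \<in> K. l e * M (e, f))"
        by (rule LIMSEQ_unique)
      then show ?thesis
        unfolding q_def by (simp add: sum_distrib_right scale del: times_divide_eq_right)
    qed
  qed
  then have "l f * (w r / w f) = 1" by (simp only: q_def)
  have unique: "x = a / b" if "x * (b / a) = 1" "a > 0" "b > 0" for x a b :: real
    using that by (simp add: field_simps)
  have lf: "l f = w f / w r"
    by (rule unique[OF \<open>l f * (w r / w f) = 1\<close> w[OF f] w[OF r]])
  show ?thesis
    unfolding lf[symmetric] by (rule l[OF f])
qed

text \<open>
  A zero of an invariant measure propagates to all predecessors.
\<close>

lemma invariant_measure_zero:
  fixes P :: "'e \<times> 'e \<Rightarrow> real"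
  assumes P: "\<And>k. k \<in> K \<Longrightarrow> P k > 0" and nn: "\<And>e. e \<in> E \<Longrightarrow> \<nu> e \<ge> 0"
    and inv: "\<And>f. f \<in> E \<Longrightarrow> (\<Sum>e | (e, f) \<in> K. \<nu> e * P (e, f)) = \<nu> f"
    and f: "f \<in> E" "\<nu> f = 0" and e: "e \<in> E"
  shows "\<nu> e = 0"
proof -
  have "(e, f) \<in> K\<^sup>*" using irreducible e f by auto
  then show ?thesis
    using f
  proof (induction rule: converse_rtrancl_induct)
    case (step y z)
    then have z: "\<nu> z = 0" "z \<in> E" "y \<in> E" using K_subset by auto
    have "\<nu> y * P (y, z) = 0"
    proof (rule sum_nonneg_0[of "{e. (e, z) \<in> K}" "\<lambda>e. \<nu> e * P (e, z)" y])
      show "(\<Sum>e | (e, z) \<in> K. \<nu> e * P (e, z)) = 0" using inv z by simp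
      show "\<And>e. e \<in> {e. (e, z) \<in> K} \<Longrightarrow> 0 \<le> \<nu> e * P (e, z)"
        using K_subset by (auto intro!: mult_nonneg_nonneg nn less_imp_le[OF P])
    qed (use step in auto)
    with P[OF step(1)] show ?case by simp
  qed auto
qed

text \<open>
  The limit of the taboo sums, that is, the expected numbers of visits during an excursion from \<open>r\<close>.
  Let \<open>a n\<close> be the probability of a return to \<open>r\<close> within \<open>n + 1\<close> steps. In one step the total mass
  of the sums grows by \<open>1 - a n\<close>. Since the sums increase, \<open>a n\<close> is at most 1, and this bound
  propagates backwards along paths into \<open>r\<close>, so the sums converge. Their total mass then converges
  too, which forces \<open>a n\<close> to tend to 1: this is invariance at \<open>r\<close>.
\<close>

lemma ex_invariant_measure:
  fixes P :: "'e \<times> 'e \<Rightarrow> real"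
  assumes P: "\<And>k. k \<in> K \<Longrightarrow> P k > 0" and stoch: "\<And>e. e \<in> E \<Longrightarrow> (\<Sum>f | (e, f) \<in> K. P (e, f)) = 1"
    and r: "r \<in> E"
  shows "\<exists>\<nu>. (\<forall>e\<in>E. \<nu> e \<ge> 0) \<and> \<nu> r = 1
    \<and> (\<forall>f\<in>E. (\<Sum>e | (e, f) \<in> K. \<nu> e * P (e, f)) = \<nu> f)"
proof -
  let ?G = "taboo_sum K r P"
  have P0: "0 \<le> P k" if "k \<in> K" for k using P[OF that] by simp
  have G0: "0 \<le> ?G n e" for n e by (rule taboo_sum_nonneg[OF P0])
  have G_mono: "?G n e \<le> ?G (Suc n) e" for n e by (rule taboo_sum_Suc_mono[OF P0])
  define a where "a n = (\<Sum>e | (e, r) \<in> K. ?G n e * P (e, r))" for n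
  have mass: "(\<Sum>f\<in>E. ?G (Suc n) f) = (\<Sum>e\<in>E. ?G n e) + 1 - a n" for n
  proof -
    have "(\<Sum>f\<in>E. ?G (Suc n) f) = 1 + (\<Sum>f\<in>E - {r}. \<Sum>e | (e, f) \<in> K. ?G n e * P (e, f))"
      using finite_states r by (subst sum.remove[of E r]) auto
    also have "(\<Sum>f\<in>E - {r}. \<Sum>e | (e, f) \<in> K. ?G n e * P (e, f))
       = (\<Sum>f\<in>E. \<Sum>e | (e, f) \<in> K. ?G n e * P (e, f)) - a n"
      using finite_states r by (subst sum.remove[of E r]) (auto simp: a_def)
    also have "(\<Sum>f\<in>E. \<Sum>e | (e, f) \<in> K. ?G n e * P (e, f)) = (\<Sum>e\<in>E. ?G n e)"
      unfolding sum_succs_swap by (simp add: sum_distrib_left[symmetric] stoch)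
    finally show ?thesis by simp
  qed
  have a_le: "a n \<le> 1" for n
    using sum_mono[of E "?G n" "?G (Suc n)", OF G_mono] mass[of n] by linarith
  have bounded: "\<exists>B. \<forall>n. ?G n e \<le> B" if "e \<in> E" for e
  proof -
    have "(e, r) \<in> K\<^sup>*" using irreducible that r by auto
    then show ?thesis
    proof (induction rule: converse_rtrancl_induct)
      case base
      show ?case by (auto intro: exI[of _ 1])
    next
      case (step y z)
      then obtain B where B: "\<And>n. ?G n z \<le> B" by auto
      have "?G n y * P (y, z) \<le> max 1 B" for n
      proof -
        have "?G n y * P (y, z) \<le> (\<Sum>e | (e, z) \<in> K. ?G n e * P (e, z))"
          using step G0 P0 by (intro member_le_sum) auto
        also have "\<dots> \<le> max 1 B"
          using a_le[of n] B[of "Suc n"] by (cases "z = r") (auto simp: a_def)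
        finally show ?thesis .
      qed
      then show ?case using P[OF step(1)] by (auto simp: field_simps intro!: exI[of _ "max 1 B / P (y, z)"])
    qed
  qed
  have "\<exists>l. (\<lambda>n. ?G n e) \<longlonglongrightarrow> l" if "e \<in> E" for e
  proof -
    from bounded[OF that] obtain B where "\<And>n. ?G n e \<le> B" by blast
    then show ?thesis using taboo_sum_convergent[of K P r e B] P0 by blast
  qed
  then obtain \<nu> where lim: "\<And>e. e \<in> E \<Longrightarrow> (\<lambda>n. ?G n e) \<longlonglongrightarrow> \<nu> e" by metis
  have \<nu>r: "\<nu> r = 1" using LIMSEQ_unique[OF lim[OF r]] by simp
  have lim_sum: "(\<lambda>n. \<Sum>e | (e, f) \<in> K. ?G n e * P (e, f)) \<longlonglongrightarrow> (\<Sum>e | (e, f) \<in> K. \<nu> e * P (e, f))" for f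
    using K_subset by (intro tendsto_sum tendsto_mult_right lim) auto
  show ?thesis
  proof (intro exI[of _ \<nu>] conjI ballI)
    show "\<nu> e \<ge> 0" if "e \<in> E" for e
      using G0 by (intro LIMSEQ_le_const[OF lim[OF that]]) auto
    show "\<nu> r = 1" by (rule \<nu>r)
    show "(\<Sum>e | (e, f) \<in> K. \<nu> e * P (e, f)) = \<nu> f" if "f \<in> E" for f
    proof (cases "f = r")
      case False
      then show ?thesis
        using LIMSEQ_unique[OF LIMSEQ_Suc[OF lim[OF that]]] lim_sum[of f] by simp
    next
      case True
      define m where "m n = (\<Sum>e\<in>E. ?G n e)" for n
      have "m \<longlonglongrightarrow> (\<Sum>e\<in>E. \<nu> e)"
        unfolding m_def by (intro tendsto_sum lim)
      then have "(\<lambda>n. m n + 1 - m (Suc n)) \<longlonglongrightarrow> (\<Sum>e\<in>E. \<nu> e) + 1 - (\<Sum>e\<in>E. \<nu> e)"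
        by (intro tendsto_intros LIMSEQ_Suc)
      moreover have "a = (\<lambda>n. m n + 1 - m (Suc n))"
        using mass by (intro ext) (simp only: m_def)
      ultimately have "a \<longlonglongrightarrow> 1" by simp
      moreover have "a \<longlonglongrightarrow> (\<Sum>e | (e, r) \<in> K. \<nu> e * P (e, r))"
        unfolding a_def using lim_sum .
      ultimately have "(\<Sum>e | (e, r) \<in> K. \<nu> e * P (e, r)) = 1" by (rule LIMSEQ_unique[symmetric])
      then show ?thesis using True \<nu>r by simp
    qed
  qed
qed

end

section \<open>Time reversal of environments\<close>

lemma environmentsD:
  assumes "\<omega> \<in> environments E"
  shows "\<And>k. k \<in> arcs E \<Longrightarrow> 0 < \<omega> k" "\<And>k. k \<in> arcs E \<Longrightarrow> \<omega> k \<le> 1"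
    "\<And>e. e \<in> E \<Longrightarrow> (\<Sum>e' | (e, e') \<in> arcs E. \<omega> (e, e')) = 1" "\<omega> \<in> extensional (arcs E)"
  using assms by (auto simp: environments_def PiE_def)

lemma arcs_converse_iff: "(f, g) \<in> arcs (E\<inverse>) \<longleftrightarrow> (prod.swap g, prod.swap f) \<in> arcs E"
  by (cases f; cases g) (auto simp: arcs_def)

lemma invariant_probD:
  assumes "invariant_prob E \<omega> \<pi>"
  shows "\<And>e. e \<in> E \<Longrightarrow> 0 \<le> \<pi> e" "(\<Sum>e\<in>E. \<pi> e) = 1"
    "\<And>f. f \<in> E \<Longrightarrow> (\<Sum>e | (e, f) \<in> arcs E. \<pi> e * \<omega> (e, f)) = \<pi> f" "\<pi> \<in> extensional E"
proof -
  show "0 \<le> \<pi> e" if "e \<in> E" for e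
    using PiE_mem[of \<pi> E "\<lambda>_. {0..}" e] assms that by (simp add: invariant_prob_def)
qed (use assms in \<open>simp_all add: invariant_prob_def PiE_def\<close>)

lemma invariant_prob_pos:
  assumes irr: "irreducible_relation E (arcs E)" and \<omega>: "\<omega> \<in> environments E"
    and \<pi>: "invariant_prob E \<omega> \<pi>" and e: "e \<in> E"
  shows "\<pi> e > 0"
proof (rule ccontr)
  interpret irreducible_relation E "arcs E" by (rule irr)
  assume "\<not> \<pi> e > 0"
  with invariant_probD(1)[OF \<pi> e] have "\<pi> e = 0" by simp
  have "\<pi> f = 0" if "f \<in> E" for f
  proof (rule invariant_measure_zero[where P = \<omega> and \<nu> = \<pi> and f = e and e = f])
    show "\<omega> k > 0" if "k \<in> arcs E" for k by (rule environmentsD(1)[OF \<omega> that])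
    show "0 \<le> \<pi> g" if "g \<in> E" for g by (rule invariant_probD(1)[OF \<pi> that])
    show "(\<Sum>e | (e, g) \<in> arcs E. \<pi> e * \<omega> (e, g)) = \<pi> g" if "g \<in> E" for g
      by (rule invariant_probD(3)[OF \<pi> that])
  qed fact+
  then have "(\<Sum>f\<in>E. \<pi> f) = 0" by simp
  with invariant_probD(2)[OF \<pi>] show False by simp
qed

text \<open>
  Subtract from \<open>\<pi>\<close> the largest multiple of \<open>\<pi>'\<close> that keeps the difference nonnegative. The
  difference is an invariant measure with a zero, hence zero.
\<close>

lemma invariant_prob_unique:
  assumes irr: "irreducible_relation E (arcs E)" and \<omega>: "\<omega> \<in> environments E" and "E \<noteq> {}"
    and \<pi>: "invariant_prob E \<omega> \<pi>" "invariant_prob E \<omega> \<pi>'"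
  shows "\<pi> = \<pi>'"
proof -
  interpret irreducible_relation E "arcs E" by (rule irr)
  note pos = invariant_prob_pos[OF irr \<omega> \<pi>(1)] invariant_prob_pos[OF irr \<omega> \<pi>(2)]
  define c where "c = Min ((\<lambda>e. \<pi> e / \<pi>' e) ` E)"
  have c: "c \<le> \<pi> e / \<pi>' e" if "e \<in> E" for e
    using finite_states that by (auto simp: c_def)
  have "c \<in> (\<lambda>e. \<pi> e / \<pi>' e) ` E"
    unfolding c_def using finite_states \<open>E \<noteq> {}\<close> by (intro Min_in) auto
  then obtain f where f: "f \<in> E" "c = \<pi> f / \<pi>' f" by auto
  have "\<pi> e - c * \<pi>' e = 0" if "e \<in> E" for e
  proof (rule invariant_measure_zero[where P = \<omega> and \<nu> = "\<lambda>e. \<pi> e - c * \<pi>' e" and f = f and e = e])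
    show "\<omega> k > 0" if "k \<in> arcs E" for k by (rule environmentsD(1)[OF \<omega> that])
    show "0 \<le> \<pi> e - c * \<pi>' e" if "e \<in> E" for e
      using c[OF that] pos(2)[OF that] by (simp add: field_simps)
    show "(\<Sum>e | (e, f) \<in> arcs E. (\<pi> e - c * \<pi>' e) * \<omega> (e, f)) = \<pi> f - c * \<pi>' f" if "f \<in> E" for f
      using invariant_probD(3)[OF \<pi>(1) that] invariant_probD(3)[OF \<pi>(2) that]
      by (simp add: left_diff_distrib sum_subtractf mult.assoc sum_distrib_left[symmetric])
    show "\<pi> f - c * \<pi>' f = 0" using f pos(2)[OF f(1)] by simp
  qed (use f that in auto)
  then have eq: "\<pi> e = c * \<pi>' e" if "e \<in> E" for e using that by auto
  have "1 = (\<Sum>e\<in>E. \<pi> e)" by (rule invariant_probD(2)[OF \<pi>(1), symmetric])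
  also have "\<dots> = c * (\<Sum>e\<in>E. \<pi>' e)" by (simp add: eq sum_distrib_left)
  also have "\<dots> = c" by (simp add: invariant_probD(2)[OF \<pi>(2)])
  finally have "c = 1" by simp
  with eq show ?thesis
    by (intro extensionalityI[OF invariant_probD(4)[OF \<pi>(1)] invariant_probD(4)[OF \<pi>(2)]]) simp
qed

lemma ex_invariant_prob:
  assumes irr: "irreducible_relation E (arcs E)" and \<omega>: "\<omega> \<in> environments E" and "E \<noteq> {}"
  obtains \<pi> where "invariant_prob E \<omega> \<pi>"
proof -
  interpret irreducible_relation E "arcs E" by (rule irr)
  obtain r where r: "r \<in> E" using \<open>E \<noteq> {}\<close> by auto
  obtain \<nu> where \<nu>: "\<And>e. e \<in> E \<Longrightarrow> \<nu> e \<ge> 0" "\<nu> r = 1"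
    "\<And>f. f \<in> E \<Longrightarrow> (\<Sum>e | (e, f) \<in> arcs E. \<nu> e * \<omega> (e, f)) = \<nu> f"
    using ex_invariant_measure[where P = \<omega> and r = r, OF environmentsD(1)[OF \<omega>] environmentsD(3)[OF \<omega>] r]
    by blast
  define m where "m = (\<Sum>e\<in>E. \<nu> e)"
  have "\<nu> r \<le> m" unfolding m_def using r \<nu>(1) finite_states by (intro member_le_sum) auto
  then have m: "m > 0" using \<nu>(2) by simp
  have "invariant_prob E \<omega> (\<lambda>e\<in>E. \<nu> e / m)"
    unfolding invariant_prob_def
  proof (intro conjI ballI)
    show "(\<lambda>e\<in>E. \<nu> e / m) \<in> E \<rightarrow>\<^sub>E {0..}" using \<nu>(1) m by auto
    show "(\<Sum>e\<in>E. (\<lambda>e\<in>E. \<nu> e / m) e) = 1" using m by (simp add: m_def flip: sum_divide_distrib)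
    fix f assume f: "f \<in> E"
    have "(\<Sum>e | (e, f) \<in> arcs E. (\<lambda>e\<in>E. \<nu> e / m) e * \<omega> (e, f))
      = (\<Sum>e | (e, f) \<in> arcs E. \<nu> e * \<omega> (e, f) / m)"
      by (intro sum.cong) (auto simp: arcs_def)
    also have "\<dots> = \<nu> f / m" using \<nu>(3)[OF f] by (simp flip: sum_divide_distrib)
    finally show "(\<Sum>e | (e, f) \<in> arcs E. (\<lambda>e\<in>E. \<nu> e / m) e * \<omega> (e, f)) = (\<lambda>e\<in>E. \<nu> e / m) f"
      using f by simp
  qed
  then show thesis by (rule that)
qed

lemma invariant_prob_the:
  assumes "irreducible_relation E (arcs E)" "\<omega> \<in> environments E" "E \<noteq> {}"
  shows "invariant_prob E \<omega> (the_invariant_prob E \<omega>)"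
proof -
  obtain \<pi> where \<pi>: "invariant_prob E \<omega> \<pi>" by (rule ex_invariant_prob[OF assms])
  have "the_invariant_prob E \<omega> = \<pi>"
    unfolding the_invariant_prob_def
    by (rule the_equality[where P = "invariant_prob E \<omega>", OF \<pi>]) (rule invariant_prob_unique[OF assms _ \<pi>])
  with \<pi> show ?thesis by simp
qed

lemma sum_arcs_converse:
  "(\<Sum>g | (f, g) \<in> arcs (E\<inverse>). F g) = (\<Sum>e | (e, prod.swap f) \<in> arcs E. F (prod.swap e))"
  by (rule sum.reindex_bij_witness[where i = prod.swap and j = prod.swap]) (auto simp: arcs_converse_iff)

lemma time_reversal_arc:
  assumes "(e, e') \<in> arcs E"
  shows "time_reversal E \<omega> (prod.swap e', prod.swap e)
    = the_invariant_prob E \<omega> e * \<omega> (e, e') / the_invariant_prob E \<omega> e'"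
  using assms by (simp add: time_reversal_def arcs_converse_iff)

lemma time_reversal_in_environments:
  assumes irr: "irreducible_relation E (arcs E)" and \<omega>: "\<omega> \<in> environments E" and ne: "E \<noteq> {}"
  shows "time_reversal E \<omega> \<in> environments (E\<inverse>)"
proof -
  interpret irreducible_relation E "arcs E" by (rule irr)
  note inv = invariant_prob_the[OF assms]
  note pos = invariant_prob_pos[OF irr \<omega> inv]
  have fin: "finite {g. (f, g) \<in> arcs (E\<inverse>)}" for f
    by (rule finite_subset[of _ "E\<inverse>"]) (use finite_states in \<open>auto simp: arcs_def\<close>)
  have pos_rev: "0 < time_reversal E \<omega> k" if "k \<in> arcs (E\<inverse>)" for k
  proof -
    obtain f g where fg: "k = (f, g)" by (cases k)
    with that have a: "(prod.swap g, prod.swap f) \<in> arcs E" by (simp add: arcs_converse_iff)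
    then have "prod.swap g \<in> E" "prod.swap f \<in> E" by (auto simp: arcs_def)
    with time_reversal_arc[OF a, of \<omega>] pos environmentsD(1)[OF \<omega> a] fg show ?thesis by simp
  qed
  have sum1: "(\<Sum>g | (f, g) \<in> arcs (E\<inverse>). time_reversal E \<omega> (f, g)) = 1" if "f \<in> E\<inverse>" for f
  proof -
    have f: "prod.swap f \<in> E" using that by (cases f) auto
    have "(\<Sum>g | (f, g) \<in> arcs (E\<inverse>). time_reversal E \<omega> (f, g))
      = (\<Sum>e | (e, prod.swap f) \<in> arcs E. time_reversal E \<omega> (prod.swap (prod.swap f), prod.swap e))"
      by (simp add: sum_arcs_converse)
    also have "\<dots> = (\<Sum>e | (e, prod.swap f) \<in> arcs E. the_invariant_prob E \<omega> e * \<omega> (e, prod.swap f) / the_invariant_prob E \<omega> (prod.swap f))"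
      by (intro sum.cong refl time_reversal_arc) auto
    also have "\<dots> = 1"
      using invariant_probD(3)[OF inv f] pos[OF f] by (simp add: sum_divide_distrib[symmetric])
    finally show ?thesis .
  qed
  have le1: "time_reversal E \<omega> (f, g) \<le> 1" if "(f, g) \<in> arcs (E\<inverse>)" for f g
  proof -
    have "time_reversal E \<omega> (f, g) \<le> (\<Sum>g | (f, g) \<in> arcs (E\<inverse>). time_reversal E \<omega> (f, g))"
      using that fin by (intro member_le_sum) (auto intro: less_imp_le[OF pos_rev])
    also have "\<dots> = 1" using that by (intro sum1) (auto simp: arcs_def)
    finally show ?thesis .
  qed
  show ?thesis
    unfolding environments_def mem_Collect_eq
  proof (intro conjI PiE_I ballI)
    fix k assume k: "k \<in> arcs (E\<inverse>)"
    obtain f g where "k = (f, g)" by (cases k)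
    with k pos_rev[OF k] le1[of f g] show "time_reversal E \<omega> k \<in> {0<..1}" by simp
  next
    fix k assume "k \<notin> arcs (E\<inverse>)"
    then show "time_reversal E \<omega> k = undefined" by (simp add: time_reversal_def)
  qed (rule sum1)
qed

section \<open>Balanced monomials\<close>

definition out_count :: "('v \<times> 'v) set \<Rightarrow> (('v \<times> 'v) \<times> ('v \<times> 'v) \<Rightarrow> nat) \<Rightarrow> 'v \<times> 'v \<Rightarrow> nat" where
  "out_count E \<kappa> e = (\<Sum>k | k \<in> arcs E \<and> fst k = e. \<kappa> k)"

definition in_count :: "('v \<times> 'v) set \<Rightarrow> (('v \<times> 'v) \<times> ('v \<times> 'v) \<Rightarrow> nat) \<Rightarrow> 'v \<times> 'v \<Rightarrow> nat" where
  "in_count E \<kappa> e = (\<Sum>k | k \<in> arcs E \<and> snd k = e. \<kappa> k)"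

text \<open>
  Balanced exponents are the arc counts of families of closed walks: each edge is left as often as
  it is entered.
\<close>

definition balanced :: "('v \<times> 'v) set \<Rightarrow> (('v \<times> 'v) \<times> ('v \<times> 'v) \<Rightarrow> nat) \<Rightarrow> bool" where
  "balanced E \<kappa> \<longleftrightarrow> (\<forall>e\<in>E. out_count E \<kappa> e = in_count E \<kappa> e)"

definition monomial :: "('v \<times> 'v) set \<Rightarrow> (('v \<times> 'v) \<times> ('v \<times> 'v) \<Rightarrow> nat)
    \<Rightarrow> (('v \<times> 'v) \<times> ('v \<times> 'v) \<Rightarrow> real) \<Rightarrow> real" where
  "monomial E \<kappa> \<omega> = (\<Prod>k\<in>arcs E. \<omega> k ^ \<kappa> k)"

lemma count_add:
  "out_count E (\<lambda>k. \<kappa> k + \<kappa>' k) e = out_count E \<kappa> e + out_count E \<kappa>' e"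
  "in_count E (\<lambda>k. \<kappa> k + \<kappa>' k) e = in_count E \<kappa> e + in_count E \<kappa>' e"
  by (simp_all add: out_count_def in_count_def sum.distrib)

lemma count_single:
  assumes "finite E" "k \<in> arcs E"
  shows "out_count E (\<lambda>k'. of_bool (k' = k)) e = of_bool (e = fst k)"
    "in_count E (\<lambda>k'. of_bool (k' = k)) e = of_bool (e = snd k)"
  using assms finite_arcs[OF assms(1)]
  by (auto simp: out_count_def in_count_def of_bool_def sum.delta)

lemma count_sum:
  "out_count E (\<lambda>k. \<Sum>i\<in>B. m i * \<kappa> i k) e = (\<Sum>i\<in>B. m i * out_count E (\<kappa> i) e)"
  "in_count E (\<lambda>k. \<Sum>i\<in>B. m i * \<kappa> i k) e = (\<Sum>i\<in>B. m i * in_count E (\<kappa> i) e)"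
  unfolding out_count_def in_count_def sum_distrib_left by (rule sum.swap)+

lemma balanced_sum:
  "(\<And>i. i \<in> B \<Longrightarrow> balanced E (\<kappa> i)) \<Longrightarrow> balanced E (\<lambda>k. \<Sum>i\<in>B. m i * \<kappa> i k)"
  by (auto simp: balanced_def count_sum intro!: sum.cong)

lemma monomial_add: "monomial E (\<lambda>k. \<kappa> k + \<kappa>' k) \<omega> = monomial E \<kappa> \<omega> * monomial E \<kappa>' \<omega>"
  by (simp add: monomial_def power_add prod.distrib)

lemma monomial_single:
  assumes "finite E" "k \<in> arcs E"
  shows "monomial E (\<lambda>k'. of_bool (k' = k)) \<omega> = \<omega> k"
proof -
  have "monomial E (\<lambda>k'. of_bool (k' = k)) \<omega> = (\<Prod>k'\<in>arcs E. if k' = k then \<omega> k' else 1)"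
    unfolding monomial_def by (intro prod.cong) auto
  also have "\<dots> = \<omega> k" using assms finite_arcs[OF assms(1)] by (simp add: prod.delta)
  finally show ?thesis .
qed

lemma monomial_sum: "monomial E (\<lambda>k. \<Sum>i\<in>B. m i * \<kappa> i k) \<omega> = (\<Prod>i\<in>B. monomial E (\<kappa> i) \<omega> ^ m i)"
proof -
  have "monomial E (\<lambda>k. \<Sum>i\<in>B. m i * \<kappa> i k) \<omega> = (\<Prod>k\<in>arcs E. \<Prod>i\<in>B. (\<omega> k ^ \<kappa> i k) ^ m i)"
    unfolding monomial_def by (intro prod.cong refl) (simp add: power_sum power_mult[symmetric] mult.commute)
  also have "\<dots> = (\<Prod>i\<in>B. \<Prod>k\<in>arcs E. (\<omega> k ^ \<kappa> i k) ^ m i)" by (rule prod.swap)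
  finally show ?thesis by (simp add: monomial_def prod_power_distrib)
qed

lemma monomial_pos: "(\<And>k. k \<in> arcs E \<Longrightarrow> \<omega> k > 0) \<Longrightarrow> monomial E \<kappa> \<omega> > 0"
  by (auto simp: monomial_def intro!: prod_pos)

lemma prod_arcs_by_tail_head:
  fixes g :: "'v \<times> 'v \<Rightarrow> real"
  assumes "finite E"
  shows "(\<Prod>k\<in>arcs E. g (fst k) ^ \<kappa> k) = (\<Prod>e\<in>E. g e ^ out_count E \<kappa> e)"
    "(\<Prod>k\<in>arcs E. g (snd k) ^ \<kappa> k) = (\<Prod>e\<in>E. g e ^ in_count E \<kappa> e)"
proof -
  have "(\<Prod>e\<in>E. g e ^ out_count E \<kappa> e) = (\<Prod>e\<in>E. \<Prod>k | k \<in> arcs E \<and> fst k = e. g (fst k) ^ \<kappa> k)"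
    unfolding out_count_def by (intro prod.cong refl) (simp add: power_sum)
  also have "\<dots> = (\<Prod>k\<in>arcs E. g (fst k) ^ \<kappa> k)"
    by (rule prod.group) (use assms finite_arcs in \<open>auto simp: arcs_def\<close>)
  finally show "(\<Prod>k\<in>arcs E. g (fst k) ^ \<kappa> k) = (\<Prod>e\<in>E. g e ^ out_count E \<kappa> e)" by simp
  have "(\<Prod>e\<in>E. g e ^ in_count E \<kappa> e) = (\<Prod>e\<in>E. \<Prod>k | k \<in> arcs E \<and> snd k = e. g (snd k) ^ \<kappa> k)"
    unfolding in_count_def by (intro prod.cong refl) (simp add: power_sum)
  also have "\<dots> = (\<Prod>k\<in>arcs E. g (snd k) ^ \<kappa> k)"
    by (rule prod.group) (use assms finite_arcs in \<open>auto simp: arcs_def\<close>)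
  finally show "(\<Prod>k\<in>arcs E. g (snd k) ^ \<kappa> k) = (\<Prod>e\<in>E. g e ^ in_count E \<kappa> e)" by simp
qed

text \<open>
  Factors attached to the tail and to the head of an arc are collected at the edges of the graph,
  where by balance they occur equally often. It is used twice: for the invariant measure in a time
  reversal, with \<open>g\<close> and \<open>h\<close> inverse to each other, and for the factors \<open>1 / s(e)\<close> and \<open>u(e')\<close> of
  the random environment.
\<close>

lemma monomial_gauge:
  assumes fin: "finite E" and bal: "balanced E \<kappa>"
    and eq: "\<And>e e'. (e, e') \<in> arcs E \<Longrightarrow> \<omega>' (e, e') = \<omega> (e, e') * (g e * h e')"
  shows "monomial E \<kappa> \<omega>' = monomial E \<kappa> \<omega> * (\<Prod>e\<in>E. (g e * h e) ^ out_count E \<kappa> e)"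
proof -
  have "monomial E \<kappa> \<omega>' = (\<Prod>k\<in>arcs E. \<omega> k ^ \<kappa> k * (g (fst k) ^ \<kappa> k * h (snd k) ^ \<kappa> k))"
    unfolding monomial_def by (intro prod.cong refl) (auto simp: eq power_mult_distrib)
  also have "\<dots> = monomial E \<kappa> \<omega> * ((\<Prod>e\<in>E. g e ^ out_count E \<kappa> e) * (\<Prod>e\<in>E. h e ^ in_count E \<kappa> e))"
    by (simp add: prod.distrib prod_arcs_by_tail_head[OF fin] monomial_def)
  also have "(\<Prod>e\<in>E. h e ^ in_count E \<kappa> e) = (\<Prod>e\<in>E. h e ^ out_count E \<kappa> e)"
    using bal by (intro prod.cong) (auto simp: balanced_def)
  finally show ?thesis by (simp add: prod.distrib power_mult_distrib)
qed

text \<open>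
  The arc of the reversed graph that corresponds to an arc of the graph, and conversely.
\<close>

definition flip_arc :: "('v \<times> 'v) \<times> ('v \<times> 'v) \<Rightarrow> ('v \<times> 'v) \<times> ('v \<times> 'v)" where
  "flip_arc k = (prod.swap (snd k), prod.swap (fst k))"

lemma flip_arc_flip_arc [simp]: "flip_arc (flip_arc k) = k"
  by (simp add: flip_arc_def)

lemma flip_arc_Pair [simp]: "flip_arc (e, f) = (prod.swap f, prod.swap e)"
  by (simp add: flip_arc_def)

lemma flip_arc_in_arcs_converse [simp]: "flip_arc k \<in> arcs (E\<inverse>) \<longleftrightarrow> k \<in> arcs E"
  by (cases k) (simp add: arcs_converse_iff)

lemma flip_arc_in_arcs [simp]: "flip_arc k \<in> arcs E \<longleftrightarrow> k \<in> arcs (E\<inverse>)"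
  by (cases k) (simp add: arcs_converse_iff)

lemma monomial_time_reversal:
  assumes irr: "irreducible_relation E (arcs E)" and \<omega>: "\<omega> \<in> environments E" and ne: "E \<noteq> {}"
    and bal: "balanced E \<kappa>"
  shows "monomial E \<kappa> (\<lambda>k. time_reversal E \<omega> (flip_arc k)) = monomial E \<kappa> \<omega>"
proof -
  interpret irreducible_relation E "arcs E" by (rule irr)
  let ?\<pi> = "the_invariant_prob E \<omega>"
  note pos = invariant_prob_pos[OF irr \<omega> invariant_prob_the[OF irr \<omega> ne]]
  have "monomial E \<kappa> (\<lambda>k. time_reversal E \<omega> (flip_arc k))
    = monomial E \<kappa> \<omega> * (\<Prod>e\<in>E. (?\<pi> e * inverse (?\<pi> e)) ^ out_count E \<kappa> e)"
    by (rule monomial_gauge[OF finite_states bal]) (simp add: time_reversal_arc field_simps)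
  also have "(\<Prod>e\<in>E. (?\<pi> e * inverse (?\<pi> e)) ^ out_count E \<kappa> e) = 1"
    by (intro prod.neutral) (auto dest!: pos)
  finally show ?thesis by simp
qed

section \<open>Reconstruction from balanced monomials\<close>

text \<open>
  The arc counts of a path from \<open>e\<close> to \<open>f\<close> are balanced except for a surplus departure at \<open>e\<close> and a
  surplus arrival at \<open>f\<close>. The endpoints may coincide, so the surpluses are added to opposite sides
  instead of being subtracted.
\<close>

lemma ex_path_count:
  assumes "finite E" "(e, f) \<in> (arcs E)\<^sup>*"
  shows "\<exists>\<kappa>. \<forall>g. out_count E \<kappa> g + of_bool (g = f) = in_count E \<kappa> g + of_bool (g = e)"
  using assms(2)
proof (induction rule: rtrancl_induct)
  case base
  show ?case by (intro exI[of _ "\<lambda>_. 0"]) (simp add: out_count_def in_count_def)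
next
  case (step y z)
  then obtain \<kappa> where \<kappa>: "\<And>g. out_count E \<kappa> g + of_bool (g = y) = in_count E \<kappa> g + of_bool (g = e)" by blast
  show ?case
  proof (intro exI allI)
    fix g
    show "out_count E (\<lambda>k. \<kappa> k + of_bool (k = (y, z))) g + of_bool (g = z)
      = in_count E (\<lambda>k. \<kappa> k + of_bool (k = (y, z))) g + of_bool (g = e)"
      using \<kappa>[of g] count_single[OF assms(1) step(2)] by (simp add: count_add)
  qed
qed

definition path_count :: "('v \<times> 'v) set \<Rightarrow> 'v \<times> 'v \<Rightarrow> 'v \<times> 'v \<Rightarrow> ('v \<times> 'v) \<times> ('v \<times> 'v) \<Rightarrow> nat" where
  "path_count E e f =
     (SOME \<kappa>. \<forall>g. out_count E \<kappa> g + of_bool (g = f) = in_count E \<kappa> g + of_bool (g = e))"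

lemma path_count:
  assumes "finite E" "(e, f) \<in> (arcs E)\<^sup>*"
  shows "out_count E (path_count E e f) g + of_bool (g = f) = in_count E (path_count E e f) g + of_bool (g = e)"
  using someI_ex[OF ex_path_count[OF assms]] unfolding path_count_def by blast

text \<open>
  Two kinds of closed walks through the root \<open>r\<close>: a path from \<open>r\<close> to \<open>e\<close> and back, and a path from
  \<open>r\<close> to the tail of an arc \<open>a\<close>, the arc itself, and the path back from its head. In the quotient of
  the weights of the second kind, for \<open>a = (e, e')\<close>, and of the first kind, for \<open>e'\<close>, the common path
  back to \<open>r\<close> cancels. What remains is \<open>h(e) \<omega>(e,e') / h(e')\<close>, with \<open>h\<close> the weight of the path from
  \<open>r\<close>.
\<close>

definition edge_loop :: "('v \<times> 'v) set \<Rightarrow> 'v \<times> 'v \<Rightarrow> 'v \<times> 'v \<Rightarrow> ('v \<times> 'v) \<times> ('v \<times> 'v) \<Rightarrow> nat" where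
  "edge_loop E r e = (\<lambda>k. path_count E r e k + path_count E e r k)"

definition arc_loop :: "('v \<times> 'v) set \<Rightarrow> 'v \<times> 'v \<Rightarrow> ('v \<times> 'v) \<times> ('v \<times> 'v) \<Rightarrow> ('v \<times> 'v) \<times> ('v \<times> 'v) \<Rightarrow> nat" where
  "arc_loop E r a = (\<lambda>k. (path_count E r (fst a) k + of_bool (k = a)) + path_count E (snd a) r k)"

definition loops :: "('v \<times> 'v) set \<Rightarrow> 'v \<times> 'v \<Rightarrow> (('v \<times> 'v) \<times> ('v \<times> 'v) \<Rightarrow> nat) set" where
  "loops E r = edge_loop E r ` E \<union> arc_loop E r ` arcs E"

lemma balanced_loops:
  assumes irr: "irreducible_relation E (arcs E)" and r: "r \<in> E" and \<kappa>: "\<kappa> \<in> loops E r"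
  shows "balanced E \<kappa>"
proof -
  interpret irreducible_relation E "arcs E" by (rule irr)
  note pc = path_count[OF finite_states irreducible]
  from \<kappa> consider e where "e \<in> E" "\<kappa> = edge_loop E r e" | a where "a \<in> arcs E" "\<kappa> = arc_loop E r a"
    by (auto simp: loops_def)
  then show ?thesis
  proof cases
    case 1
    show ?thesis
      unfolding balanced_def 1 edge_loop_def count_add
    proof
      fix g assume "g \<in> E"
      from pc[OF r \<open>e \<in> E\<close>, of g] pc[OF \<open>e \<in> E\<close> r, of g]
      show "out_count E (path_count E r e) g + out_count E (path_count E e r) g =
         in_count E (path_count E r e) g + in_count E (path_count E e r) g" by linarith
    qed
  next
    case 2
    then have a: "fst a \<in> E" "snd a \<in> E" using K_subset by auto
    show ?thesis
      unfolding balanced_def 2 arc_loop_def count_add count_single[OF finite_states \<open>a \<in> arcs E\<close>]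
    proof
      fix g assume "g \<in> E"
      from pc[OF r a(1), of g] pc[OF a(2) r, of g]
      show "out_count E (path_count E r (fst a)) g + of_bool (g = fst a) + out_count E (path_count E (snd a) r) g =
         in_count E (path_count E r (fst a)) g + of_bool (g = snd a) + in_count E (path_count E (snd a) r) g" by linarith
    qed
  qed
qed

text \<open>
  From the values \<open>y \<kappa>\<close> of the loop monomials: \<open>M\<close> is the environment conjugated by the path weights
  \<open>h\<close>, \<open>G\<close> its left eigenvector, and the result is \<open>M\<close> conjugated by \<open>G\<close> and transposed.
\<close>

definition reconstruct :: "('v \<times> 'v) set \<Rightarrow> 'v \<times> 'v \<Rightarrow> ((('v \<times> 'v) \<times> ('v \<times> 'v) \<Rightarrow> nat) \<Rightarrow> real)
    \<Rightarrow> ('v \<times> 'v) \<times> ('v \<times> 'v) \<Rightarrow> real" where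
  "reconstruct E r y =
     (let M = (\<lambda>a. y (arc_loop E r a) / y (edge_loop E r (snd a)));
          G = (\<lambda>e. lim (\<lambda>n. taboo_sum (arcs E) r M n e))
      in (\<lambda>k\<in>arcs (E\<inverse>). G (fst (flip_arc k)) * M (flip_arc k) / G (snd (flip_arc k))))"

text \<open>
  In terms of \<open>\<rho>\<close>, the matrix \<open>M\<close> is the transpose of \<open>\<rho>\<close> conjugated by the inverse path weights
  \<open>w = 1 / h\<close>. So \<open>w\<close> is proportional to its left eigenvector, and conjugation by this eigenvector
  gives \<open>\<rho>\<close> back.
\<close>

lemma reconstruct_eq:
  assumes irr: "irreducible_relation E (arcs E)" and r: "r \<in> E" and \<rho>: "\<rho> \<in> environments (E\<inverse>)"
    and y: "\<And>\<kappa>. \<kappa> \<in> loops E r \<Longrightarrow> y \<kappa> = monomial E \<kappa> (\<lambda>k. \<rho> (flip_arc k))"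
  shows "reconstruct E r y = \<rho>"
proof -
  interpret irreducible_relation E "arcs E" by (rule irr)
  let ?\<omega> = "\<lambda>k. \<rho> (flip_arc k)"
  let ?m = "\<lambda>\<kappa>. monomial E \<kappa> ?\<omega>"
  define M where "M a = y (arc_loop E r a) / y (edge_loop E r (snd a))" for a
  define w where "w e = inverse (?m (path_count E r e))" for e
  have pos: "?\<omega> k > 0" if "k \<in> arcs E" for k
    using environmentsD(1)[OF \<rho>] that by simp
  have w: "w e > 0" for e unfolding w_def by (simp add: monomial_pos[OF pos])
  have M: "M (e, f) = ?\<omega> (e, f) * w f / w e" if "(e, f) \<in> arcs E" for e f
  proof -
    have "f \<in> E" using that by (auto simp: arcs_def)
    then have "M (e, f) = ?m (arc_loop E r (e, f)) / ?m (edge_loop E r f)"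
      using that by (simp add: M_def y loops_def)
    also have "\<dots> = ?m (path_count E r e) * ?\<omega> (e, f) / ?m (path_count E r f)"
      using monomial_pos[of E ?\<omega> "path_count E f r", OF pos] monomial_pos[of E ?\<omega> "path_count E r f", OF pos]
      by (simp add: arc_loop_def edge_loop_def monomial_add monomial_single[OF finite_states that] del: flip_arc_Pair)
    finally show ?thesis by (simp add: w_def field_simps)
  qed
  have sum1: "(\<Sum>e | (e, f) \<in> arcs E. ?\<omega> (e, f)) = 1" if "f \<in> E" for f
    using environmentsD(3)[OF \<rho>, of "prod.swap f"] that
    by (cases f) (simp add: sum_arcs_converse)
  have lim: "lim (\<lambda>n. taboo_sum (arcs E) r M n f) = w f / w r" if "f \<in> E" for f
    by (intro limI taboo_sum_tendsto[where p = "\<lambda>e f. ?\<omega> (e, f)" and w = w]) (use pos sum1 w M r that in auto)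
  show ?thesis
  proof (rule extensionalityI[of _ "arcs (E\<inverse>)"])
    show "\<rho> \<in> extensional (arcs (E\<inverse>))" using environmentsD(4)[OF \<rho>] .
    show "reconstruct E r y \<in> extensional (arcs (E\<inverse>))" by (simp add: reconstruct_def Let_def)
    fix k assume k: "k \<in> arcs (E\<inverse>)"
    obtain e f where ef: "flip_arc k = (e, f)" by (cases "flip_arc k")
    have a: "(e, f) \<in> arcs E" using k unfolding ef[symmetric] by simp
    then have "e \<in> E" "f \<in> E" by (auto simp: arcs_def)
    have "reconstruct E r y k = (w e / w r) * M (e, f) / (w f / w r)"
      using k unfolding reconstruct_def Let_def M_def[symmetric]
      by (simp add: ef lim[OF \<open>e \<in> E\<close>] lim[OF \<open>f \<in> E\<close>])
    also have "\<dots> = ?\<omega> (e, f)" using w[of e] w[of f] w[of r] by (simp add: M[OF a])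
    also have "?\<omega> (e, f) = \<rho> k" unfolding ef[symmetric] by simp
    finally show "reconstruct E r y k = \<rho> k" .
  qed
qed

lemma borel_measurable_reconstruct:
  assumes fin: "finite E" and r: "r \<in> E"
  shows "reconstruct E r \<in> (\<Pi>\<^sub>M \<kappa>\<in>loops E r. borel) \<rightarrow>\<^sub>M (\<Pi>\<^sub>M k\<in>arcs (E\<inverse>). (borel :: real measure))"
proof -
  let ?P = "\<Pi>\<^sub>M \<kappa>\<in>loops E r. (borel :: real measure)"
  define M where "M y a = y (arc_loop E r a) / y (edge_loop E r (snd a))" for y :: "_ \<Rightarrow> real" and a
  have M[measurable]: "(\<lambda>y. M y a) \<in> borel_measurable ?P" if "a \<in> arcs E" for a
  proof -
    have "snd a \<in> E" using that by (auto simp: arcs_def)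
    with that have [simp]: "arc_loop E r a \<in> loops E r" "edge_loop E r (snd a) \<in> loops E r"
      by (auto simp: loops_def)
    show ?thesis unfolding M_def by measurable
  qed
  have "(\<lambda>y. taboo_sum (arcs E) r (M y) n e) \<in> borel_measurable ?P" for n e
  proof (induction n arbitrary: e)
    case (Suc n)
    have "(\<lambda>y. \<Sum>f | (f, e) \<in> arcs E. taboo_sum (arcs E) r (M y) n f * M y (f, e)) \<in> borel_measurable ?P"
      by (intro borel_measurable_sum borel_measurable_times Suc M) auto
    then show ?case by (cases "e = r") auto
  qed simp
  note [measurable] = this
  have [measurable]: "(\<lambda>y. lim (\<lambda>n. taboo_sum (arcs E) r (M y) n e)) \<in> borel_measurable ?P" for e
    by measurable
  show ?thesis
  proof (rule measurable_PiM_single')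
    fix k assume "k \<in> arcs (E\<inverse>)"
    then have "flip_arc k \<in> arcs E" by simp
    then show "(\<lambda>y. reconstruct E r y k) \<in> borel_measurable ?P"
      using \<open>k \<in> arcs (E\<inverse>)\<close> unfolding reconstruct_def Let_def M_def[symmetric]
      by simp
  qed (auto simp: reconstruct_def Let_def)
qed

section \<open>The hypergeometric law\<close>

lemma out_edges_converse: "out_edges (E\<inverse>) x = prod.swap ` in_edges E x"
  by (force simp: out_edges_def in_edges_def image_iff)

lemma in_edges_converse: "in_edges (E\<inverse>) x = prod.swap ` out_edges E x"
  by (force simp: out_edges_def in_edges_def image_iff)

text \<open>
  The situation of the theorem without the condition on the divergence. It is inherited by the
  reversed graph and by weights \<open>\<alpha> + n\<close>, the two changes of parameters in the proof.
\<close>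

locale weighted_graph =
  fixes V :: "'v set" and E :: "('v \<times> 'v) set"
    and \<alpha> :: "'v \<times> 'v \<Rightarrow> real" and Z :: "('v \<times> 'v) \<times> ('v \<times> 'v) \<Rightarrow> real"
  assumes finite_V: "finite V" and E_subset: "E \<subseteq> V \<times> V"
    and out_nonempty: "\<And>x. x \<in> V \<Longrightarrow> out_edges E x \<noteq> {}"
    and in_nonempty: "\<And>x. x \<in> V \<Longrightarrow> in_edges E x \<noteq> {}"
    and \<alpha>_pos: "\<And>e. e \<in> E \<Longrightarrow> \<alpha> e > 0"
    and Z_pos: "\<And>k. k \<in> arcs E \<Longrightarrow> Z k > 0"
begin

lemma finite_E: "finite E"
  using finite_V E_subset by (meson finite_SigmaI finite_subset)

lemma finite_out_edges [simp]: "finite (out_edges E x)" and finite_in_edges [simp]: "finite (in_edges E x)"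
  using finite_E by (auto simp: out_edges_def in_edges_def)

lemma converse_graph: "weighted_graph V (E\<inverse>) (rev_edge_fun \<alpha>) (rev_arc_fun Z)"
proof
  show "rev_arc_fun Z k > 0" if "k \<in> arcs (E\<inverse>)" for k
    using that Z_pos by (cases k) (simp add: rev_arc_fun_def arcs_converse_iff)
  show "rev_edge_fun \<alpha> e > 0" if "e \<in> E\<inverse>" for e
    using that \<alpha>_pos by (cases e) (simp add: rev_edge_fun_def)
qed (use finite_V E_subset out_nonempty in_nonempty in \<open>auto simp: out_edges_converse in_edges_converse\<close>)

lemma add_weights:
  fixes n :: "'v \<times> 'v \<Rightarrow> nat"
  shows "weighted_graph V E (\<lambda>e. \<alpha> e + real (n e)) Z"
  by unfold_locales
    (use finite_V E_subset out_nonempty in_nonempty \<alpha>_pos Z_pos in \<open>auto intro: add_pos_nonneg\<close>)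

definition vertex_const :: "'v \<Rightarrow> real" where
  "vertex_const x = enn2real (\<integral>\<^sup>+u. ennreal (vertex_weight E \<alpha> Z x u) \<partial>simplex_lebesgue (out_edges E x))"

lemma vertex_weight_eq_simplex_weight:
  "vertex_weight E \<alpha> Z x = simplex_weight (in_edges E x) (out_edges E x) \<alpha> \<alpha> (\<lambda>e e'. Z (e, e'))"
  by (simp add: vertex_weight_def simplex_weight_def fun_eq_iff)

lemma vertex_Z_pos: "e \<in> in_edges E x \<Longrightarrow> e' \<in> out_edges E x \<Longrightarrow> Z (e, e') > 0"
  by (rule Z_pos) (auto simp: in_edges_def out_edges_def arcs_def)

lemma vertex_const:
  assumes x: "x \<in> V"
  shows "(\<integral>\<^sup>+u. ennreal (vertex_weight E \<alpha> Z x u) \<partial>simplex_lebesgue (out_edges E x)) = ennreal (vertex_const x)"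
    and "vertex_const x > 0"
proof -
  have "\<alpha> e > 0" if "e \<in> in_edges E x" for e using that \<alpha>_pos by (auto simp: in_edges_def)
  moreover have "\<alpha> e > 0" if "e \<in> out_edges E x" for e using that \<alpha>_pos by (auto simp: out_edges_def)
  ultimately have "(\<integral>\<^sup>+u. ennreal (vertex_weight E \<alpha> Z x u) \<partial>simplex_lebesgue (out_edges E x)) \<noteq> 0"
    "(\<integral>\<^sup>+u. ennreal (vertex_weight E \<alpha> Z x u) \<partial>simplex_lebesgue (out_edges E x)) \<noteq> \<infinity>"
    unfolding vertex_weight_eq_simplex_weight
    using vertex_Z_pos[of _ x] out_nonempty[OF x] by (intro simplex_weight_integral_bounds; simp)+
  then show "(\<integral>\<^sup>+u. ennreal (vertex_weight E \<alpha> Z x u) \<partial>simplex_lebesgue (out_edges E x)) = ennreal (vertex_const x)"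
    "vertex_const x > 0"
    unfolding vertex_const_def by (auto simp: less_top enn2real_positive_iff zero_less_iff_neq_zero)
qed

lemma sets_vertex_law: "sets (vertex_law E \<alpha> Z x) = sets (simplex_lebesgue (out_edges E x))"
  by (simp add: vertex_law_def Let_def)

lemma space_vertex_law: "space (vertex_law E \<alpha> Z x) = open_simplex (out_edges E x)"
  by (simp add: vertex_law_def Let_def space_simplex_lebesgue)

lemma borel_measurable_vertex_weight:
  "vertex_weight E \<alpha> Z x \<in> borel_measurable (simplex_lebesgue (out_edges E x))"
  unfolding vertex_weight_eq_simplex_weight by (rule borel_measurable_simplex_weight)

lemma nn_integral_vertex_law:
  assumes x: "x \<in> V" and f: "f \<in> borel_measurable (simplex_lebesgue (out_edges E x))"
  shows "(\<integral>\<^sup>+u. f u \<partial>vertex_law E \<alpha> Z x)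
    = (\<integral>\<^sup>+u. ennreal (vertex_weight E \<alpha> Z x u) * f u \<partial>simplex_lebesgue (out_edges E x)) / ennreal (vertex_const x)"
proof -
  note [measurable] = f borel_measurable_vertex_weight
  have "(\<integral>\<^sup>+u. f u \<partial>vertex_law E \<alpha> Z x)
    = (\<integral>\<^sup>+u. (ennreal (vertex_weight E \<alpha> Z x u) * f u) * inverse (ennreal (vertex_const x)) \<partial>simplex_lebesgue (out_edges E x))"
    unfolding vertex_law_def Let_def vertex_const(1)[OF x]
    by (subst nn_integral_density) (auto intro!: nn_integral_cong simp: divide_ennreal_def mult_ac)
  also have "\<dots> = (\<integral>\<^sup>+u. ennreal (vertex_weight E \<alpha> Z x u) * f u \<partial>simplex_lebesgue (out_edges E x)) * inverse (ennreal (vertex_const x))"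
    by (rule nn_integral_multc) measurable
  finally show ?thesis by (simp add: divide_ennreal_def)
qed

lemma prob_space_vertex_law:
  assumes x: "x \<in> V"
  shows "prob_space (vertex_law E \<alpha> Z x)"
proof
  have "emeasure (vertex_law E \<alpha> Z x) (space (vertex_law E \<alpha> Z x)) = (\<integral>\<^sup>+u. 1 \<partial>vertex_law E \<alpha> Z x)"
    by simp
  also have "\<dots> = 1"
    using nn_integral_vertex_law[OF x, of "\<lambda>_. 1"] vertex_const[OF x] by (simp add: divide_ennreal)
  finally show "emeasure (vertex_law E \<alpha> Z x) (space (vertex_law E \<alpha> Z x)) = 1" .
qed

lemma product_sigma_finite_vertex_law: "product_sigma_finite (vertex_law E \<alpha> Z)"
proof (rule product_sigma_finite.intro)
  fix x
  show "sigma_finite_measure (vertex_law E \<alpha> Z x)"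
  proof (cases "x \<in> V")
    case True
    then interpret prob_space "vertex_law E \<alpha> Z x" by (rule prob_space_vertex_law)
    show ?thesis by unfold_locales
  next
    case False
    then have "out_edges E x = {}" using E_subset by (auto simp: out_edges_def)
    then have "space (vertex_law E \<alpha> Z x) = {}"
      by (simp add: space_vertex_law open_simplex_def)
    then interpret finite_measure "vertex_law E \<alpha> Z x" by (intro finite_measureI) simp
    show ?thesis by unfold_locales
  qed
qed

lemma prob_space_PiM_vertex_law: "prob_space (\<Pi>\<^sub>M x\<in>V. vertex_law E \<alpha> Z x)"
  by (rule prob_space_PiM) (rule prob_space_vertex_law)

lemma vertex_vectorD:
  assumes "u \<in> space (\<Pi>\<^sub>M x\<in>V. vertex_law E \<alpha> Z x)" "x \<in> V"
  shows "u x \<in> open_simplex (out_edges E x)"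
  using assms by (auto simp: space_PiM PiE_def Pi_def space_vertex_law)

lemma sum_Z_pos:
  assumes "v \<in> open_simplex (out_edges E x)" "e \<in> in_edges E x" "x \<in> V"
  shows "(\<Sum>e'\<in>out_edges E x. Z (e, e') * v e') > 0"
  using vertex_Z_pos[OF assms(2)] open_simplexD(1)[OF assms(1)] out_nonempty[OF assms(3)]
  by (intro sum_pos mult_pos_pos) auto

lemma env_of_in_environments:
  assumes u: "u \<in> space (\<Pi>\<^sub>M x\<in>V. vertex_law E \<alpha> Z x)"
  shows "env_of E Z u \<in> environments E"
proof -
  have sum1: "(\<Sum>e' | (e, e') \<in> arcs E. env_of E Z u (e, e')) = 1" if "e \<in> E" for e
  proof -
    let ?x = "snd e"
    have x: "?x \<in> V" "e \<in> in_edges E ?x" using that E_subset by (auto simp: in_edges_def)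
    have "{e'. (e, e') \<in> arcs E} = out_edges E ?x" using that by (auto simp: arcs_def out_edges_def)
    then have "(\<Sum>e' | (e, e') \<in> arcs E. env_of E Z u (e, e'))
      = (\<Sum>e'\<in>out_edges E ?x. Z (e, e') * u ?x e' / (\<Sum>e''\<in>out_edges E ?x. Z (e, e'') * u ?x e''))"
      using that by (intro sum.cong) (auto simp: env_of_def arcs_def out_edges_def)
    also have "\<dots> = 1"
      using sum_Z_pos[OF vertex_vectorD[OF u x(1)] x(2,1)] by (simp flip: sum_divide_distrib)
    finally show ?thesis .
  qed
  have pos: "env_of E Z u (e, e') > 0" if "(e, e') \<in> arcs E" for e e'
  proof -
    from that E_subset have x: "snd e \<in> V" "e \<in> in_edges E (snd e)" "e' \<in> out_edges E (snd e)"
      by (auto simp: arcs_def in_edges_def out_edges_def)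
    note v = vertex_vectorD[OF u x(1)]
    show ?thesis
      using that sum_Z_pos[OF v x(2,1)] open_simplexD(1)[OF v x(3)] Z_pos[OF that]
      by (simp add: env_of_def)
  qed
  have le1: "env_of E Z u (e, e') \<le> 1" if "(e, e') \<in> arcs E" for e e'
  proof -
    have "finite {e'. (e, e') \<in> arcs E}"
      by (rule finite_subset[OF _ finite_E]) (auto simp: arcs_def)
    then have "env_of E Z u (e, e') \<le> (\<Sum>e' | (e, e') \<in> arcs E. env_of E Z u (e, e'))"
      using that by (intro member_le_sum) (auto intro: less_imp_le[OF pos])
    with sum1[of e] that show ?thesis by (auto simp: arcs_def)
  qed
  show ?thesis
    unfolding environments_def mem_Collect_eq
  proof (intro conjI PiE_I ballI)
    fix k assume k: "k \<in> arcs E"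
    obtain e e' where "k = (e, e')" by (cases k)
    with k pos[of e e'] le1[of e e'] show "env_of E Z u k \<in> {0<..1}" by simp
  next
    fix k assume "k \<notin> arcs E"
    then show "env_of E Z u k = undefined" by (simp add: env_of_def)
  qed (rule sum1)
qed

lemma measurable_vertex_component:
  assumes "x \<in> V" "e \<in> out_edges E x"
  shows "(\<lambda>u. u x e) \<in> borel_measurable (\<Pi>\<^sub>M x\<in>V. vertex_law E \<alpha> Z x)"
proof -
  have "(\<lambda>v. v e) \<in> borel_measurable (vertex_law E \<alpha> Z x)"
    unfolding measurable_cong_sets[OF sets_vertex_law refl]
    by (rule measurable_simplex_lebesgueI) (use assms in simp)
  then show ?thesis
    by (rule measurable_compose[OF measurable_component_singleton[OF assms(1)]])
qed

lemma measurable_env_of: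
  "env_of E Z \<in> (\<Pi>\<^sub>M x\<in>V. vertex_law E \<alpha> Z x) \<rightarrow>\<^sub>M env_space E"
  unfolding env_space_def
proof (rule measurable_restrict_space2)
  show "env_of E Z \<in> space (\<Pi>\<^sub>M x\<in>V. vertex_law E \<alpha> Z x) \<rightarrow> environments E"
    using env_of_in_environments by auto
  show "env_of E Z \<in> (\<Pi>\<^sub>M x\<in>V. vertex_law E \<alpha> Z x) \<rightarrow>\<^sub>M (\<Pi>\<^sub>M k\<in>arcs E. borel)"
  proof (rule measurable_PiM_single')
    fix k assume k: "k \<in> arcs E"
    obtain e e' where ee': "k = (e, e')" by (cases k)
    with k E_subset have x: "snd e \<in> V" "e' \<in> out_edges E (snd e)"
      by (auto simp: arcs_def out_edges_def)
    show "(\<lambda>u. env_of E Z u k) \<in> borel_measurable (\<Pi>\<^sub>M x\<in>V. vertex_law E \<alpha> Z x)"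
      using k unfolding ee' env_of_def
      by (simp, intro borel_measurable_divide borel_measurable_times borel_measurable_sum
          borel_measurable_const measurable_vertex_component x) auto
  qed (auto simp: env_of_def)
qed

lemma prob_space_env_law: "prob_space (env_law V E \<alpha> Z)"
  unfolding env_law_def
  by (rule prob_space.prob_space_distr[OF prob_space_PiM_vertex_law measurable_env_of])

lemma sets_env_law: "sets (env_law V E \<alpha> Z) = sets (env_space E)"
  by (simp add: env_law_def)

lemma space_env_law: "space (env_law V E \<alpha> Z) = environments E"
  by (auto simp: env_law_def env_space_def space_restrict_space space_PiM environments_def PiE_def)

lemma prod_edges_by_vertex:
  fixes F :: "'v \<times> 'v \<Rightarrow> real"
  shows "(\<Prod>e\<in>E. F e) = (\<Prod>x\<in>V. \<Prod>e\<in>out_edges E x. F e)"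
    and "(\<Prod>e\<in>E. F e) = (\<Prod>x\<in>V. \<Prod>e\<in>in_edges E x. F e)"
proof -
  have "(\<Prod>x\<in>V. \<Prod>e | e \<in> E \<and> fst e = x. F e) = (\<Prod>e\<in>E. F e)"
    by (rule prod.group) (use finite_V finite_E E_subset in auto)
  then show "(\<Prod>e\<in>E. F e) = (\<Prod>x\<in>V. \<Prod>e\<in>out_edges E x. F e)" by (simp add: out_edges_def)
  have "(\<Prod>x\<in>V. \<Prod>e | e \<in> E \<and> snd e = x. F e) = (\<Prod>e\<in>E. F e)"
    by (rule prod.group) (use finite_V finite_E E_subset in auto)
  then show "(\<Prod>e\<in>E. F e) = (\<Prod>x\<in>V. \<Prod>e\<in>in_edges E x. F e)" by (simp add: in_edges_def)
qed

text \<open>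
  The contribution of the vertex \<open>x\<close> to a monomial with \<open>n e\<close> visits to each edge \<open>e\<close>.
\<close>

definition tilt :: "('v \<times> 'v \<Rightarrow> nat) \<Rightarrow> 'v \<Rightarrow> ('v \<times> 'v \<Rightarrow> real) \<Rightarrow> real" where
  "tilt n x v = (\<Prod>e\<in>out_edges E x. v e ^ n e)
     * (\<Prod>e\<in>in_edges E x. inverse (\<Sum>e'\<in>out_edges E x. Z (e, e') * v e') ^ n e)"

lemma tilt_nonneg:
  assumes "v \<in> open_simplex (out_edges E x)" "x \<in> V"
  shows "tilt n x v \<ge> 0"
  unfolding tilt_def using open_simplexD(1)[OF assms(1)] sum_Z_pos[OF assms(1) _ assms(2)]
  by (intro mult_nonneg_nonneg prod_nonneg) (auto simp: less_imp_le)

lemma borel_measurable_tilt: "tilt n x \<in> borel_measurable (simplex_lebesgue (out_edges E x))"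
  unfolding tilt_def[abs_def] by (rule measurable_simplex_lebesgueI) measurable

lemma vertex_weight_tilt:
  assumes v: "v \<in> open_simplex (out_edges E x)" and x: "x \<in> V"
  shows "vertex_weight E \<alpha> Z x v * tilt n x v = vertex_weight E (\<lambda>e. \<alpha> e + real (n e)) Z x v"
proof -
  let ?s = "\<lambda>e. \<Sum>e'\<in>out_edges E x. Z (e, e') * v e'"
  have "v e powr (\<alpha> e - 1) * v e ^ n e = v e powr (\<alpha> e + real (n e) - 1)" if "e \<in> out_edges E x" for e
    using open_simplexD(1)[OF v that] by (simp add: powr_realpow[symmetric] powr_add[symmetric] algebra_simps)
  moreover have "?s e powr (- \<alpha> e) * inverse (?s e) ^ n e = ?s e powr (- (\<alpha> e + real (n e)))" if "e \<in> in_edges E x" for e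
    using sum_Z_pos[OF v that x]
    by (simp add: powr_realpow[symmetric] powr_minus[symmetric] powr_add[symmetric] power_inverse)
  ultimately have
    "(\<Prod>e\<in>out_edges E x. v e powr (\<alpha> e - 1)) * (\<Prod>e\<in>out_edges E x. v e ^ n e)
      = (\<Prod>e\<in>out_edges E x. v e powr (\<alpha> e + real (n e) - 1))"
    "(\<Prod>e\<in>in_edges E x. ?s e powr (- \<alpha> e)) * (\<Prod>e\<in>in_edges E x. inverse (?s e) ^ n e)
      = (\<Prod>e\<in>in_edges E x. ?s e powr (- (\<alpha> e + real (n e))))"
    unfolding prod.distrib[symmetric] by (intro prod.cong refl; simp)+
  then show ?thesis unfolding vertex_weight_def tilt_def by (simp add: mult_ac flip: mult.assoc)
qed

lemma monomial_env_of:
  assumes bal: "balanced E \<kappa>"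
  shows "monomial E \<kappa> (env_of E Z u) = monomial E \<kappa> Z * (\<Prod>x\<in>V. tilt (out_count E \<kappa>) x (u x))"
proof -
  let ?n = "out_count E \<kappa>"
  let ?s = "\<lambda>e. \<Sum>e'\<in>out_edges E (snd e). Z (e, e') * u (snd e) e'"
  have "monomial E \<kappa> (env_of E Z u)
    = monomial E \<kappa> Z * (\<Prod>e\<in>E. (inverse (?s e) * u (fst e) e) ^ ?n e)"
    by (rule monomial_gauge[OF finite_E bal]) (auto simp: env_of_def arcs_def field_simps)
  also have "(\<Prod>e\<in>E. (inverse (?s e) * u (fst e) e) ^ ?n e)
      = (\<Prod>e\<in>E. u (fst e) e ^ ?n e) * (\<Prod>e\<in>E. inverse (?s e) ^ ?n e)"
    by (simp add: power_mult_distrib prod.distrib)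
  also have "(\<Prod>e\<in>E. u (fst e) e ^ ?n e) = (\<Prod>x\<in>V. \<Prod>e\<in>out_edges E x. u x e ^ ?n e)"
    unfolding prod_edges_by_vertex(1) by (intro prod.cong) (auto simp: out_edges_def)
  also have "(\<Prod>e\<in>E. inverse (?s e) ^ ?n e)
      = (\<Prod>x\<in>V. \<Prod>e\<in>in_edges E x. inverse (\<Sum>e'\<in>out_edges E x. Z (e, e') * u x e') ^ ?n e)"
    unfolding prod_edges_by_vertex(2) by (intro prod.cong) (auto simp: in_edges_def)
  finally show ?thesis by (simp add: tilt_def prod.distrib)
qed

lemma borel_measurable_monomial: "monomial E \<kappa> \<in> borel_measurable (env_space E)"
  unfolding env_space_def
  by (rule measurable_restrict_space1) (simp add: monomial_def[abs_def], measurable)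

end

text \<open>
  The constant as a function of the weights, for comparing weights that agree on the edges.
\<close>

lemma vertex_const_eq:
  assumes "weighted_graph V E \<alpha> Z"
  shows "weighted_graph.vertex_const E \<alpha> Z x
    = enn2real (\<integral>\<^sup>+u. ennreal (vertex_weight E \<alpha> Z x u) \<partial>simplex_lebesgue (out_edges E x))"
  using weighted_graph.vertex_const_def[OF assms] .

context weighted_graph begin

text \<open>
  The monomial splits into tilts at the vertices, which are independent. Each tilt turns the weight
  at its vertex into the weight for \<open>\<alpha> + n\<close>, so its expectation is a quotient of normalizing
  constants.
\<close>

lemma expectation_monomial:
  assumes bal: "balanced E \<kappa>"
  shows "(\<integral>\<omega>. monomial E \<kappa> \<omega> \<partial>env_law V E \<alpha> Z) = monomial E \<kappa> Z *
    (\<Prod>x\<in>V. weighted_graph.vertex_const E (\<lambda>e. \<alpha> e + real (out_count E \<kappa> e)) Z x / vertex_const x)"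
proof -
  let ?n = "out_count E \<kappa>"
  interpret tilted: weighted_graph V E "\<lambda>e. \<alpha> e + real (?n e)" Z by (rule add_weights)
  interpret product_sigma_finite "vertex_law E \<alpha> Z" by (rule product_sigma_finite_vertex_law)
  have Zm: "monomial E \<kappa> Z > 0" by (rule monomial_pos) (rule Z_pos)
  have cpos: "tilted.vertex_const x / vertex_const x \<ge> 0" if "x \<in> V" for x
    using vertex_const(2)[OF that] tilted.vertex_const(2)[OF that] by simp
  have vertex: "(\<integral>\<^sup>+v. ennreal (tilt ?n x v) \<partial>vertex_law E \<alpha> Z x)
      = ennreal (tilted.vertex_const x / vertex_const x)" if x: "x \<in> V" for x
  proof -
    have "(\<integral>\<^sup>+v. ennreal (tilt ?n x v) \<partial>vertex_law E \<alpha> Z x)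
      = (\<integral>\<^sup>+v. ennreal (vertex_weight E \<alpha> Z x v) * ennreal (tilt ?n x v) \<partial>simplex_lebesgue (out_edges E x)) / ennreal (vertex_const x)"
      by (rule nn_integral_vertex_law[OF x]) (use borel_measurable_tilt in measurable)
    also have "(\<integral>\<^sup>+v. ennreal (vertex_weight E \<alpha> Z x v) * ennreal (tilt ?n x v) \<partial>simplex_lebesgue (out_edges E x))
      = (\<integral>\<^sup>+v. ennreal (vertex_weight E (\<lambda>e. \<alpha> e + real (?n e)) Z x v) \<partial>simplex_lebesgue (out_edges E x))"
      by (intro nn_integral_cong)
        (simp add: space_simplex_lebesgue tilt_nonneg[OF _ x] vertex_weight_tilt[OF _ x, symmetric] ennreal_mult'')
    also have "\<dots> = ennreal (tilted.vertex_const x)" by (rule tilted.vertex_const(1)[OF x])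
    finally show ?thesis using vertex_const(2)[OF x] tilted.vertex_const(2)[OF x] by (simp add: divide_ennreal)
  qed
  have "(\<integral>\<^sup>+\<omega>. ennreal (monomial E \<kappa> \<omega>) \<partial>env_law V E \<alpha> Z)
    = (\<integral>\<^sup>+u. ennreal (monomial E \<kappa> (env_of E Z u)) \<partial>(\<Pi>\<^sub>M x\<in>V. vertex_law E \<alpha> Z x))"
    unfolding env_law_def
    by (rule nn_integral_distr[OF measurable_env_of]) (use borel_measurable_monomial in measurable)
  also have "\<dots> = (\<integral>\<^sup>+u. ennreal (monomial E \<kappa> Z) * (\<Prod>x\<in>V. ennreal (tilt ?n x (u x))) \<partial>(\<Pi>\<^sub>M x\<in>V. vertex_law E \<alpha> Z x))"
  proof (intro nn_integral_cong)
    fix u assume u: "u \<in> space (\<Pi>\<^sub>M x\<in>V. vertex_law E \<alpha> Z x)"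
    have "0 \<le> tilt ?n x (u x)" if "x \<in> V" for x
      by (rule tilt_nonneg[OF vertex_vectorD[OF u that] that])
    then show "ennreal (monomial E \<kappa> (env_of E Z u)) = ennreal (monomial E \<kappa> Z) * (\<Prod>x\<in>V. ennreal (tilt ?n x (u x)))"
      using Zm by (simp add: monomial_env_of[OF bal] prod_ennreal ennreal_mult' less_imp_le)
  qed
  also have "\<dots> = ennreal (monomial E \<kappa> Z) * (\<integral>\<^sup>+u. (\<Prod>x\<in>V. ennreal (tilt ?n x (u x))) \<partial>(\<Pi>\<^sub>M x\<in>V. vertex_law E \<alpha> Z x))"
  proof (rule nn_integral_cmult)
    have "(\<lambda>u. ennreal (tilt ?n x (u x))) \<in> borel_measurable (\<Pi>\<^sub>M x\<in>V. vertex_law E \<alpha> Z x)" if "x \<in> V" for x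
    proof (rule measurable_compose[OF measurable_component_singleton[OF that]])
      show "(\<lambda>v. ennreal (tilt ?n x v)) \<in> borel_measurable (vertex_law E \<alpha> Z x)"
        unfolding measurable_cong_sets[OF sets_vertex_law refl] using borel_measurable_tilt by measurable
    qed
    then show "(\<lambda>u. \<Prod>x\<in>V. ennreal (tilt ?n x (u x))) \<in> borel_measurable (\<Pi>\<^sub>M x\<in>V. vertex_law E \<alpha> Z x)"
      by (rule borel_measurable_prod_ennreal)
  qed
  also have "(\<integral>\<^sup>+u. (\<Prod>x\<in>V. ennreal (tilt ?n x (u x))) \<partial>(\<Pi>\<^sub>M x\<in>V. vertex_law E \<alpha> Z x))
      = (\<Prod>x\<in>V. \<integral>\<^sup>+v. ennreal (tilt ?n x v) \<partial>vertex_law E \<alpha> Z x)"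
  proof (rule product_nn_integral_prod[OF finite_V])
    show "(\<lambda>v. ennreal (tilt ?n x v)) \<in> borel_measurable (vertex_law E \<alpha> Z x)" for x
      unfolding measurable_cong_sets[OF sets_vertex_law refl] using borel_measurable_tilt by measurable
  qed
  also have "\<dots> = ennreal (\<Prod>x\<in>V. tilted.vertex_const x / vertex_const x)"
    using cpos by (simp add: vertex prod_ennreal)
  also have "ennreal (monomial E \<kappa> Z) * \<dots> = ennreal (monomial E \<kappa> Z * (\<Prod>x\<in>V. tilted.vertex_const x / vertex_const x))"
    using Zm by (simp add: ennreal_mult')
  finally have nn: "(\<integral>\<^sup>+\<omega>. ennreal (monomial E \<kappa> \<omega>) \<partial>env_law V E \<alpha> Z)
    = ennreal (monomial E \<kappa> Z * (\<Prod>x\<in>V. tilted.vertex_const x / vertex_const x))" .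
  have "(\<integral>\<omega>. monomial E \<kappa> \<omega> \<partial>env_law V E \<alpha> Z) = enn2real (\<integral>\<^sup>+\<omega>. ennreal (monomial E \<kappa> \<omega>) \<partial>env_law V E \<alpha> Z)"
  proof (rule integral_eq_nn_integral)
    show "monomial E \<kappa> \<in> borel_measurable (env_law V E \<alpha> Z)"
      unfolding measurable_cong_sets[OF sets_env_law refl] by (rule borel_measurable_monomial)
    show "AE \<omega> in env_law V E \<alpha> Z. 0 \<le> monomial E \<kappa> \<omega>"
      by (intro AE_I2 less_imp_le monomial_pos) (auto simp: space_env_law dest: environmentsD)
  qed
  also have "\<dots> = monomial E \<kappa> Z * (\<Prod>x\<in>V. tilted.vertex_const x / vertex_const x)"
    unfolding nn using Zm cpos by (intro enn2real_ennreal mult_nonneg_nonneg prod_nonneg) auto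
  finally show ?thesis .
qed

text \<open>
  At \<open>x\<close> the reversed graph exchanges incoming and outgoing edges and transposes \<open>Z\<close>. Zero divergence
  is the equality of total weights in the duality of simplex integrals.
\<close>

lemma vertex_const_duality:
  assumes x: "x \<in> V" and div: "divergence E \<alpha> x = 0"
  shows "(\<Prod>e\<in>in_edges E x. Gamma (\<alpha> e)) * vertex_const x
    = (\<Prod>e\<in>out_edges E x. Gamma (\<alpha> e)) * weighted_graph.vertex_const (E\<inverse>) (rev_edge_fun \<alpha>) (rev_arc_fun Z) x"
proof -
  interpret conv: weighted_graph V "E\<inverse>" "rev_edge_fun \<alpha>" "rev_arc_fun Z" by (rule converse_graph)
  let ?I = "out_edges (E\<inverse>) x" and ?J = "out_edges E x" and ?a = "rev_edge_fun \<alpha>"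
  let ?Z = "\<lambda>f e'. Z (prod.swap f, e')"
  have reindex_in: "(\<Prod>e\<in>in_edges E x. F e) = (\<Prod>f\<in>?I. F (prod.swap f))" for F :: "_ \<Rightarrow> real"
    unfolding out_edges_converse by (subst prod.reindex) auto
  have reindex_out: "(\<Prod>e\<in>?J. F e) = (\<Prod>f\<in>in_edges (E\<inverse>) x. F (prod.swap f))" for F :: "_ \<Rightarrow> real"
    unfolding in_edges_converse by (subst prod.reindex) auto
  have w1: "vertex_weight E \<alpha> Z x = simplex_weight ?I ?J ?a \<alpha> ?Z"
    by (simp add: fun_eq_iff vertex_weight_def simplex_weight_def reindex_in rev_edge_fun_def)
  have w2: "vertex_weight (E\<inverse>) ?a (rev_arc_fun Z) x = simplex_weight ?J ?I \<alpha> ?a (\<lambda>j i. ?Z i j)"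
    by (simp add: fun_eq_iff vertex_weight_def simplex_weight_def reindex_out rev_edge_fun_def rev_arc_fun_def)
  have "sum ?a ?I = (\<Sum>e\<in>in_edges E x. \<alpha> e)"
    unfolding out_edges_converse by (subst sum.reindex) (auto simp: rev_edge_fun_def)
  then have ab: "sum ?a ?I = sum \<alpha> ?J"
    using div by (simp add: divergence_def)
  have "ennreal (\<Prod>i\<in>?I. Gamma (?a i)) * (\<integral>\<^sup>+u. ennreal (simplex_weight ?I ?J ?a \<alpha> ?Z u) \<partial>simplex_lebesgue ?J)
    = ennreal (\<Prod>j\<in>?J. Gamma (\<alpha> j)) * (\<integral>\<^sup>+\<tau>. ennreal (simplex_weight ?J ?I \<alpha> ?a (\<lambda>j i. ?Z i j) \<tau>) \<partial>simplex_lebesgue ?I)"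
  proof (rule simplex_weight_integral_duality)
    show "?Z i j > 0" if "i \<in> ?I" "j \<in> ?J" for i j
      using that by (intro vertex_Z_pos[of _ x]) (auto simp: out_edges_converse)
    show "?a i > 0" if "i \<in> ?I" for i
      using that by (intro conv.\<alpha>_pos) (auto simp: out_edges_def)
    show "\<alpha> j > 0" if "j \<in> ?J" for j
      using that by (intro \<alpha>_pos) (auto simp: out_edges_def)
  qed (use ab out_nonempty[OF x] conv.out_nonempty[OF x] in auto)
  then have "ennreal (\<Prod>e\<in>in_edges E x. Gamma (\<alpha> e)) * ennreal (vertex_const x)
    = ennreal (\<Prod>e\<in>?J. Gamma (\<alpha> e)) * ennreal (conv.vertex_const x)"
    unfolding w1[symmetric] w2[symmetric] vertex_const(1)[OF x] conv.vertex_const(1)[OF x]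
    by (simp add: reindex_in rev_edge_fun_def)
  moreover have "(\<Prod>e\<in>in_edges E x. Gamma (\<alpha> e)) \<ge> 0" "(\<Prod>e\<in>?J. Gamma (\<alpha> e)) \<ge> 0"
    using \<alpha>_pos by (auto intro!: prod_nonneg less_imp_le[OF Gamma_real_pos] simp: in_edges_def out_edges_def)
  ultimately show ?thesis
    using vertex_const(2)[OF x] conv.vertex_const(2)[OF x]
    by (simp add: ennreal_mult'[symmetric] ennreal_inj)
qed

lemma prod_vertex_const_converse:
  assumes "\<And>x. x \<in> V \<Longrightarrow> divergence E \<alpha> x = 0"
  shows "(\<Prod>x\<in>V. vertex_const x)
    = (\<Prod>x\<in>V. weighted_graph.vertex_const (E\<inverse>) (rev_edge_fun \<alpha>) (rev_arc_fun Z) x)"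
proof -
  let ?G = "\<Prod>e\<in>E. Gamma (\<alpha> e)"
  have "?G * (\<Prod>x\<in>V. vertex_const x) = (\<Prod>x\<in>V. (\<Prod>e\<in>in_edges E x. Gamma (\<alpha> e)) * vertex_const x)"
    by (simp add: prod_edges_by_vertex(2) prod.distrib)
  also have "\<dots> = (\<Prod>x\<in>V. (\<Prod>e\<in>out_edges E x. Gamma (\<alpha> e)) *
      weighted_graph.vertex_const (E\<inverse>) (rev_edge_fun \<alpha>) (rev_arc_fun Z) x)"
    by (intro prod.cong refl vertex_const_duality assms)
  also have "\<dots> = ?G * (\<Prod>x\<in>V. weighted_graph.vertex_const (E\<inverse>) (rev_edge_fun \<alpha>) (rev_arc_fun Z) x)"
    by (simp add: prod_edges_by_vertex(1) prod.distrib)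
  finally show ?thesis
    using prod_pos[of E "\<lambda>e. Gamma (\<alpha> e)"] \<alpha>_pos Gamma_real_pos by fastforce
qed

text \<open>
  The arcs through \<open>x\<close> are counted once by their first edges, which enter \<open>x\<close>, and once by their
  second edges, which leave \<open>x\<close>.
\<close>

lemma divergence_out_count:
  assumes bal: "balanced E \<kappa>"
  shows "divergence E (\<lambda>e. real (out_count E \<kappa> e)) x = 0"
proof -
  have "(\<Sum>e\<in>out_edges E x. out_count E \<kappa> e) = (\<Sum>e\<in>out_edges E x. in_count E \<kappa> e)"
    using bal by (intro sum.cong) (auto simp: balanced_def out_edges_def)
  also have "\<dots> = (\<Sum>e\<in>out_edges E x. \<Sum>k | k \<in> {k \<in> arcs E. fst (snd k) = x} \<and> snd k = e. \<kappa> k)"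
    unfolding in_count_def by (intro sum.cong) (auto simp: out_edges_def)
  also have "\<dots> = (\<Sum>k\<in>{k \<in> arcs E. fst (snd k) = x}. \<kappa> k)"
    by (rule sum.group) (use finite_E finite_arcs[OF finite_E] in \<open>auto simp: arcs_def out_edges_def\<close>)
  also have "{k \<in> arcs E. fst (snd k) = x} = {k \<in> arcs E. snd (fst k) = x}"
    by (auto simp: arcs_def)
  also have "(\<Sum>k\<in>{k \<in> arcs E. snd (fst k) = x}. \<kappa> k)
      = (\<Sum>e\<in>in_edges E x. \<Sum>k | k \<in> {k \<in> arcs E. snd (fst k) = x} \<and> fst k = e. \<kappa> k)"
    by (rule sum.group[symmetric]) (use finite_E finite_arcs[OF finite_E] in \<open>auto simp: arcs_def in_edges_def\<close>)
  also have "\<dots> = (\<Sum>e\<in>in_edges E x. out_count E \<kappa> e)"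
    unfolding out_count_def by (intro sum.cong) (auto simp: in_edges_def)
  finally show ?thesis by (simp add: divergence_def flip: of_nat_sum)
qed

end

lemma divergence_add: "divergence E (\<lambda>e. \<alpha> e + \<beta> e) x = divergence E \<alpha> x + divergence E \<beta> x"
  by (simp add: divergence_def sum.distrib)

lemma count_converse:
  "out_count (E\<inverse>) (\<lambda>k. \<kappa> (flip_arc k)) f = in_count E \<kappa> (prod.swap f)"
  "in_count (E\<inverse>) (\<lambda>k. \<kappa> (flip_arc k)) f = out_count E \<kappa> (prod.swap f)"
  unfolding out_count_def in_count_def
  by (rule sum.reindex_bij_witness[where i = flip_arc and j = flip_arc]; auto simp: flip_arc_def arcs_converse_iff)+

lemma balanced_converse: "balanced E \<kappa> \<Longrightarrow> balanced (E\<inverse>) (\<lambda>k. \<kappa> (flip_arc k))"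
  by (auto simp: balanced_def count_converse)

lemma monomial_converse: "monomial (E\<inverse>) (\<lambda>k. \<kappa> (flip_arc k)) \<rho> = monomial E \<kappa> (\<lambda>k. \<rho> (flip_arc k))"
  unfolding monomial_def
  by (rule prod.reindex_bij_witness[where i = flip_arc and j = flip_arc]) auto

text \<open>
  By balance, an edge and its reversal are visited equally often. So the shifted weights on the
  reversed graph are the reversals of the shifted weights, and the equality of the products of
  constants applies to \<open>\<alpha>\<close> and to \<open>\<alpha> + n\<close>.
\<close>

lemma (in weighted_graph) expectation_monomial_converse:
  assumes div: "\<And>x. x \<in> V \<Longrightarrow> divergence E \<alpha> x = 0" and bal: "balanced E \<kappa>"
  shows "(\<integral>\<rho>. monomial E \<kappa> (\<lambda>k. \<rho> (flip_arc k)) \<partial>env_law V (E\<inverse>) (rev_edge_fun \<alpha>) (rev_arc_fun Z))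
    = (\<integral>\<omega>. monomial E \<kappa> \<omega> \<partial>env_law V E \<alpha> Z)"
proof -
  let ?n = "out_count E \<kappa>" and ?\<kappa>' = "\<lambda>k. \<kappa> (flip_arc k)"
  let ?\<beta> = "\<lambda>e. \<alpha> e + real (?n e)"
  let ?\<beta>' = "\<lambda>f. rev_edge_fun \<alpha> f + real (out_count (E\<inverse>) ?\<kappa>' f)"
  interpret tilted: weighted_graph V E ?\<beta> Z by (rule add_weights)
  interpret conv: weighted_graph V "E\<inverse>" "rev_edge_fun \<alpha>" "rev_arc_fun Z" by (rule converse_graph)
  interpret conv_tilted: weighted_graph V "E\<inverse>" ?\<beta>' "rev_arc_fun Z" by (rule conv.add_weights)
  have "rev_edge_fun ?\<beta> f = ?\<beta>' f" if "f \<in> E\<inverse>" for f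
  proof -
    have "prod.swap f \<in> E" using that by (cases f) auto
    with bal show ?thesis by (simp add: rev_edge_fun_def count_converse balanced_def)
  qed
  then have "vertex_weight (E\<inverse>) (rev_edge_fun ?\<beta>) (rev_arc_fun Z) x u = vertex_weight (E\<inverse>) ?\<beta>' (rev_arc_fun Z) x u" for x u
    unfolding vertex_weight_def
    by (intro arg_cong2[where f = "(*)"] prod.cong refl) (auto simp: out_edges_def in_edges_def)
  then have "weighted_graph.vertex_const (E\<inverse>) (rev_edge_fun ?\<beta>) (rev_arc_fun Z) x = conv_tilted.vertex_const x" for x
    by (simp add: vertex_const_eq[OF tilted.converse_graph] conv_tilted.vertex_const_def)
  moreover have "divergence E ?\<beta> x = 0" if "x \<in> V" for x
    using div[OF that] divergence_out_count[OF bal] by (simp add: divergence_add)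
  ultimately have "(\<Prod>x\<in>V. tilted.vertex_const x) = (\<Prod>x\<in>V. conv_tilted.vertex_const x)"
    using tilted.prod_vertex_const_converse by simp
  moreover have "monomial (E\<inverse>) ?\<kappa>' (rev_arc_fun Z) = monomial E \<kappa> Z"
    unfolding monomial_converse by (simp add: monomial_def rev_arc_fun_def flip_arc_def)
  ultimately show ?thesis
    using conv.expectation_monomial[OF balanced_converse[OF bal]] prod_vertex_const_converse[OF div]
    by (simp add: expectation_monomial[OF bal] monomial_converse prod_dividef)
qed

text \<open>
  A single vertex without edges satisfies the hypotheses of the theorem. Both laws are then built
  from the same vertex law, which is the zero measure on the empty simplex.
\<close>

lemma env_law_empty:
  "env_law V {} \<alpha> Z = env_law V {} \<alpha>' Z'"
proof -
  have "vertex_law {} \<alpha> Z = vertex_law {} \<alpha>' Z'"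
    by (simp add: vertex_law_def vertex_weight_def out_edges_def in_edges_def fun_eq_iff)
  moreover have "env_of {} Z = env_of {} Z'"
    by (simp add: env_of_def arcs_def restrict_def fun_eq_iff)
  ultimately show ?thesis by (simp add: env_law_def)
qed

section \<open>Time reversal of the hypergeometric law\<close>

theorem corollary4p3:
  fixes V :: "'v set" and E :: "('v \<times> 'v) set"
    and \<alpha> :: "'v \<times> 'v \<Rightarrow> real" and Z :: "('v \<times> 'v) \<times> ('v \<times> 'v) \<Rightarrow> real"
  assumes "finite V" and "E \<subseteq> V \<times> V" and "graph_connected V E"
    and "\<And>e. e \<in> E \<Longrightarrow> \<alpha> e > 0"
    and "\<And>k. k \<in> arcs E \<Longrightarrow> Z k > 0"
    and "\<And>x. x \<in> V \<Longrightarrow> divergence E \<alpha> x = 0"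
  shows "distr (env_law V E \<alpha> Z) (env_space (E\<inverse>)) (time_reversal E)
         = env_law V (E\<inverse>) (rev_edge_fun \<alpha>) (rev_arc_fun Z)"
proof (cases "E = {}")
  case True
  let ?P = "env_law V {} \<alpha> Z"
  have sp: "space ?P = {\<lambda>_. undefined}"
    by (auto simp: env_law_def env_space_def space_restrict_space space_PiM environments_def arcs_def)
  have "distr ?P (env_space {}) (time_reversal {}) = distr ?P ?P id"
  proof (rule distr_cong)
    show "sets (env_space {}) = sets ?P" by (simp add: env_law_def)
    show "time_reversal {} \<omega> = id \<omega>" if "\<omega> \<in> space ?P" for \<omega>
      using that unfolding sp by (simp add: time_reversal_def arcs_def restrict_def fun_eq_iff)
  qed simp
  also have "\<dots> = env_law V {} (rev_edge_fun \<alpha>) (rev_arc_fun Z)"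
    by (simp add: distr_id[unfolded id_def] id_def env_law_empty[of V \<alpha> Z "rev_edge_fun \<alpha>" "rev_arc_fun Z"])
  finally show ?thesis using True by simp
next
  case False
  have reach: "(x, y) \<in> E\<^sup>*" if "x \<in> V" "y \<in> V" for x y
    using assms(3) that reachable_back_if_divergence_free[OF assms(1,2,4,6)]
    unfolding graph_connected_def by blast
  interpret weighted_graph V E \<alpha> Z
  proof
    show "out_edges E x \<noteq> {}" "in_edges E x \<noteq> {}" if "x \<in> V" for x
      using edges_at_vertex_nonempty[OF reach assms(2) False that] by auto
  qed (use assms in auto)
  have irr: "irreducible_relation E (arcs E)"
  proof
    show "(e, f) \<in> (arcs E)\<^sup>*" if "e \<in> E" "f \<in> E" for e f
      using that assms(2) by (intro arcs_path_if_path[OF reach]) auto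
  qed (use finite_E arcs_subset in auto)
  interpret conv: weighted_graph V "E\<inverse>" "rev_edge_fun \<alpha>" "rev_arc_fun Z" by (rule converse_graph)
  obtain r where r: "r \<in> E" using False by auto
  let ?P = "env_law V E \<alpha> Z" and ?Q = "env_law V (E\<inverse>) (rev_edge_fun \<alpha>) (rev_arc_fun Z)"
  let ?B = "loops E r"
  let ?L = "\<Pi>\<^sub>M \<kappa>\<in>?B. (borel :: real measure)"
  let ?X = "\<lambda>\<omega>. \<lambda>\<kappa>\<in>?B. monomial E \<kappa> \<omega>"
  let ?Y = "\<lambda>\<rho>. \<lambda>\<kappa>\<in>?B. monomial E \<kappa> (\<lambda>k. \<rho> (flip_arc k))"
  have finB: "finite ?B" using finite_E finite_arcs by (auto simp: loops_def)
  note bal = balanced_loops[OF irr r]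
  have X: "monomial E \<kappa> \<in> borel_measurable ?P" for \<kappa>
    unfolding measurable_cong_sets[OF sets_env_law refl] by (rule borel_measurable_monomial)
  have Y: "(\<lambda>\<rho>. monomial E \<kappa> (\<lambda>k. \<rho> (flip_arc k))) \<in> borel_measurable ?Q" for \<kappa>
    unfolding measurable_cong_sets[OF conv.sets_env_law refl] monomial_converse[symmetric]
    by (rule conv.borel_measurable_monomial)
  have monomial01: "monomial E \<kappa> \<omega> \<in> {0..1}" if "\<And>k. k \<in> arcs E \<Longrightarrow> 0 < \<omega> k \<and> \<omega> k \<le> 1" for \<kappa> \<omega>
    using that by (auto simp: monomial_def less_imp_le intro!: prod_nonneg prod_le_1 power_le_one)
  \<comment> \<open>the loop monomials have the same joint law on both sides\<close>
  have law_eq: "distr ?P ?L ?X = distr ?Q ?L ?Y"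
  proof (rule distr_PiM_eqI_moments[OF prob_space_env_law conv.prob_space_env_law finB X Y])
    show "monomial E \<kappa> \<omega> \<in> {0..1}" if "\<omega> \<in> space ?P" for \<kappa> \<omega>
      using environmentsD(1,2)[of \<omega> E] that by (intro monomial01) (simp add: space_env_law)
    show "monomial E \<kappa> (\<lambda>k. \<rho> (flip_arc k)) \<in> {0..1}" if "\<rho> \<in> space ?Q" for \<kappa> \<rho>
      using environmentsD(1,2)[of \<rho> "E\<inverse>"] that by (intro monomial01) (simp add: conv.space_env_law)
    fix m :: "_ \<Rightarrow> nat"
    show "(\<integral>\<omega>. (\<Prod>\<kappa>\<in>?B. monomial E \<kappa> \<omega> ^ m \<kappa>) \<partial>?P)
      = (\<integral>\<rho>. (\<Prod>\<kappa>\<in>?B. monomial E \<kappa> (\<lambda>k. \<rho> (flip_arc k)) ^ m \<kappa>) \<partial>?Q)"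
      unfolding monomial_sum[symmetric, where \<kappa> = "\<lambda>\<kappa>. \<kappa>"]
      by (rule expectation_monomial_converse[symmetric, OF assms(6) balanced_sum]) (use bal in auto)
  qed
  have Xm: "?X \<in> ?P \<rightarrow>\<^sub>M ?L" and Ym: "?Y \<in> ?Q \<rightarrow>\<^sub>M ?L"
    using X Y by (auto intro!: measurable_restrict)
  note \<Phi> = borel_measurable_reconstruct[OF finite_E r]
  \<comment> \<open>one reconstruction map serves both laws: here it produces the time reversal, below it returns its environment\<close>
  have rev_eq: "reconstruct E r (?X \<omega>) = time_reversal E \<omega>" if "\<omega> \<in> environments E" for \<omega>
    by (rule reconstruct_eq[OF irr r time_reversal_in_environments[OF irr that False]])
      (simp add: monomial_time_reversal[OF irr that False bal])
  have id_eq: "reconstruct E r (?Y \<rho>) = \<rho>" if "\<rho> \<in> environments (E\<inverse>)" for \<rho>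
    by (rule reconstruct_eq[OF irr r that]) simp
  have rev_m: "time_reversal E \<in> ?P \<rightarrow>\<^sub>M env_space (E\<inverse>)"
    unfolding env_space_def
  proof (rule measurable_restrict_space2)
    show "time_reversal E \<in> space ?P \<rightarrow> environments (E\<inverse>)"
      using time_reversal_in_environments[OF irr _ False] by (auto simp: space_env_law)
    have "(\<lambda>\<omega>. reconstruct E r (?X \<omega>)) \<in> ?P \<rightarrow>\<^sub>M (\<Pi>\<^sub>M k\<in>arcs (E\<inverse>). borel)"
      by (rule measurable_compose[OF Xm \<Phi>])
    then show "time_reversal E \<in> ?P \<rightarrow>\<^sub>M (\<Pi>\<^sub>M k\<in>arcs (E\<inverse>). borel)"
      by (rule measurable_cong[THEN iffD1, rotated]) (simp add: rev_eq space_env_law)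
  qed
  show ?thesis
  proof (rule measure_eqI)
    show "sets (distr ?P (env_space (E\<inverse>)) (time_reversal E)) = sets ?Q"
      by (simp add: conv.sets_env_law)
    fix A assume "A \<in> sets (distr ?P (env_space (E\<inverse>)) (time_reversal E))"
    then have A: "A \<in> sets (env_space (E\<inverse>))" by simp
    then obtain A' where A': "A' \<in> sets (\<Pi>\<^sub>M k\<in>arcs (E\<inverse>). (borel :: real measure))" "A = environments (E\<inverse>) \<inter> A'"
      unfolding env_space_def sets_restrict_space by auto
    let ?C = "reconstruct E r -` A' \<inter> space ?L"
    have C: "?C \<in> sets ?L" using measurable_sets[OF \<Phi> A'(1)] .
    have "time_reversal E -` A \<inter> space ?P = ?X -` ?C \<inter> space ?P"
      using rev_eq time_reversal_in_environments[OF irr _ False] measurable_space[OF Xm]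
      by (auto simp: A'(2) space_env_law)
    then have "emeasure (distr ?P (env_space (E\<inverse>)) (time_reversal E)) A = emeasure (distr ?P ?L ?X) ?C"
      using rev_m A Xm C by (simp add: emeasure_distr)
    also have "\<dots> = emeasure (distr ?Q ?L ?Y) ?C" by (simp only: law_eq)
    also have "\<dots> = emeasure ?Q (?Y -` ?C \<inter> space ?Q)" by (rule emeasure_distr[OF Ym C])
    also have "?Y -` ?C \<inter> space ?Q = A"
      using id_eq measurable_space[OF Ym] by (auto simp: A'(2) conv.space_env_law)
    finally show "emeasure (distr ?P (env_space (E\<inverse>)) (time_reversal E)) A = emeasure ?Q A" .
  qed
qed

end
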